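(* Let $E=(E^0,E^1,r,s)$ be a finite directed graph with no sinks and no sources, and let $n\ge 1$. Let $\pi:\mathcal{O}(E(n))\to \mathcal{B}(\mathcal{H}_E)/\mathfrak{K}$ be the $*$-homomorphism into the Calkin algebra determined by the Cuntz-Krieger $E(n)$-family $\{P_w,S_{(e,w)}: w\in E(n)^0,\ (e,w)\in E(n)^1\}$, where $P_w=q(Q_w)$ and $S_{(e,w)}=q(T_{(e,w)})$ (so $\pi$ carries the canonical generators of $\mathcal{O}(E(n))$ to this family). Then $\pi$ is a $*$-isomorphism of $\mathcal{O}(E(n))$ onto $\mathcal{B}(n)$.
   Context: Graphs and paths. No sinks and no sources means every vertex is $s(e)$ for some edge $e$ and $r(e')$ for some edge $e'$. $E^*$ is the set of all finite paths in $E$, vertices included as paths of length $0$. Paths compose right to left: $w_2w_1$ (defined when $s(w_2)=r(w_1)$) is $w_1$ followed by $w_2$. $|w|$ is the length of $w$; $E^{=n}=\{w\in E^*:|w|=n\}$, $E^{<n}=\{w\in E^*:|w|<n\}$. Every $w\in E^*$ factors uniquely as $w=w(n)\,v_k\cdots v_1$ with $v_i\in E^{=n}$ and $w(n)\in E^{<n}$; this defines $w(n)$. Operators. $\mathcal{H}_E=\ell^2(E^* )$ has orthonormal basis $\{\xi_w:w\in E^*\}$. A weighted shift on $\mathcal{H}_E$ with weights $\{\lambda(w):w\in E^*\setminus E^0\}$ is the family $(T_e)_{e\in E^1}$ with $T_e\xi_w=\lambda(ew)\xi_{ew}$ (zero if $s(e)\ne r(w)$). It is of period $n$ if $\lambda(w)$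 depends only on the length-reduced remainder, i.e. $T_e\xi_w=\lambda(ew)\xi_{ew}$ where the weight is that of the period-$n$ remainder $(ew)(n)$: the weight attached to passing from $w$ to $ew$ depends only on $e$ and $w(n)$. $\mathcal{A}(n)$ is the $C^*$-algebra generated by all the operators $T_e$, $e\in E^1$, from all period $n$ weighted shifts on $\mathcal{H}_E$; equivalently it is generated by the operators $T_{(e,w)}$ defined below. $\mathfrak{K}$ is the ideal of compact operators on $\mathcal{H}_E$; $R_x$ ($x\in E^0$) is the projection onto the closed span of $\{\xi_w:s(w)=x\}$; $\mathfrak{K}_E=\bigoplus_{x\in E^0}R_x\mathfrak{K}R_x$ is an ideal of $\mathcal{A}(n)$, and $\mathcal{B}(n)=\mathcal{A}(n)/\mathfrak{K}_E$, identified with $q(\mathcal{A}(n))$, where $q:\mathcal{B}(\mathcal{H}_E)\to\mathcal{B}(\mathcal{H}_E)/\mathfrak{K}$ is the quotient map onto the Calkin algebra. The graph $E(n)$. $E(n)^0=E^{<n}$; $E(n)^1=\{(e,w)\in E^1\times E^{<n}: s_E(e)=r_E(w)\}$; $s_{E(n)}(e,w)=w$; $r_{E(n)}(e,w)=ew$ if $|w|<n-1$ and $r_{E(n)}(e,w)=r_E(e)$ if $|w|=n-1$. The family. For $w\in E(n)^0$, $Q_w$ is the projection onto the closed span of $\{\xi_{w'}:w'(n)=w\}$. For $(e,w)\in E(n)^1$, $T_{(e,w)}\xi_{w'}=\xi_{ew'}$ if $w'(n)=w$, and $0$ otherwise. Cuntz-Krieger algebra. For a finite graph $F$, a Cuntz-Krieger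 (CK) $F$-family consists of mutually orthogonal projections $P_x$ ($x\in F^0$) and partial isometries $S_f$ ($f\in F^1$) with $S_f^*S_g=0$ for $f\ne g$, $S_f^*S_f=P_{s(f)}$, $\sum_{r(f)=x}S_fS_f^*\le P_x$, with equality whenever $r^{-1}(x)\ne\emptyset$. $\mathcal{O}(F)$ is the universal $C^*$-algebra generated by a CK $F$-family. The family $\{P_w,S_{(e,w)}\}$ of the claim is a CK $E(n)$-family. *)

theory Defs
  imports "HOL-Analysis.Analysis" "HOL-Algebra.QuotRing" "HOL-Algebra.Module"
    "Graph_Theory.Digraph" "Graph_Theory.Arc_Walk"
begin

typedef 'i ell2 = "{x :: 'i \<Rightarrow> complex. (\<lambda>i. (cmod (x i))\<^sup>2) summable_on UNIV}"
  morphisms coord Abs_ell2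
  by (rule exI[of _ "\<lambda>_. 0"]) simp

lemma coord_sq_summable: "(\<lambda>i. (cmod (coord x i))\<^sup>2) summable_on UNIV"
  using coord[of x] by simp

lemma sq_summable_add:
  fixes x y :: "'i \<Rightarrow> complex"
  assumes "(\<lambda>i. (cmod (x i))\<^sup>2) summable_on UNIV" "(\<lambda>i. (cmod (y i))\<^sup>2) summable_on UNIV"
  shows "(\<lambda>i. (cmod (x i + y i))\<^sup>2) summable_on UNIV"
proof (rule summable_on_comparison_test)
  show "(\<lambda>i. 2 * (cmod (x i))\<^sup>2 + 2 * (cmod (y i))\<^sup>2) summable_on UNIV"
    by (intro summable_on_add summable_on_cmult_right assms)
  fix i
  have "(cmod (x i + y i))\<^sup>2 \<le> (cmod (x i) + cmod (y i))\<^sup>2"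
    by (intro power_mono norm_triangle_ineq) auto
  also have "\<dots> \<le> 2 * (cmod (x i))\<^sup>2 + 2 * (cmod (y i))\<^sup>2"
    using sum_squares_bound[of "cmod (x i)" "cmod (y i)"] by (simp add: power2_sum)
  finally show "(cmod (x i + y i))\<^sup>2 \<le> 2 * (cmod (x i))\<^sup>2 + 2 * (cmod (y i))\<^sup>2" .
qed auto

lemma sq_summable_scale:
  fixes x :: "'i \<Rightarrow> complex"
  assumes "(\<lambda>i. (cmod (x i))\<^sup>2) summable_on UNIV"
  shows "(\<lambda>i. (cmod (c * x i))\<^sup>2) summable_on UNIV"
  unfolding norm_mult power_mult_distrib by (intro summable_on_cmult_right assms)

lemma coord_mult_abs_summable: "(\<lambda>i. norm (cnj (coord x i) * coord y i)) summable_on UNIV"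
proof (rule summable_on_comparison_test)
  show "(\<lambda>i. (cmod (coord x i))\<^sup>2 + (cmod (coord y i))\<^sup>2) summable_on UNIV"
    by (intro summable_on_add coord_sq_summable)
  fix i
  show "norm (cnj (coord x i) * coord y i) \<le> (cmod (coord x i))\<^sup>2 + (cmod (coord y i))\<^sup>2"
    using sum_squares_bound[of "cmod (coord x i)" "cmod (coord y i)"]
      zero_le_power2[of "cmod (coord x i)"] zero_le_power2[of "cmod (coord y i)"]
    unfolding norm_mult complex_mod_cnj by linarith
qed auto

lemma coord_mult_summable: "(\<lambda>i. cnj (coord x i) * coord y i) summable_on UNIV"
  by (rule abs_summable_summable[OF coord_mult_abs_summable])

definition scaleC :: "complex \<Rightarrow> 'i ell2 \<Rightarrow> 'i ell2"  (infixr "*\<^sub>C" 75)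
  where "c *\<^sub>C x = Abs_ell2 (\<lambda>i. c * coord x i)"

definition cinner :: "'i ell2 \<Rightarrow> 'i ell2 \<Rightarrow> complex"
  where "cinner x y = (\<Sum>\<^sub>\<infinity>i. cnj (coord x i) * coord y i)"

lemma coord_scaleC [simp]: "coord (c *\<^sub>C x) i = c * coord x i"
  by (simp add: scaleC_def Abs_ell2_inverse sq_summable_scale coord_sq_summable)

instantiation ell2 :: (type) real_inner
begin

definition "0 = Abs_ell2 (\<lambda>_::'a. 0)"
definition "x + y = Abs_ell2 (\<lambda>i::'a. coord x i + coord y i)"
definition "- x = (- 1) *\<^sub>C (x :: 'a ell2)"
definition "x - y = x + - (y :: 'a ell2)"
definition "r *\<^sub>R x = complex_of_real r *\<^sub>C (x :: 'a ell2)"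
definition "inner x y = Re (cinner x (y :: 'a ell2))"
definition "norm x = sqrt (\<Sum>\<^sub>\<infinity>i::'a. (cmod (coord x i))\<^sup>2)"
definition "sgn x = inverse (norm x) *\<^sub>R (x :: 'a ell2)"
definition "dist x y = norm (x - y :: 'a ell2)"
definition [code del]: "(uniformity :: ('a ell2 \<times> 'a ell2) filter) =
  (INF e\<in>{0<..}. principal {(x, y). dist x y < e})"
definition [code del]: "open (U :: 'a ell2 set) \<longleftrightarrow>
  (\<forall>x\<in>U. eventually (\<lambda>(x', y). x' = x \<longrightarrow> y \<in> U) uniformity)"

lemma coord_zero [simp]: "coord (0 :: 'a ell2) i = 0"
  by (simp add: zero_ell2_def Abs_ell2_inverse)

lemma coord_add [simp]: "coord (x + y :: 'a ell2) i = coord x i + coord y i"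
  by (simp add: plus_ell2_def Abs_ell2_inverse sq_summable_add coord_sq_summable)

lemma coord_uminus [simp]: "coord (- x :: 'a ell2) i = - coord x i"
  by (simp add: uminus_ell2_def)

lemma coord_diff [simp]: "coord (x - y :: 'a ell2) i = coord x i - coord y i"
  by (simp add: minus_ell2_def)

lemma coord_scaleR [simp]: "coord (r *\<^sub>R x :: 'a ell2) i = complex_of_real r * coord x i"
  by (simp add: scaleR_ell2_def)

lemma ell2_eqI: "(\<And>i. coord x i = coord y i) \<Longrightarrow> x = (y :: 'a ell2)"
  by (metis coord_inject ext)

lemma inner_ell2_infsum: "inner x (y :: 'a ell2) = (\<Sum>\<^sub>\<infinity>i. Re (cnj (coord x i) * coord y i))"
  unfolding inner_ell2_def cinner_def
  by (rule infsum_Re[symmetric, OF coord_mult_summable])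

lemma inner_self_ell2: "inner x (x :: 'a ell2) = (\<Sum>\<^sub>\<infinity>i. (cmod (coord x i))\<^sup>2)"
  unfolding inner_ell2_infsum by (simp add: cmod_def power2_eq_square)

instance
proof
  fix x y z :: "'a ell2" and a b r :: real
  have Re_summable: "(\<lambda>i. Re (cnj (coord u i) * coord v i)) summable_on UNIV" for u v :: "'a ell2"
    by (rule summable_on_Re[OF coord_mult_summable])
  show "dist x y = norm (x - y)" by (rule dist_ell2_def)
  show "sgn x = inverse (norm x) *\<^sub>R x" by (rule sgn_ell2_def)
  show "(uniformity :: ('a ell2 \<times> 'a ell2) filter) =
      (INF e\<in>{0<..}. principal {(x, y). dist x y < e})"
    by (rule uniformity_ell2_def)
  show "open U \<longleftrightarrow> (\<forall>x\<in>U. eventually (\<lambda>(x', y). x' = x \<longrightarrow> y \<in> U) uniformity)"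
    for U :: "'a ell2 set"
    by (rule open_ell2_def)
  show "x + y + z = x + (y + z)" "x + y = y + x" "0 + x = x" "- x + x = 0" "x - y = x + - y"
    "a *\<^sub>R (x + y) = a *\<^sub>R x + a *\<^sub>R y" "(a + b) *\<^sub>R x = a *\<^sub>R x + b *\<^sub>R x"
    "a *\<^sub>R b *\<^sub>R x = (a * b) *\<^sub>R x" "1 *\<^sub>R x = x"
    by (auto intro!: ell2_eqI simp: algebra_simps)
  show "inner x y = inner y x"
    unfolding inner_ell2_infsum by (intro infsum_cong) (simp add: mult.commute)
  show "inner (x + y) z = inner x z + inner y z"
    unfolding inner_ell2_infsum
    by (subst infsum_add[symmetric, OF Re_summable Re_summable])
      (simp add: algebra_simps)
  show "inner (r *\<^sub>R x) y = r * inner x y"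
    unfolding inner_ell2_infsum
    by (subst infsum_cmult_right'[symmetric]) (simp add: algebra_simps)
  show "0 \<le> inner x x"
    unfolding inner_self_ell2 by (intro infsum_nonneg) simp
  show "(inner x x = 0) = (x = 0)"
  proof
    assume *: "inner x x = 0"
    have "(cmod (coord x i))\<^sup>2 = 0" for i
      by (rule nonneg_infsum_le_0D[where A = UNIV])
        (use * coord_sq_summable[of x] in \<open>simp_all add: inner_self_ell2\<close>)
    then show "x = 0" by (intro ell2_eqI) simp
  qed (simp add: inner_self_ell2)
  show "norm x = sqrt (inner x x)"
    by (simp add: norm_ell2_def inner_self_ell2)
qed

end

definition ket :: "'i \<Rightarrow> 'i ell2"
  where "ket i = Abs_ell2 (\<lambda>j. if j = i then 1 else 0)"

lemma coord_ket [simp]: "coord (ket i) j = (if j = i then 1 else 0)"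
proof -
  have "(\<lambda>j. (cmod (if j = i then 1 else 0))\<^sup>2) summable_on UNIV"
    by (rule finite_nonzero_values_imp_summable_on) (rule finite_subset[of _ "{i}"], auto)
  then show ?thesis by (simp add: ket_def Abs_ell2_inverse)
qed

text \<open>The real span of all complex multiples is the complex span.\<close>

definition closed_cspan :: "'i ell2 set \<Rightarrow> 'i ell2 set"
  where "closed_cspan S = closure (span (\<Union>c. scaleC c ` S))"

text \<open>
  The library's bounded linear functions are only real-linear, so complex linearity is imposed
  separately.  The space of square-summable functions on a subset \<open>X\<close> of the index type is the
  closed span of the basis vectors indexed by \<open>X\<close>; a bounded operator on it is identified with its
  extension by zero to the orthogonal complement.
\<close>

type_synonym 'i op = "'i ell2 \<Rightarrow>\<^sub>L 'i ell2"

definition bounded_ops :: "'i set \<Rightarrow> 'i op set"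
  where "bounded_ops X = {T.
    (\<forall>c x. blinfun_apply T (c *\<^sub>C x) = c *\<^sub>C blinfun_apply T x) \<and>
    (\<forall>x. \<forall>i. i \<notin> X \<longrightarrow> coord (blinfun_apply T x) i = 0) \<and>
    (\<forall>x. (\<forall>i\<in>X. coord x i = 0) \<longrightarrow> blinfun_apply T x = 0)}"

definition compact_ops :: "'i set \<Rightarrow> 'i op set"
  where "compact_ops X =
    {T \<in> bounded_ops X. compact (closure (blinfun_apply T ` cball 0 1))}"

definition op_adj :: "'i op \<Rightarrow> 'i op"
  where "op_adj T =
    (THE S. \<forall>x y. cinner (blinfun_apply S x) y = cinner x (blinfun_apply T y))"

definition op_scale :: "complex \<Rightarrow> 'i op \<Rightarrow> 'i op"
  where "op_scale c T = Blinfun (\<lambda>x. c *\<^sub>C blinfun_apply T x)"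

definition orth_proj :: "'i ell2 set \<Rightarrow> 'i op"
  where "orth_proj M =
    (THE P. \<forall>x. blinfun_apply P x \<in> M \<and> (\<forall>y\<in>M. cinner y (x - blinfun_apply P x) = 0))"

text \<open>
  Complex *-algebras.  They are not assumed to be unital; the field \<open>one\<close> inherited from the library's
  record is never used.
\<close>

record 'a star_algebra = "(complex, 'a) module" +
  star :: "'a \<Rightarrow> 'a"
  nrm :: "'a \<Rightarrow> real"

definition op_algebra :: "'i set \<Rightarrow> 'i op star_algebra"
  where "op_algebra X =
    \<lparr>carrier = bounded_ops X, mult = (o\<^sub>L), one = orth_proj (closed_cspan (ket ` X)),
     zero = 0, add = (+), smult = op_scale, star = op_adj, nrm = norm\<rparr>"

definition quot :: "('a, 'b) star_algebra_scheme \<Rightarrow> 'a set \<Rightarrow> 'a set star_algebra"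
  where "quot A I =
    \<lparr>carrier = a_rcosets\<^bsub>A\<^esub> I, mult = rcoset_mult A I, one = I +>\<^bsub>A\<^esub> \<one>\<^bsub>A\<^esub>,
     zero = I, add = set_add A,
     smult = (\<lambda>c X. \<Union>a\<in>X. I +>\<^bsub>A\<^esub> (c \<odot>\<^bsub>A\<^esub> a)),
     star = (\<lambda>X. \<Union>a\<in>X. I +>\<^bsub>A\<^esub> star A a),
     nrm = (\<lambda>X. Inf (nrm A ` X))\<rparr>"

definition star_hom ::
  "('a \<Rightarrow> 'b) \<Rightarrow> ('a, 'c) star_algebra_scheme \<Rightarrow> ('b, 'd) star_algebra_scheme \<Rightarrow> bool"
  where "star_hom \<phi> A B \<longleftrightarrow>
    \<phi> \<in> carrier A \<rightarrow> carrier B \<and>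
    (\<forall>a\<in>carrier A. \<forall>b\<in>carrier A. \<phi> (a \<oplus>\<^bsub>A\<^esub> b) = \<phi> a \<oplus>\<^bsub>B\<^esub> \<phi> b) \<and>
    (\<forall>a\<in>carrier A. \<forall>b\<in>carrier A. \<phi> (a \<otimes>\<^bsub>A\<^esub> b) = \<phi> a \<otimes>\<^bsub>B\<^esub> \<phi> b) \<and>
    (\<forall>c. \<forall>a\<in>carrier A. \<phi> (c \<odot>\<^bsub>A\<^esub> a) = c \<odot>\<^bsub>B\<^esub> \<phi> a) \<and>
    (\<forall>a\<in>carrier A. \<phi> (star A a) = star B (\<phi> a))"

definition star_iso ::
  "('a \<Rightarrow> 'b) \<Rightarrow> ('a, 'c) star_algebra_scheme \<Rightarrow> ('b, 'd) star_algebra_scheme \<Rightarrow> bool"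
  where "star_iso \<phi> A B \<longleftrightarrow> star_hom \<phi> A B \<and> bij_betw \<phi> (carrier A) (carrier B)"

definition cstar_subalgebra :: "('a, 'b) star_algebra_scheme \<Rightarrow> 'a set \<Rightarrow> bool"
  where "cstar_subalgebra A B \<longleftrightarrow>
    B \<subseteq> carrier A \<and> \<zero>\<^bsub>A\<^esub> \<in> B \<and>
    (\<forall>a\<in>B. \<forall>b\<in>B. a \<oplus>\<^bsub>A\<^esub> b \<in> B \<and> a \<otimes>\<^bsub>A\<^esub> b \<in> B) \<and>
    (\<forall>c. \<forall>a\<in>B. c \<odot>\<^bsub>A\<^esub> a \<in> B) \<and> (\<forall>a\<in>B. star A a \<in> B) \<and>
    (\<forall>a\<in>carrier A. (\<forall>\<epsilon>>0. \<exists>b\<in>B. nrm A (a \<ominus>\<^bsub>A\<^esub> b) < \<epsilon>) \<longrightarrow> a \<in> B)"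

definition cstar_generated :: "('a, 'b) star_algebra_scheme \<Rightarrow> 'a set \<Rightarrow> 'a set"
  where "cstar_generated A S = \<Inter>{B. cstar_subalgebra A B \<and> S \<subseteq> B}"

text \<open>The order of a C*-algebra: \<open>b - a\<close> is positive, that is, of the form \<open>c* c\<close>.\<close>

definition star_le :: "('a, 'b) star_algebra_scheme \<Rightarrow> 'a \<Rightarrow> 'a \<Rightarrow> bool"
  where "star_le A a b \<longleftrightarrow> (\<exists>c\<in>carrier A. b = a \<oplus>\<^bsub>A\<^esub> (star A c \<otimes>\<^bsub>A\<^esub> c))"

definition cstar_seminorm :: "('a, 'b) star_algebra_scheme \<Rightarrow> ('a \<Rightarrow> real) \<Rightarrow> bool"
  where "cstar_seminorm A \<rho> \<longleftrightarrow>
    (\<forall>a\<in>carrier A. 0 \<le> \<rho> a) \<and>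
    (\<forall>a\<in>carrier A. \<forall>b\<in>carrier A. \<rho> (a \<oplus>\<^bsub>A\<^esub> b) \<le> \<rho> a + \<rho> b) \<and>
    (\<forall>c. \<forall>a\<in>carrier A. \<rho> (c \<odot>\<^bsub>A\<^esub> a) = cmod c * \<rho> a) \<and>
    (\<forall>a\<in>carrier A. \<forall>b\<in>carrier A. \<rho> (a \<otimes>\<^bsub>A\<^esub> b) \<le> \<rho> a * \<rho> b) \<and>
    (\<forall>a\<in>carrier A. \<rho> (star A a \<otimes>\<^bsub>A\<^esub> a) = (\<rho> a)\<^sup>2)"

text \<open>
  Separated completion with respect to \<open>nrm\<close> (which may be a seminorm): Cauchy sequences modulo
  null sequences.
\<close>

definition cauchy_seqs :: "('a, 'b) star_algebra_scheme \<Rightarrow> (nat \<Rightarrow> 'a) set"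
  where "cauchy_seqs A = {a. (\<forall>k. a k \<in> carrier A) \<and>
    (\<forall>\<epsilon>>0. \<exists>N. \<forall>j\<ge>N. \<forall>k\<ge>N. nrm A (a j \<ominus>\<^bsub>A\<^esub> a k) < \<epsilon>)}"

definition null_seqs :: "('a, 'b) star_algebra_scheme \<Rightarrow> (nat \<Rightarrow> 'a) set"
  where "null_seqs A = {a. (\<forall>k. a k \<in> carrier A) \<and> (\<lambda>k. nrm A (a k)) \<longlonglongrightarrow> 0}"

definition seq_algebra :: "('a, 'b) star_algebra_scheme \<Rightarrow> (nat \<Rightarrow> 'a) star_algebra"
  where "seq_algebra A =
    \<lparr>carrier = cauchy_seqs A, mult = (\<lambda>a b k. a k \<otimes>\<^bsub>A\<^esub> b k), one = (\<lambda>k. \<one>\<^bsub>A\<^esub>),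
     zero = (\<lambda>k. \<zero>\<^bsub>A\<^esub>), add = (\<lambda>a b k. a k \<oplus>\<^bsub>A\<^esub> b k),
     smult = (\<lambda>c a k. c \<odot>\<^bsub>A\<^esub> a k), star = (\<lambda>a k. star A (a k)),
     nrm = (\<lambda>a. lim (\<lambda>k. nrm A (a k)))\<rparr>"

definition completion :: "('a, 'b) star_algebra_scheme \<Rightarrow> (nat \<Rightarrow> 'a) set star_algebra"
  where "completion A = quot (seq_algebra A) (null_seqs A)"

definition to_completion :: "('a, 'b) star_algebra_scheme \<Rightarrow> 'a \<Rightarrow> (nat \<Rightarrow> 'a) set"
  where "to_completion A a = null_seqs A +>\<^bsub>seq_algebra A\<^esub> (\<lambda>k. a)"

definition ck_family ::
  "('v, 'e) pre_digraph \<Rightarrow> ('a, 'b) star_algebra_scheme \<Rightarrow> ('v \<Rightarrow> 'a) \<Rightarrow> ('e \<Rightarrow> 'a) \<Rightarrow> bool"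
  where "ck_family F A P S \<longleftrightarrow>
    P \<in> verts F \<rightarrow> carrier A \<and> S \<in> arcs F \<rightarrow> carrier A \<and>
    (\<forall>x\<in>verts F. P x \<otimes>\<^bsub>A\<^esub> P x = P x \<and> star A (P x) = P x) \<and>
    (\<forall>x\<in>verts F. \<forall>y\<in>verts F. x \<noteq> y \<longrightarrow> P x \<otimes>\<^bsub>A\<^esub> P y = \<zero>\<^bsub>A\<^esub>) \<and>
    (\<forall>f\<in>arcs F. S f \<otimes>\<^bsub>A\<^esub> star A (S f) \<otimes>\<^bsub>A\<^esub> S f = S f) \<and>
    (\<forall>f\<in>arcs F. \<forall>g\<in>arcs F. f \<noteq> g \<longrightarrow> star A (S f) \<otimes>\<^bsub>A\<^esub> S g = \<zero>\<^bsub>A\<^esub>) \<and>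
    (\<forall>f\<in>arcs F. star A (S f) \<otimes>\<^bsub>A\<^esub> S f = P (tail F f)) \<and>
    (\<forall>x\<in>verts F. star_le A (\<Oplus>\<^bsub>A\<^esub>f\<in>in_arcs F x. S f \<otimes>\<^bsub>A\<^esub> star A (S f)) (P x)) \<and>
    (\<forall>x\<in>verts F. in_arcs F x \<noteq> {} \<longrightarrow>
      (\<Oplus>\<^bsub>A\<^esub>f\<in>in_arcs F x. S f \<otimes>\<^bsub>A\<^esub> star A (S f)) = P x)"

text \<open>
  Free (non-unital) *-algebra on \<open>G\<close>: finitely supported functions on the nonempty words in the
  letters \<open>g\<close> and \<open>g*\<close>, encoded as \<open>(g, False)\<close> and \<open>(g, True)\<close>, with convolution as product.
  The parameter \<open>\<nu>\<close> is the seminorm it is equipped with.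
\<close>

type_synonym 'g star_poly = "('g \<times> bool) list \<Rightarrow> complex"

definition free_star_algebra :: "'g set \<Rightarrow> ('g star_poly \<Rightarrow> real) \<Rightarrow> 'g star_poly star_algebra"
  where "free_star_algebra G \<nu> =
    \<lparr>carrier = {a. finite {u. a u \<noteq> 0} \<and> (\<forall>u. a u \<noteq> 0 \<longrightarrow> u \<noteq> [] \<and> fst ` set u \<subseteq> G)},
     mult = (\<lambda>a b u. \<Sum>i\<le>length u. a (take i u) * b (drop i u)),
     one = undefined,
     zero = (\<lambda>u. 0),
     add = (\<lambda>a b u. a u + b u),
     smult = (\<lambda>c a u. c * a u),
     star = (\<lambda>a u. cnj (a (rev (map (\<lambda>(g, s). (g, \<not> s)) u)))),
     nrm = \<nu>\<rparr>"

definition gen :: "'g \<Rightarrow> 'g star_poly"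
  where "gen g = (\<lambda>u. if u = [(g, False)] then 1 else 0)"

definition ck_gens :: "('v, 'e) pre_digraph \<Rightarrow> ('v + 'e) set"
  where "ck_gens F = Inl ` verts F \<union> Inr ` arcs F"

text \<open>
  The C*-seminorms \<open>\<rho>\<close> on the free *-algebra on the vertices and edges of \<open>F\<close> for which the
  generators form a Cuntz-Krieger family in the quotient by the kernel of \<open>\<rho>\<close>.  These are exactly
  the seminorms \<open>a \<mapsto> \<parallel>\<phi> a\<parallel>\<close> where \<open>\<phi>\<close> sends the generators to a Cuntz-Krieger family in some
  C*-algebra.
\<close>

definition ck_seminorm :: "('v, 'e) pre_digraph \<Rightarrow> (('v + 'e) star_poly \<Rightarrow> real) \<Rightarrow> bool"
  where "ck_seminorm F \<rho> \<longleftrightarrow>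
    (let A = free_star_algebra (ck_gens F) \<rho>; I = {a \<in> carrier A. \<rho> a = 0} in
      cstar_seminorm A \<rho> \<and>
      ck_family F (quot A I) (\<lambda>x. I +>\<^bsub>A\<^esub> gen (Inl x)) (\<lambda>f. I +>\<^bsub>A\<^esub> gen (Inr f)))"

definition ck_free :: "('v, 'e) pre_digraph \<Rightarrow> ('v + 'e) star_poly star_algebra"
  where "ck_free F =
    free_star_algebra (ck_gens F) (\<lambda>a. SUP \<rho>\<in>{\<rho>. ck_seminorm F \<rho>}. \<rho> a)"

text \<open>
  The universal C*-algebra generated by a Cuntz-Krieger family of \<open>F\<close>: the completion of the
  free *-algebra in the largest C*-seminorm satisfying the Cuntz-Krieger relations.
\<close>

definition ck_algebra ::
  "('v, 'e) pre_digraph \<Rightarrow> (nat \<Rightarrow> ('v + 'e) star_poly) set star_algebra"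
  where "ck_algebra F = completion (ck_free F)"

definition ck_vert :: "('v, 'e) pre_digraph \<Rightarrow> 'v \<Rightarrow> (nat \<Rightarrow> ('v + 'e) star_poly) set"
  where "ck_vert F x = to_completion (ck_free F) (gen (Inl x))"

definition ck_arc :: "('v, 'e) pre_digraph \<Rightarrow> 'e \<Rightarrow> (nat \<Rightarrow> ('v + 'e) star_poly) set"
  where "ck_arc F f = to_completion (ck_free F) (gen (Inr f))"

text \<open>
  The source and range maps of a graph are \<^const>\<open>tail\<close> and \<^const>\<open>head\<close>.  A path is a pair of its
  source vertex and the list of its edges, written from right to left, so the edge traversed last
  comes first (whereas \<^const>\<open>pre_digraph.awalk\<close> lists the edges in the order of traversal).
\<close>

type_synonym ('v, 'e) path = "'v \<times> 'e list"

definition paths :: "('v, 'e) pre_digraph \<Rightarrow> ('v, 'e) path set"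
  where "paths E = {w. \<exists>y. pre_digraph.awalk E (fst w) (rev (snd w)) y}"

definition path_src :: "('v, 'e) path \<Rightarrow> 'v"
  where "path_src w = fst w"

definition path_range :: "('v, 'e) pre_digraph \<Rightarrow> ('v, 'e) path \<Rightarrow> 'v"
  where "path_range E w = (case snd w of [] \<Rightarrow> fst w | e # _ \<Rightarrow> head E e)"

definition path_len :: "('v, 'e) path \<Rightarrow> nat"
  where "path_len w = length (snd w)"

definition path_comp :: "('v, 'e) path \<Rightarrow> ('v, 'e) path \<Rightarrow> ('v, 'e) path"
  where "path_comp w2 w1 = (fst w1, snd w2 @ snd w1)"

definition path_cons :: "'e \<Rightarrow> ('v, 'e) path \<Rightarrow> ('v, 'e) path"
  where "path_cons e w = (fst w, e # snd w)"

text \<open>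
  The remainder \<open>w(n)\<close> in the factorisation \<open>w = w(n) v\<^sub>k \<dots> v\<^sub>1\<close> consists of the
  \<open>|w| mod n\<close> edges traversed last; the lemma \<open>path_rem_unique\<close> confirms that it is the one
  determined by this factorisation.
\<close>

definition path_rem :: "('v, 'e) pre_digraph \<Rightarrow> nat \<Rightarrow> ('v, 'e) path \<Rightarrow> ('v, 'e) path"
  where "path_rem E n w =
    (let m = path_len w mod n in (path_range E (fst w, drop m (snd w)), take m (snd w)))"

inductive factors ::
  "('v, 'e) pre_digraph \<Rightarrow> nat \<Rightarrow> ('v, 'e) path \<Rightarrow> ('v, 'e) path \<Rightarrow> bool"
  for E n u where
  "u \<in> paths E \<Longrightarrow> path_len u < n \<Longrightarrow> factors E n u u"
| "factors E n u w \<Longrightarrow> v \<in> paths E \<Longrightarrow> path_len v = n \<Longrightarrow> path_src w = path_range E v \<Longrightarrow>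
    factors E n u (path_comp w v)"

lemma (in wf_digraph) path_split:
  assumes "(x, p @ q) \<in> paths G"
  shows "(x, q) \<in> paths G" "(path_range G (x, q), p) \<in> paths G"
proof -
  from assms obtain y where y: "awalk x (rev q @ rev p) y"
    by (auto simp: paths_def)
  then have 1: "awalk x (rev q) (awlast x (rev q))" and 2: "awalk (awlast x (rev q)) (rev p) y"
    by auto
  from 1 show "(x, q) \<in> paths G" by (auto simp: paths_def)
  have "awlast x (rev q) = path_range G (x, q)"
  proof (cases q)
    case (Cons e q')
    with 1 have "awalk x (rev q' @ [e]) (awlast x (rev q))" by simp
    then have "awalk (awlast x (rev q')) [e] (awlast x (rev q))"
      by (simp only: awalk_append_iff)
    then have "awalk (head G e) [] (awlast x (rev q))"
      by (simp only: awalk_Cons_iff)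
    from awalk_empty_ends[OF this] show ?thesis by (simp add: path_range_def Cons)
  qed (simp add: path_range_def)
  with 2 show "(path_range G (x, q), p) \<in> paths G" by (auto simp: paths_def)
qed

lemma path_range_append: "path_range E (x, p @ q) = path_range E (path_range E (x, q), p)"
  by (cases p) (simp_all add: path_range_def)

lemma path_rem_append:
  assumes "length q = n"
  shows "path_rem E n (x, p @ q) = path_rem E n (path_range E (x, q), p)"
proof -
  define m where "m = length p mod n"
  have m: "m \<le> length p" "length (p @ q) mod n = m" using assms by (simp_all add: m_def)
  have "path_rem E n (x, p @ q) = (path_range E (x, drop m p @ q), take m p)"
    using m by (simp add: path_rem_def path_len_def del: length_append)
  then show ?thesis
    by (simp add: path_range_append path_rem_def path_len_def flip: m_def)
qed

lemma (in wf_digraph) path_rem_unique: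
  assumes "n \<ge> 1" "w \<in> paths G"
  shows "factors G n u w \<longleftrightarrow> u = path_rem G n w"
proof
  assume "factors G n u w"
  then show "u = path_rem G n w"
  proof induction
    case 1
    then show ?case by (simp add: path_rem_def path_range_def path_len_def prod_eq_iff)
  next
    case (2 w v)
    have "path_rem G n (path_comp w v) = path_rem G n (path_range G v, snd w)"
      using 2 path_rem_append[of "snd v" n G "fst v" "snd w"]
      by (simp add: path_comp_def path_len_def)
    also have "(path_range G v, snd w) = w"
      using 2 by (simp add: path_src_def prod_eq_iff)
    finally show ?case using 2 by simp
  qed
next
  have "factors G n (path_rem G n w) w"
    using assms(2)
  proof (induction "path_len w" arbitrary: w rule: less_induct)
    case less
    obtain x l where w: "w = (x, l)" by force
    show ?case
    proof (cases "length l < n")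
      case True
      then have "path_rem G n w = w" by (simp add: w path_rem_def path_range_def path_len_def)
      with True less(2) show ?thesis
        using factors.intros(1)[of w G n] by (simp add: w path_len_def)
    next
      case False
      define p where "p = take (length l - n) l"
      define q where "q = drop (length l - n) l"
      have l: "l = p @ q" and q: "length q = n" using False by (auto simp: p_def q_def)
      let ?v = "(x, q)" and ?w = "(path_range G (x, q), p)"
      have mem: "?v \<in> paths G" "?w \<in> paths G"
        using less(2) path_split[of x p q] by (auto simp: w l)
      have "path_len ?w < path_len w" using q assms(1) by (simp add: w l path_len_def)
      from less(1)[OF this mem(2)] have f: "factors G n (path_rem G n ?w) ?w" .
      have c: "path_comp ?w ?v = w" by (simp add: path_comp_def w l)
      have "factors G n (path_rem G n ?w) (path_comp ?w ?v)"
        by (rule factors.intros(2)[OF f mem(1)]) (simp_all add: q path_len_def path_src_def)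
      moreover have "path_rem G n ?w = path_rem G n w"
        using path_rem_append[OF q, of G x p] by (simp add: w l)
      ultimately show ?thesis by (simp add: c)
    qed
  qed
  then show "u = path_rem G n w \<Longrightarrow> factors G n u w" by simp
qed

definition path_graph ::
  "('v, 'e) pre_digraph \<Rightarrow> nat \<Rightarrow> (('v, 'e) path, 'e \<times> ('v, 'e) path) pre_digraph"
  where "path_graph E n =
    \<lparr>verts = {w \<in> paths E. path_len w < n},
     arcs = {(e, w). e \<in> arcs E \<and> w \<in> paths E \<and> path_len w < n \<and> tail E e = path_range E w},
     tail = (\<lambda>(e, w). w),
     head = (\<lambda>(e, w). if path_len w < n - 1 then path_cons e w else (head E e, []))\<rparr>"

text \<open>Only the weights \<open>lam w\<close> of paths \<open>w\<close> of positive length are used.\<close>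

definition weighted_shift ::
  "('v, 'e) pre_digraph \<Rightarrow> (('v, 'e) path \<Rightarrow> complex) \<Rightarrow> ('e \<Rightarrow> ('v, 'e) path op) \<Rightarrow> bool"
  where "weighted_shift E lam T \<longleftrightarrow>
    (\<forall>e\<in>arcs E. T e \<in> bounded_ops (paths E) \<and>
      (\<forall>w\<in>paths E. blinfun_apply (T e) (ket w) =
        (if tail E e = path_range E w then lam (path_cons e w) *\<^sub>C ket (path_cons e w) else 0)))"

definition has_period :: "('v, 'e) pre_digraph \<Rightarrow> nat \<Rightarrow> (('v, 'e) path \<Rightarrow> complex) \<Rightarrow> bool"
  where "has_period E n lam \<longleftrightarrow>
    (\<forall>e\<in>arcs E. \<forall>w\<in>paths E. \<forall>w'\<in>paths E.
      tail E e = path_range E w \<longrightarrow> tail E e = path_range E w' \<longrightarrow>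
      path_rem E n w = path_rem E n w' \<longrightarrow> lam (path_cons e w) = lam (path_cons e w'))"

definition shift_algebra :: "('v, 'e) pre_digraph \<Rightarrow> nat \<Rightarrow> ('v, 'e) path op set"
  where "shift_algebra E n = cstar_generated (op_algebra (paths E))
    {T e | T e lam. e \<in> arcs E \<and> weighted_shift E lam T \<and> has_period E n lam}"

definition calkin_algebra :: "('v, 'e) pre_digraph \<Rightarrow> ('v, 'e) path op set star_algebra"
  where "calkin_algebra E = quot (op_algebra (paths E)) (compact_ops (paths E))"

definition calkin_map :: "('v, 'e) pre_digraph \<Rightarrow> ('v, 'e) path op \<Rightarrow> ('v, 'e) path op set"
  where "calkin_map E T = compact_ops (paths E) +>\<^bsub>op_algebra (paths E)\<^esub> T"

definition src_proj :: "('v, 'e) pre_digraph \<Rightarrow> 'v \<Rightarrow> ('v, 'e) path op"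
  where "src_proj E x = orth_proj (closed_cspan (ket ` {w \<in> paths E. path_src w = x}))"

definition src_compacts :: "('v, 'e) pre_digraph \<Rightarrow> ('v, 'e) path op set"
  where "src_compacts E =
    {(\<Sum>x\<in>verts E. src_proj E x o\<^sub>L K x o\<^sub>L src_proj E x) | K.
      \<forall>x\<in>verts E. K x \<in> compact_ops (paths E)}"

definition BD_algebra :: "('v, 'e) pre_digraph \<Rightarrow> nat \<Rightarrow> ('v, 'e) path op set star_algebra"
  where "BD_algebra E n =
    quot (op_algebra (paths E) \<lparr>carrier := shift_algebra E n\<rparr>) (src_compacts E)"

definition BD_image :: "('v, 'e) pre_digraph \<Rightarrow> nat \<Rightarrow> ('v, 'e) path op set star_algebra"
  where "BD_image E n =
    calkin_algebra E \<lparr>carrier := calkin_map E ` shift_algebra E n\<rparr>"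

text \<open>The canonical map \<open>T + \<KK>\<^sub>E \<mapsto> T + \<KK>\<close> by which the quotient \<open>\<B>(n)\<close> is identified with \<open>q(\<A>(n))\<close>.\<close>

definition BD_to_calkin ::
  "('v, 'e) pre_digraph \<Rightarrow> ('v, 'e) path op set \<Rightarrow> ('v, 'e) path op set"
  where "BD_to_calkin E X = (\<Union>T\<in>X. calkin_map E T)"

definition rem_proj :: "('v, 'e) pre_digraph \<Rightarrow> nat \<Rightarrow> ('v, 'e) path \<Rightarrow> ('v, 'e) path op"
  where "rem_proj E n w = orth_proj (closed_cspan (ket ` {w' \<in> paths E. path_rem E n w' = w}))"

definition edge_shift ::
  "('v, 'e) pre_digraph \<Rightarrow> nat \<Rightarrow> 'e \<times> ('v, 'e) path \<Rightarrow> ('v, 'e) path op"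
  where "edge_shift E n = (\<lambda>(e, w). THE T. T \<in> bounded_ops (paths E) \<and>
    (\<forall>w'\<in>paths E. blinfun_apply T (ket w') =
      (if path_rem E n w' = w then ket (path_cons e w') else 0)))"

text \<open>
  The *-homomorphism from the Cuntz-Krieger algebra of \<open>E(n)\<close> to the Calkin algebra that is
  determined by the images of the projections \<open>Q\<^sub>w\<close> and of the operators \<open>T\<^sub>(\<^sub>e\<^sub>,\<^sub>w\<^sub>)\<close>.
\<close>

definition induced_hom ::
  "('v, 'e) pre_digraph \<Rightarrow> nat \<Rightarrow>
    ((nat \<Rightarrow> (('v, 'e) path + 'e \<times> ('v, 'e) path) star_poly) set \<Rightarrow> ('v, 'e) path op set) \<Rightarrow> bool"
  where "induced_hom E n \<pi> \<longleftrightarrow>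
    star_hom \<pi> (ck_algebra (path_graph E n)) (calkin_algebra E) \<and>
    (\<forall>w\<in>verts (path_graph E n). \<pi> (ck_vert (path_graph E n) w) = calkin_map E (rem_proj E n w)) \<and>
    (\<forall>f\<in>arcs (path_graph E n). \<pi> (ck_arc (path_graph E n) f) = calkin_map E (edge_shift E n f))"

end

theory Submission
  imports Defs "HOL-Library.Function_Algebras"
begin

text \<open>
  Let \<open>\<psi>\<close> denote the evaluation of *-polynomials in the generators of \<open>\<O>(E(n))\<close> at the
  operators \<open>Q\<^sub>w\<close> and \<open>T\<^sub>(\<^sub>e\<^sub>,\<^sub>w\<^sub>)\<close>.  These satisfy the Cuntz-Krieger relations up to
  finite-rank operators: \<open>Q\<^sub>w\<close> exceeds the sum of the range projections of the edges ending at
  \<open>w\<close> by the projection onto the paths of length zero with remainder \<open>w\<close>.  The norm of the Calkin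
  algebra is \<open>ess T = inf \<parallel>T(1 - P\<^sub>D)\<parallel>\<close>, where \<open>P\<^sub>D\<close> runs over the coordinate projections of
  finite sets \<open>D\<close> of paths.  So \<open>\<sigma> a = ess (\<psi> a)\<close> is one of the seminorms over which the norm of
  \<open>\<O>(E(n))\<close> is a supremum.

  The heart of the proof is that \<open>\<sigma>\<close> is the largest of them (\<open>gauge_invariant_uniqueness\<close>).  Let
  \<open>\<rho>\<close> be another one.  Modulo the relations, a polynomial of degree \<open>k - l\<close> is a combination of
  products \<open>S\<^sub>\<mu> S\<^sub>\<nu>*\<close> of paths of fixed lengths \<open>k\<close> and \<open>l\<close>; these are finitely many and behave
  like matrix units, so reading off coefficients gives \<open>\<rho> \<le> K \<sigma>\<close> on their span.  For \<open>k = l\<close>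
  the span is an algebra, and by the C*-identity \<open>\<rho>(h)\<^sup>N = \<rho>(h\<^sup>N) \<le> K \<sigma>(h\<^sup>N) = K \<sigma>(h)\<^sup>N\<close> for
  self-adjoint \<open>h\<close> and \<open>N = 2\<^sup>m\<close>, whence \<open>\<rho> \<le> \<sigma>\<close> there, and then on all homogeneous elements.  A
  polynomial of degree at most \<open>D\<close> has \<open>2D + 1\<close> homogeneous components, and averaging over the
  gauge action, under which \<open>\<sigma>\<close> is invariant, shows that \<open>\<sigma>\<close> of each component is at most \<open>\<sigma>\<close>
  of the polynomial; so \<open>\<rho> \<le> (2D + 1) \<sigma>\<close>.  The degree of \<open>h\<^sup>N\<close> grows only linearly in
  \<open>N\<close>, and taking \<open>N\<close>-th roots once more gives \<open>\<rho> \<le> \<sigma>\<close>.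

  Consequently an element of \<open>\<O>(E(n))\<close> is a sequence of polynomials that is Cauchy for \<open>\<sigma>\<close>, modulo
  null sequences.  The algebra \<open>\<A>(n)\<close> contains all finite coordinate projections, hence every
  such sequence has an essential limit \<open>T \<in> \<A>(n)\<close> (\<open>lift_Cauchy\<close>), and every \<open>T \<in> \<A>(n)\<close> arises in
  this way (\<open>esslim_of_A\<close>).  Sending the sequence to the class of \<open>T\<close> is the homomorphism whose
  existence is claimed.  A homomorphism with the prescribed values on generators is not assumed
  continuous, but it is contractive: if \<open>\<parallel>S\<parallel> < 1\<close> then \<open>1 - S*S = (1 - b)\<^sup>2\<close> for a
  self-adjoint \<open>b \<in> \<A>(n)\<close>, and applying the homomorphism to this identity bounds the image of
  \<open>S\<close> (\<open>hom_contractive_unit\<close>).  So there is only one such homomorphism, and it is isometric with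
  range \<open>q(\<A>(n))\<close>.

  Finally \<open>\<A>(n)\<close> commutes with the projections \<open>R\<^sub>x\<close>, so a compact \<open>T \<in> \<A>(n)\<close> equals
  \<open>\<Sum>\<^sub>x R\<^sub>x T R\<^sub>x\<close>; thus \<open>\<A>(n)\<close> meets the compact operators inside \<open>\<KK>\<^sub>E\<close>, and
  \<open>T + \<KK>\<^sub>E \<mapsto> T + \<KK>\<close> is injective (\<open>BD_iso\<close>).
\<close>

section \<open>The Hilbert space of square-summable functions\<close>

lemma ell2_norm_sq: "(norm (x :: 'i ell2))\<^sup>2 = (\<Sum>\<^sub>\<infinity>i. (cmod (coord x i))\<^sup>2)"
  by (simp add: norm_ell2_def infsum_nonneg)

lemma finite_sum_coord_le:
  "finite F \<Longrightarrow> (\<Sum>i\<in>F. (cmod (coord (x :: 'i ell2) i))\<^sup>2) \<le> (norm x)\<^sup>2"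
  unfolding ell2_norm_sq by (rule finite_sum_le_infsum) (auto intro: coord_sq_summable)

lemma coord_norm_le: "cmod (coord x i) \<le> norm (x :: 'i ell2)"
  by (rule power2_le_imp_le) (use finite_sum_coord_le[of "{i}" x] in auto)

lemma ell2_norm_leI:
  assumes "\<And>F. finite F \<Longrightarrow> (\<Sum>i\<in>F. (cmod (coord (x :: 'i ell2) i))\<^sup>2) \<le> B\<^sup>2" "0 \<le> B"
  shows "norm x \<le> B"
proof -
  have "(norm x)\<^sup>2 \<le> B\<^sup>2"
    unfolding ell2_norm_sq by (rule infsum_le_finite_sums) (auto intro: coord_sq_summable assms(1))
  then show ?thesis using assms(2) by (rule power2_le_imp_le)
qed

lemma coord_Abs_ell2:
  assumes "\<And>F. finite F \<Longrightarrow> (\<Sum>i\<in>F. (cmod (v i))\<^sup>2) \<le> B"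
  shows "coord (Abs_ell2 v) = v"
proof -
  have "(\<lambda>i. (cmod (v i))\<^sup>2) summable_on UNIV"
    by (rule nonneg_bdd_above_summable_on) (auto intro!: bdd_aboveI[of _ B] assms)
  then show ?thesis by (simp add: Abs_ell2_inverse)
qed

text \<open>
  A Cauchy sequence converges coordinatewise.  The estimate for the tail is made on finite sets
  of coordinates, where it survives the limit, and therefore holds for the norm.
\<close>

instance ell2 :: (type) banach
proof
  fix X :: "nat \<Rightarrow> 'a ell2"
  assume X: "Cauchy X"
  have "Cauchy (\<lambda>n. coord (X n) i)" for i
  proof (rule metric_CauchyI)
    fix e :: real assume "0 < e"
    then obtain M where "\<forall>m\<ge>M. \<forall>n\<ge>M. dist (X m) (X n) < e" using X by (meson metric_CauchyD)
    then show "\<exists>M. \<forall>m\<ge>M. \<forall>n\<ge>M. dist (coord (X m) i) (coord (X n) i) < e"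
      by (metis (no_types, lifting) coord_diff coord_norm_le dist_norm order_le_less_trans)
  qed
  then have "convergent (\<lambda>n. coord (X n) i)" for i by (rule Cauchy_convergent)
  then obtain l where l: "\<And>i. (\<lambda>n. coord (X n) i) \<longlonglongrightarrow> l i"
    unfolding convergent_def by metis
  have tail: "\<exists>N. \<forall>n\<ge>N. \<forall>F. finite F \<longrightarrow> (\<Sum>i\<in>F. (cmod (coord (X n) i - l i))\<^sup>2) \<le> e\<^sup>2"
    if e: "0 < e" for e
  proof -
    obtain N where N: "\<And>m n. m \<ge> N \<Longrightarrow> n \<ge> N \<Longrightarrow> dist (X m) (X n) < e"
      using X e by (meson metric_CauchyD)
    have "(\<Sum>i\<in>F. (cmod (coord (X n) i - l i))\<^sup>2) \<le> e\<^sup>2" if n: "n \<ge> N" and F: "finite F" for n F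
    proof (rule LIMSEQ_le_const2)
      show "(\<lambda>m. \<Sum>i\<in>F. (cmod (coord (X n) i - coord (X m) i))\<^sup>2)
          \<longlonglongrightarrow> (\<Sum>i\<in>F. (cmod (coord (X n) i - l i))\<^sup>2)"
        by (intro tendsto_intros l)
      have "(\<Sum>i\<in>F. (cmod (coord (X n) i - coord (X m) i))\<^sup>2) \<le> e\<^sup>2" if "m \<ge> N" for m
      proof -
        have "(\<Sum>i\<in>F. (cmod (coord (X n - X m) i))\<^sup>2) \<le> (norm (X n - X m))\<^sup>2"
          by (rule finite_sum_coord_le[OF F])
        also have "\<dots> \<le> e\<^sup>2"
          using N[OF n that] by (intro power_mono) (auto simp: dist_norm)
        finally show ?thesis by simp
      qed
      then show "\<exists>M. \<forall>m\<ge>M. (\<Sum>i\<in>F. (cmod (coord (X n) i - coord (X m) i))\<^sup>2) \<le> e\<^sup>2" by blast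
    qed
    then show ?thesis by blast
  qed
  obtain N where N: "\<And>F. finite F \<Longrightarrow> (\<Sum>i\<in>F. (cmod (coord (X N) i - l i))\<^sup>2) \<le> 1\<^sup>2"
    using tail[of 1] by auto
  have d: "coord (Abs_ell2 (\<lambda>i. coord (X N) i - l i)) = (\<lambda>i. coord (X N) i - l i)"
    by (rule coord_Abs_ell2[of _ "1\<^sup>2"]) (rule N)
  define L where "L = X N - Abs_ell2 (\<lambda>i. coord (X N) i - l i)"
  have L: "coord L i = l i" for i by (simp add: L_def d)
  have "X \<longlonglongrightarrow> L"
  proof (rule metric_LIMSEQ_I)
    fix e :: real assume e: "0 < e"
    then obtain M where M: "\<And>n F. n \<ge> M \<Longrightarrow> finite F \<Longrightarrow>
        (\<Sum>i\<in>F. (cmod (coord (X n) i - l i))\<^sup>2) \<le> (e/2)\<^sup>2"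
      using tail[of "e/2"] by auto
    have "dist (X n) L < e" if "n \<ge> M" for n
    proof -
      have "norm (X n - L) \<le> e/2"
        by (rule ell2_norm_leI) (use M[OF that] e in \<open>auto simp: L\<close>)
      then show ?thesis using e by (simp add: dist_norm)
    qed
    then show "\<exists>M. \<forall>n\<ge>M. dist (X n) L < e" by blast
  qed
  then show "convergent X" by (auto simp: convergent_def)
qed

lemma scaleC_simps [simp]:
  "c *\<^sub>C (0 :: 'i ell2) = 0" "0 *\<^sub>C (x :: 'i ell2) = 0" "1 *\<^sub>C x = x"
  "a *\<^sub>C b *\<^sub>C x = (a * b) *\<^sub>C x"
  by (auto intro!: ell2_eqI)

lemma scaleC_distrib:
  "c *\<^sub>C (x + y) = c *\<^sub>C x + c *\<^sub>C (y :: 'i ell2)" "c *\<^sub>C (x - y) = c *\<^sub>C x - c *\<^sub>C y"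
  "(a + b) *\<^sub>C x = a *\<^sub>C x + b *\<^sub>C x" "(a - b) *\<^sub>C x = a *\<^sub>C x - b *\<^sub>C x"
  "c *\<^sub>C (- x) = - (c *\<^sub>C x)" "c *\<^sub>C r *\<^sub>R x = r *\<^sub>R c *\<^sub>C x"
  "r *\<^sub>R x = complex_of_real r *\<^sub>C x"
  by (auto intro!: ell2_eqI simp: algebra_simps)

lemma scaleC_eq_scaleR: "complex_of_real r *\<^sub>C x = r *\<^sub>R (x :: 'i ell2)"
  by (auto intro!: ell2_eqI)

lemma norm_scaleC [simp]: "norm (c *\<^sub>C x) = cmod c * norm (x :: 'i ell2)"
  by (simp add: norm_ell2_def norm_mult power_mult_distrib infsum_cmult_right' real_sqrt_mult)

lemma cinner_add_left: "cinner (x + y) z = cinner x z + cinner y z"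
  unfolding cinner_def
  by (subst infsum_add[symmetric, OF coord_mult_summable coord_mult_summable])
    (simp add: algebra_simps)

lemma cinner_add_right: "cinner z (x + y) = cinner z x + cinner z y"
  unfolding cinner_def
  by (subst infsum_add[symmetric, OF coord_mult_summable coord_mult_summable])
    (simp add: algebra_simps)

lemma cinner_scaleC_left [simp]: "cinner (c *\<^sub>C x) y = cnj c * cinner x y"
  unfolding cinner_def by (subst infsum_cmult_right'[symmetric]) (simp add: mult.assoc)

lemma cinner_scaleC_right [simp]: "cinner x (c *\<^sub>C y) = c * cinner x y"
  unfolding cinner_def by (subst infsum_cmult_right'[symmetric]) (simp add: algebra_simps)

lemma cinner_zero [simp]: "cinner 0 x = 0" "cinner x 0 = 0"
  by (simp_all add: cinner_def)

lemma cinner_diff_left: "cinner (x - y) z = cinner x z - cinner y z"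
  by (metis add_diff_cancel cinner_add_left diff_add_cancel)

lemma cinner_diff_right: "cinner z (x - y) = cinner z x - cinner z y"
  by (metis add_diff_cancel cinner_add_right diff_add_cancel)

lemma cinner_commute: "cinner y x = cnj (cinner x y)"
  unfolding cinner_def by (subst infsum_cnj[symmetric]) (simp add: mult.commute)

lemma Re_cinner: "Re (cinner x y) = inner x y"
  by (simp add: inner_ell2_def)

lemma cinner_self: "cinner x x = complex_of_real ((norm x)\<^sup>2)"
proof -
  have "Im (cinner x x) = 0" using cinner_commute[of x x] by (simp add: complex_eq_iff)
  moreover have "Re (cinner x x) = (norm x)\<^sup>2" by (simp add: Re_cinner power2_norm_eq_inner)
  ultimately show ?thesis by (simp add: complex_eq_iff)
qed

text \<open>
  The real inner product controls only the real part, so one vector is first rotated by the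
  phase that makes the complex inner product nonnegative.
\<close>

lemma cinner_cauchy_schwarz: "cmod (cinner x y) \<le> norm x * norm y"
proof (cases "cinner x y = 0")
  case False
  define c where "c = cnj (cinner x y) / cmod (cinner x y)"
  have c: "cmod c = 1" using False by (simp add: c_def norm_divide)
  have "c * cinner x y = cmod (cinner x y)"
    using False complex_norm_square[of "cinner x y"]
    by (simp add: c_def power2_eq_square field_simps)
  then have "cmod (cinner x y) = Re (cinner x (c *\<^sub>C y))" by simp
  also have "\<dots> \<le> norm x * norm (c *\<^sub>C y)" by (simp only: Re_cinner norm_cauchy_schwarz)
  finally show ?thesis by (simp add: c)
qed simp

lemma cinner_ket_left [simp]: "cinner (ket i) x = coord x i"
  unfolding cinner_def
  by (subst infsum_cong_neutral[where T = "{i}" and g = "\<lambda>j. coord x j"]) auto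

lemma cinner_ket_right [simp]: "cinner x (ket i) = cnj (coord x i)"
  by (subst cinner_commute) simp

lemma norm_ket [simp]: "norm (ket i) = 1"
proof -
  have "complex_of_real ((norm (ket i))\<^sup>2) = 1"
    unfolding cinner_self[symmetric] cinner_ket_left by simp
  then have "(norm (ket i))\<^sup>2 = 1" by (simp only: of_real_eq_1_iff)
  then show ?thesis by (metis abs_norm_cancel power2_eq_1_iff abs_1 abs_minus_cancel)
qed

section \<open>Bounded operators\<close>

lemma Blinfun_op:
  assumes "\<And>x y. f (x + y) = f x + f y" "\<And>c x. f (c *\<^sub>C x) = c *\<^sub>C f x"
    and "\<And>x. norm (f x) \<le> K * norm (x :: 'i ell2)"
  shows "blinfun_apply (Blinfun f) = (f :: 'i ell2 \<Rightarrow> 'j ell2)"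
proof -
  have "bounded_linear f"
    by (rule bounded_linear_intro[where K = K]) (use assms in \<open>auto simp: scaleC_distrib(7) mult.commute\<close>)
  then show ?thesis by (rule bounded_linear_Blinfun_apply)
qed

text \<open>
  The type of operators consists of real-linear maps, so complex linearity is a predicate.
\<close>

definition clin :: "'i op \<Rightarrow> bool"
  where "clin T \<longleftrightarrow> (\<forall>c x. T (c *\<^sub>C x) = c *\<^sub>C T x)"

lemma clinD [simp]: "clin T \<Longrightarrow> T (c *\<^sub>C x) = c *\<^sub>C T x"
  by (simp add: clin_def)

text \<open>The weighted shift along a partial injection \<open>g\<close> with domain \<open>D\<close>.\<close>

definition wshift :: "'i set \<Rightarrow> ('i \<Rightarrow> 'i) \<Rightarrow> ('i \<Rightarrow> complex) \<Rightarrow> 'i op"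
  where "wshift D g c = Blinfun (\<lambda>x. Abs_ell2 (\<lambda>j. if j \<in> g ` D
    then c (inv_into D g j) * coord x (inv_into D g j) else 0))"

context
  fixes D :: "'i set" and g :: "'i \<Rightarrow> 'i" and c :: "'i \<Rightarrow> complex"
  assumes inj: "inj_on g D" and c: "\<And>i. i \<in> D \<Longrightarrow> cmod (c i) \<le> 1"
begin

lemma wshift_sum_le:
  assumes "finite F"
  shows "(\<Sum>j\<in>F. (cmod (if j \<in> g ` D then c (inv_into D g j) * coord x (inv_into D g j) else 0))\<^sup>2)
    \<le> (norm x)\<^sup>2"
proof -
  have "(\<Sum>j\<in>F. (cmod (if j \<in> g ` D then c (inv_into D g j) * coord x (inv_into D g j) else 0))\<^sup>2)
      = (\<Sum>j\<in>F \<inter> g ` D. (cmod (c (inv_into D g j) * coord x (inv_into D g j)))\<^sup>2)"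
    using assms by (intro sum.mono_neutral_cong_right) auto
  also have "\<dots> \<le> (\<Sum>j\<in>F \<inter> g ` D. (cmod (coord x (inv_into D g j)))\<^sup>2)"
    using c by (intro sum_mono power_mono) (auto simp: norm_mult inv_into_into mult_left_le_one_le)
  also have "\<dots> = (\<Sum>i\<in>inv_into D g ` (F \<inter> g ` D). (cmod (coord x i))\<^sup>2)"
    by (rule sum.reindex_cong[OF inj_on_inv_into refl refl, symmetric]) auto
  also have "\<dots> \<le> (norm x)\<^sup>2"
    using assms by (intro finite_sum_coord_le) auto
  finally show ?thesis .
qed

lemma wshift_coord_aux:
  "coord (Abs_ell2 (\<lambda>j. if j \<in> g ` D then c (inv_into D g j) * coord x (inv_into D g j) else 0))
    = (\<lambda>j. if j \<in> g ` D then c (inv_into D g j) * coord x (inv_into D g j) else 0)"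
  by (rule coord_Abs_ell2) (rule wshift_sum_le)

lemma wshift_apply: "wshift D g c x =
  Abs_ell2 (\<lambda>j. if j \<in> g ` D then c (inv_into D g j) * coord x (inv_into D g j) else 0)"
  unfolding wshift_def
  by (subst Blinfun_op[where K = 1])
    (auto intro!: ell2_eqI ell2_norm_leI wshift_sum_le simp: wshift_coord_aux algebra_simps)

lemma wshift_coord: "coord (wshift D g c x) j =
  (if j \<in> g ` D then c (inv_into D g j) * coord x (inv_into D g j) else 0)"
  unfolding wshift_apply wshift_coord_aux ..

lemma wshift_ket: "wshift D g c (ket i) = (if i \<in> D then c i *\<^sub>C ket (g i) else 0)"
  by (rule ell2_eqI) (auto simp: wshift_coord inj inv_into_f_f f_inv_into_f inv_into_into)

lemma norm_wshift_le: "norm (wshift D g c) \<le> 1"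
proof (rule norm_blinfun_bound)
  show "norm (wshift D g c x) \<le> 1 * norm x" for x
    by (rule ell2_norm_leI) (auto simp only: wshift_coord mult_1 wshift_sum_le norm_ge_zero)
qed simp

lemma wshift_bounded_ops:
  assumes "D \<subseteq> X" "g ` D \<subseteq> X"
  shows "wshift D g c \<in> bounded_ops X"
  unfolding bounded_ops_def using assms
  by (auto intro!: ell2_eqI simp: wshift_coord inv_into_into subset_iff)

end

definition restr :: "'i set \<Rightarrow> 'i op"
  where "restr F = wshift F id (\<lambda>_. 1)"

lemma restr_coord [simp]: "coord (restr F x) i = (if i \<in> F then coord x i else 0)"
  unfolding restr_def by (subst wshift_coord) (auto simp: inv_into_f_f inv_into_f_eq)

lemma norm_restr_le: "norm (restr F) \<le> 1"
  unfolding restr_def by (rule norm_wshift_le) auto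

lemma norm_restr_apply_le: "norm (restr F x) \<le> norm x"
  using norm_blinfun[of "restr F" x] norm_restr_le[of F] mult_left_le_one_le[of "norm x" "norm (restr F)"]
  by simp

lemma restr_restr: "restr F o\<^sub>L restr G = restr (F \<inter> G)"
  by (rule blinfun_eqI) (auto intro!: ell2_eqI)

lemma restr_restr_apply [simp]: "restr F (restr G x) = restr (F \<inter> G) x"
  by (auto intro!: ell2_eqI)

lemma restr_ket [simp]: "restr F (ket i) = (if i \<in> F then ket i else 0)"
  by (auto intro!: ell2_eqI)

lemma restr_UNIV [simp]: "restr UNIV x = x"
  by (auto intro!: ell2_eqI)

lemma restr_Compl: "restr (- F) x = x - restr F x"
  by (auto intro!: ell2_eqI)

lemma clin_restr [simp]: "clin (restr F)"
  by (auto simp: clin_def intro!: ell2_eqI)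

lemma coord_sum_ket: "finite F \<Longrightarrow> coord (\<Sum>i\<in>F. v i *\<^sub>C ket i) j = (if j \<in> F then v j else 0)"
  by (induction F rule: finite_induct) auto

lemma restr_finite: "finite F \<Longrightarrow> restr F x = (\<Sum>i\<in>F. coord x i *\<^sub>C ket i)"
  by (rule ell2_eqI) (simp add: coord_sum_ket)

lemma restr_approx:
  assumes "0 < e"
  shows "\<exists>F. finite F \<and> norm (restr (- F) (x :: 'i ell2)) < e"
proof -
  let ?f = "\<lambda>i. (cmod (coord x i))\<^sup>2"
  obtain F where F: "finite F" "dist (sum ?f F) (infsum ?f UNIV) \<le> (e/2)\<^sup>2"
    using infsum_finite_approximation[OF coord_sq_summable[of x], of "(e/2)\<^sup>2"] assms by auto
  have "norm (restr (- F) x) \<le> e/2"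
  proof (rule ell2_norm_leI)
    fix G :: "'i set" assume G: "finite G"
    have "(\<Sum>i\<in>G. (cmod (coord (restr (- F) x) i))\<^sup>2) = sum ?f (G - F)"
      using G by (intro sum.mono_neutral_cong_right) auto
    also have "\<dots> = sum ?f (G \<union> F) - sum ?f F"
      using G F(1) sum.subset_diff[of F "G \<union> F" ?f] by (auto simp: Un_Diff)
    also have "\<dots> \<le> infsum ?f UNIV - sum ?f F"
      using finite_sum_coord_le[of "G \<union> F" x] G F(1) by (simp add: ell2_norm_sq)
    also have "\<dots> \<le> (e/2)\<^sup>2" using F(2) by (simp add: dist_real_def)
    finally show "(\<Sum>i\<in>G. (cmod (coord (restr (- F) x) i))\<^sup>2) \<le> (e/2)\<^sup>2" .
  qed (use assms in simp)
  then show ?thesis using F(1) assms by (intro exI[of _ F]) auto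
qed

text \<open>
  Finite linear combinations of basis vectors are dense.
\<close>

lemma op_eqI_ket:
  assumes "clin S" "clin T" "\<And>i. S (ket i) = T (ket i)"
  shows "S = T"
proof (rule blinfun_eqI)
  fix x
  have "norm (S x - T x) \<le> e" if e: "0 < e" for e
  proof -
    \<comment> \<open>The summand 1 keeps the divisor positive when the operators already agree.\<close>
    define N where "N = norm (S - T) + 1"
    have N: "N > 0" by (simp add: N_def add_nonneg_pos)
    obtain F where F: "finite F" "norm (restr (- F) x) < e / N"
      using restr_approx[of "e / N" x] e N by auto
    have "S (restr F x) = T (restr F x)"
      using F(1) assms by (simp add: restr_finite blinfun.sum_right)
    then have "S x - T x = (S - T) (restr (- F) x)"
      by (simp add: restr_Compl blinfun.diff_left blinfun.diff_right)
    also have "norm \<dots> \<le> norm (S - T) * norm (restr (- F) x)" by (rule norm_blinfun)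
    also have "\<dots> \<le> N * (e / N)"
      using F(2) by (intro mult_mono) (auto simp: N_def add_nonneg_nonneg)
    finally show ?thesis using N by simp
  qed
  then have "norm (S x - T x) \<le> 0" by (rule field_le_epsilon[where y = 0, simplified])
  then show "S x = T x" by simp
qed

lemma op_eqI_cinner:
  assumes "clin S" "clin T" "\<And>i j. cinner (ket j) (S (ket i)) = cinner (ket j) (T (ket i))"
  shows "S = T"
  using assms by (intro op_eqI_ket) (auto intro!: ell2_eqI)

subsection \<open>Adjoints\<close>

lemma cinner_ext: "(\<And>y. cinner x y = cinner x' y) \<Longrightarrow> x = x'"
  by (rule ell2_eqI) (metis cinner_ket_right complex_cnj_cancel_iff)

text \<open>
  The coordinates of \<open>T* x\<close> must be \<open>\<langle>T e\<^sub>i, x\<rangle>\<close>.  They are square-summable: for a finite set of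
  indices, pairing \<open>x\<close> with the image under \<open>T\<close> of the vector with exactly these coordinates
  gives the sum of their squares.
\<close>

lemma adjoint_exists:
  fixes T :: "'i op"
  assumes T: "clin T"
  shows "\<exists>S :: 'i op. clin S \<and> (\<forall>x y. cinner (S x) y = cinner x (T y))"
proof -
  let ?v = "\<lambda>x i. cinner (T (ket i)) x"
  have bd: "(\<Sum>i\<in>F. (cmod (?v x i))\<^sup>2) \<le> (norm T * norm x)\<^sup>2" if F: "finite F" for x F
  proof -
    \<comment> \<open>Since \<open>\<langle>T y, x\<rangle> = s\<close> and \<open>\<parallel>y\<parallel> \<le> sqrt s\<close>, boundedness of \<open>T\<close> bounds \<open>s\<close>.\<close>
    define y where "y = (\<Sum>i\<in>F. ?v x i *\<^sub>C ket i)"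
    define s where "s = (\<Sum>i\<in>F. (cmod (?v x i))\<^sup>2)"
    have s0: "0 \<le> s" by (simp add: s_def sum_nonneg)
    have cy: "coord y i = (if i \<in> F then ?v x i else 0)" for i
      using F by (simp add: y_def coord_sum_ket)
    have ny: "norm y \<le> sqrt s"
    proof (rule ell2_norm_leI)
      fix G :: "'i set" assume "finite G"
      have "(\<Sum>i\<in>G. (cmod (coord y i))\<^sup>2) = (\<Sum>i\<in>G \<inter> F. (cmod (?v x i))\<^sup>2)"
        using \<open>finite G\<close> by (intro sum.mono_neutral_cong_right) (auto simp: cy)
      also have "\<dots> \<le> s" unfolding s_def using F by (intro sum_mono2) auto
      finally show "(\<Sum>i\<in>G. (cmod (coord y i))\<^sup>2) \<le> (sqrt s)\<^sup>2" using s0 by simp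
    qed (simp add: s0)
    have "cinner (T y) x = (\<Sum>i\<in>F. cnj (?v x i) * ?v x i)"
    proof -
      have "cinner (sum f F) x = (\<Sum>i\<in>F. cinner (f i) x)" for f
        using F by (induction F) (auto simp: cinner_add_left)
      then show ?thesis using T by (simp add: y_def blinfun.sum_right)
    qed
    also have "\<dots> = complex_of_real s"
      by (simp add: s_def mult.commute flip: complex_norm_square)
    finally have "s = cmod (cinner (T y) x)" using s0 by simp
    also have "\<dots> \<le> norm (T y) * norm x" by (rule cinner_cauchy_schwarz)
    also have "\<dots> \<le> norm T * sqrt s * norm x"
      using order_trans[OF norm_blinfun[of T y] mult_left_mono[OF ny]]
      by (intro mult_right_mono) auto
    finally have *: "sqrt s * sqrt s \<le> sqrt s * (norm T * norm x)" using s0 by (simp add: algebra_simps)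
    have "sqrt s \<le> norm T * norm x"
    proof (cases "s = 0")
      case False
      then have "0 < sqrt s" using s0 by simp
      with * show ?thesis by (simp only: mult_le_cancel_left_pos)
    qed simp
    then have "(sqrt s)\<^sup>2 \<le> (norm T * norm x)\<^sup>2" using s0 by (intro power_mono) auto
    then show ?thesis using s0 by (simp add: s_def)
  qed
  define f where "f x = Abs_ell2 (?v x)" for x
  have f: "coord (f x) i = ?v x i" for x i
    unfolding f_def by (subst coord_Abs_ell2[OF bd]) auto
  have f2: "blinfun_apply (Blinfun f) = f"
  proof (rule Blinfun_op)
    show "norm (f x) \<le> norm T * norm x" for x
      by (rule ell2_norm_leI) (use bd in \<open>auto simp: f\<close>)
  qed (auto intro!: ell2_eqI simp: f cinner_add_right)
  have "cinner (f x) y = cinner x (T y)" for x y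
  proof -
    have "cmod (cinner (f x) y - cinner x (T y)) \<le> e" if e: "0 < e" for e
    proof -
      define N where "N = norm (f x) + norm x * norm T + 1"
      have N: "N > 0" by (simp add: N_def add_nonneg_pos)
      obtain F where F: "finite F" "norm (restr (- F) y) < e / N"
        using restr_approx[of "e / N" y] e N by auto
      let ?r = "restr (- F) y"
      have sr: "cinner z (sum h F) = (\<Sum>i\<in>F. cinner z (h i))" for h z
        using F(1) by (induction F) (auto simp: cinner_add_right)
      have "cinner (f x) (restr F y) = cinner x (T (restr F y))"
        using F(1) T by (simp add: restr_finite blinfun.sum_right sr f flip: cinner_commute)
      then have "cinner (f x) y - cinner x (T y) = cinner (f x) ?r - cinner x (T ?r)"
        by (simp add: restr_Compl blinfun.diff_right cinner_diff_right)
      also have "cmod \<dots> \<le> cmod (cinner (f x) ?r) + cmod (cinner x (T ?r))"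
        by (rule norm_triangle_ineq4)
      also have "\<dots> \<le> norm (f x) * norm ?r + norm x * (norm T * norm ?r)"
        by (intro add_mono order_trans[OF cinner_cauchy_schwarz] mult_left_mono norm_blinfun) auto
      also have "\<dots> \<le> N * norm ?r" by (simp add: N_def algebra_simps)
      also have "\<dots> \<le> N * (e / N)" using F(2) N by (intro mult_left_mono) auto
      finally show ?thesis using N by simp
    qed
    then have "cmod (cinner (f x) y - cinner x (T y)) \<le> 0" by (rule field_le_epsilon[where y = 0, simplified])
    then show ?thesis by simp
  qed
  moreover have "clin (Blinfun f)" by (auto simp: clin_def f2 f intro!: ell2_eqI)
  ultimately show ?thesis using f2 by metis
qed

lemma op_adj_eqI:
  fixes S T :: "'i op"
  assumes "\<And>x y. cinner (S x) y = cinner x (T y)"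
  shows "op_adj T = S"
  unfolding op_adj_def
proof (rule the_equality)
  show "\<forall>x y. cinner (S x) y = cinner x (T y)" using assms by blast
  show "S' = S" if "\<forall>x y. cinner (S' x) y = cinner x (T y)" for S' :: "'i op"
    by (intro blinfun_eqI cinner_ext) (simp add: that assms)
qed

lemma op_adj_both:
  assumes "clin T"
  shows "clin (op_adj T) \<and> (\<forall>x y. cinner (op_adj T x) y = cinner x (T y))"
proof -
  obtain S :: "'a op" where S: "clin S" "\<And>x y. cinner (S x) y = cinner x (T y)"
    using adjoint_exists[OF assms] by blast
  from op_adj_eqI[of S T, OF S(2)] S show ?thesis by simp
qed

lemma clin_adj [simp]: "clin T \<Longrightarrow> clin (op_adj T)"
  and cinner_adj_left: "clin T \<Longrightarrow> cinner (op_adj T x) y = cinner x (T y)"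
  using op_adj_both by blast+

lemma cinner_adj_right: "clin T \<Longrightarrow> cinner x (op_adj T y) = cinner (T x) y"
  using cinner_commute[of x "op_adj T y"] cinner_adj_left[of T y x] cinner_commute[of "T x" y] by simp

lemma op_adj_eqI_ket:
  assumes "clin S" "clin T" "\<And>i j. cinner (ket j) (S (ket i)) = cinner (T (ket j)) (ket i)"
  shows "op_adj T = S"
proof (rule op_eqI_cinner)
  fix i j
  show "cinner (ket j) (op_adj T (ket i)) = cinner (ket j) (S (ket i))"
    by (simp only: cinner_adj_right[OF assms(2)] assms(3))
qed (simp_all add: assms)

lemma clin_ops [simp]:
  "clin 0" "clin S \<Longrightarrow> clin T \<Longrightarrow> clin (S + T)" "clin S \<Longrightarrow> clin T \<Longrightarrow> clin (S - T)"
  "clin S \<Longrightarrow> clin (- S)" "clin S \<Longrightarrow> clin T \<Longrightarrow> clin (S o\<^sub>L T)" "clin id_blinfun"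
  by (auto simp: clin_def blinfun.add_left blinfun.diff_left blinfun.minus_left scaleC_distrib(1,2,5))

lemma op_scale_apply [simp]: "op_scale c T x = c *\<^sub>C T x"
proof -
  have "bounded_linear (\<lambda>x. c *\<^sub>C T x)"
  proof (rule bounded_linear_intro[where K = "cmod c * norm T"])
    show "norm (c *\<^sub>C T x) \<le> norm x * (cmod c * norm T)" for x
      using mult_left_mono[OF norm_blinfun[of T x], of "cmod c"] by (simp add: algebra_simps)
  qed (simp_all add: blinfun.add_right blinfun.scaleR_right scaleC_distrib(1,6))
  then show ?thesis unfolding op_scale_def by (simp add: bounded_linear_Blinfun_apply)
qed

lemma clin_op_scale [simp]: "clin T \<Longrightarrow> clin (op_scale c T)"
  by (auto simp: clin_def mult.commute)

lemma norm_op_scale [simp]: "norm (op_scale c T) = cmod c * norm T"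
proof -
  have le: "norm (op_scale c T) \<le> cmod c * norm T" for c and T :: "'a op"
    by (rule norm_blinfun_bound) (auto simp: mult.assoc intro: mult_left_mono norm_blinfun)
  show ?thesis
  proof (cases "c = 0")
    case False
    have "T = op_scale (inverse c) (op_scale c T)" using False by (intro blinfun_eqI) simp
    then have "norm T \<le> cmod (inverse c) * norm (op_scale c T)" by (metis le)
    then have "cmod c * norm T \<le> norm (op_scale c T)"
      using False by (simp add: norm_inverse norm_divide field_simps)
    with le[of c T] show ?thesis by simp
  qed (use le[of 0 T] in simp)
qed

lemma op_scale_simps:
  "op_scale c (S + T) = op_scale c S + op_scale c T" "op_scale c (S - T) = op_scale c S - op_scale c T"
  "op_scale (a + b) T = op_scale a T + op_scale b T"
  "op_scale a (op_scale b T) = op_scale (a * b) T" "op_scale 1 T = T" "op_scale 0 T = 0"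
  "op_scale c 0 = 0" "op_scale (-1) T = - T"
  "op_scale c S o\<^sub>L T = op_scale c (S o\<^sub>L T)"
  "clin S \<Longrightarrow> S o\<^sub>L op_scale c T = op_scale c (S o\<^sub>L T)"
  "op_scale (complex_of_real r) T = r *\<^sub>R T"
  by (auto intro!: blinfun_eqI simp: blinfun.add_left blinfun.diff_left scaleC_distrib(1-5)
      blinfun.minus_left blinfun.scaleR_left scaleC_eq_scaleR)
    (auto intro!: ell2_eqI)

lemma adj_adj [simp]: "clin T \<Longrightarrow> op_adj (op_adj T) = T"
  by (rule op_adj_eqI) (simp add: cinner_adj_right)

lemma adj_comp: "clin S \<Longrightarrow> clin T \<Longrightarrow> op_adj (S o\<^sub>L T) = op_adj T o\<^sub>L op_adj S"
  by (rule op_adj_eqI) (simp add: cinner_adj_left)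

lemma adj_add: "clin S \<Longrightarrow> clin T \<Longrightarrow> op_adj (S + T) = op_adj S + op_adj T"
  by (rule op_adj_eqI) (simp add: cinner_adj_left blinfun.add_left cinner_add_left cinner_add_right)

lemma adj_diff: "clin S \<Longrightarrow> clin T \<Longrightarrow> op_adj (S - T) = op_adj S - op_adj T"
  by (rule op_adj_eqI) (simp add: cinner_adj_left blinfun.diff_left cinner_diff_left cinner_diff_right)

lemma adj_scale: "clin T \<Longrightarrow> op_adj (op_scale c T) = op_scale (cnj c) (op_adj T)"
  by (rule op_adj_eqI) (simp add: cinner_adj_left)

lemma adj_0 [simp]: "op_adj 0 = 0"
  by (rule op_adj_eqI) simp

lemma adj_restr [simp]: "op_adj (restr F) = restr F"
  by (rule op_adj_eqI_ket) (auto)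

lemma norm_sq_adj_comp: "clin T \<Longrightarrow> (norm (T x))\<^sup>2 \<le> norm (op_adj T o\<^sub>L T) * (norm x)\<^sup>2"
proof -
  assume T: "clin T"
  have "complex_of_real ((norm (T x))\<^sup>2) = cinner x ((op_adj T o\<^sub>L T) x)"
    using T by (simp add: cinner_adj_right cinner_self)
  then have "(norm (T x))\<^sup>2 = cmod (cinner x ((op_adj T o\<^sub>L T) x))"
    by (metis abs_of_nonneg norm_of_real zero_le_power2)
  also have "\<dots> \<le> norm x * (norm (op_adj T o\<^sub>L T) * norm x)"
    by (intro order_trans[OF cinner_cauchy_schwarz] mult_left_mono norm_blinfun) auto
  finally show ?thesis by (simp add: power2_eq_square algebra_simps)
qed

lemma norm_sq_le_adj_comp: "clin T \<Longrightarrow> (norm T)\<^sup>2 \<le> norm (op_adj T o\<^sub>L T)"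
proof -
  assume T: "clin T"
  have "norm T \<le> sqrt (norm (op_adj T o\<^sub>L T))"
  proof (rule norm_blinfun_bound)
    fix x
    have "norm (T x) = sqrt ((norm (T x))\<^sup>2)" by simp
    also have "\<dots> \<le> sqrt (norm (op_adj T o\<^sub>L T) * (norm x)\<^sup>2)"
      using norm_sq_adj_comp[OF T] by (simp only: real_sqrt_le_iff)
    finally show "norm (T x) \<le> sqrt (norm (op_adj T o\<^sub>L T)) * norm x" by (simp add: real_sqrt_mult)
  qed simp
  then have "(norm T)\<^sup>2 \<le> (sqrt (norm (op_adj T o\<^sub>L T)))\<^sup>2" by (intro power_mono) auto
  then show ?thesis by simp
qed

lemma norm_adj [simp]: "clin T \<Longrightarrow> norm (op_adj T) = norm T"
proof -
  have le: "norm T \<le> norm (op_adj T)" if T: "clin T" for T :: "'a op"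
  proof (cases "norm T = 0")
    case False
    have "norm T * norm T \<le> norm (op_adj T) * norm T"
      using norm_sq_le_adj_comp[OF T] norm_blinfun_compose[of "op_adj T" T]
      by (simp add: power2_eq_square)
    then show ?thesis using False by simp
  qed simp
  assume "clin T"
  then show ?thesis using le[of T] le[of "op_adj T"] by simp
qed

subsection \<open>Operators supported on a set of basis vectors\<close>

lemma bounded_ops_iff: "T \<in> bounded_ops X \<longleftrightarrow> clin T \<and> restr X o\<^sub>L T = T \<and> T o\<^sub>L restr X = T"
proof
  assume T: "T \<in> bounded_ops X"
  have "T (x - restr X x) = 0" for x
    using T unfolding bounded_ops_def by (auto simp del: coord_diff simp: restr_Compl[symmetric])
  then have "T (restr X x) = T x" for x by (simp add: blinfun.diff_right)
  with T show "clin T \<and> restr X o\<^sub>L T = T \<and> T o\<^sub>L restr X = T"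
    by (auto simp: bounded_ops_def clin_def intro!: blinfun_eqI ell2_eqI)
next
  assume T: "clin T \<and> restr X o\<^sub>L T = T \<and> T o\<^sub>L restr X = T"
  have "coord (T x) i = 0" if "i \<notin> X" for x i
  proof -
    have "coord (restr X (T x)) i = 0" using that by simp
    then show ?thesis using T by (metis blinfun_apply_blinfun_compose)
  qed
  moreover have "T x = 0" if "\<forall>i\<in>X. coord x i = 0" for x
  proof -
    have "restr X x = 0" using that by (auto intro!: ell2_eqI)
    then show ?thesis using T by (metis blinfun_apply_blinfun_compose blinfun.zero_right)
  qed
  ultimately show "T \<in> bounded_ops X" using T by (auto simp: bounded_ops_def clin_def)
qed

lemma bounded_ops_clin [simp]: "T \<in> bounded_ops X \<Longrightarrow> clin T"
  by (simp add: bounded_ops_iff)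

lemma bounded_ops_closed [intro]:
  "0 \<in> bounded_ops X"
  "S \<in> bounded_ops X \<Longrightarrow> T \<in> bounded_ops X \<Longrightarrow> S + T \<in> bounded_ops X"
  "S \<in> bounded_ops X \<Longrightarrow> T \<in> bounded_ops X \<Longrightarrow> S - T \<in> bounded_ops X"
  "S \<in> bounded_ops X \<Longrightarrow> - S \<in> bounded_ops X"
  "S \<in> bounded_ops X \<Longrightarrow> T \<in> bounded_ops X \<Longrightarrow> S o\<^sub>L T \<in> bounded_ops X"
  "S \<in> bounded_ops X \<Longrightarrow> op_scale c S \<in> bounded_ops X"
  unfolding bounded_ops_def
  by (auto simp: blinfun.add_left blinfun.diff_left blinfun.minus_left scaleC_distrib(1-5) mult.commute)

lemma bounded_ops_adj [intro]: "T \<in> bounded_ops X \<Longrightarrow> op_adj T \<in> bounded_ops X"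
  using adj_comp[of "restr X" T] adj_comp[of T "restr X"] by (simp add: bounded_ops_iff)

lemma bounded_ops_ket_0: "T \<in> bounded_ops X \<Longrightarrow> i \<notin> X \<Longrightarrow> T (ket i) = 0"
  unfolding bounded_ops_def mem_Collect_eq
  by (elim conjE, erule allE[where x = "ket i" and P = "\<lambda>x. (\<forall>i\<in>X. coord x i = 0) \<longrightarrow> T x = 0"]) auto

lemma bounded_ops_eqI:
  assumes "S \<in> bounded_ops X" "T \<in> bounded_ops X" "\<And>i. i \<in> X \<Longrightarrow> S (ket i) = T (ket i)"
  shows "S = T"
proof (rule op_eqI_ket)
  show "S (ket i) = T (ket i)" for i
    using assms(3)[of i] bounded_ops_ket_0[OF assms(1), of i] bounded_ops_ket_0[OF assms(2), of i]
    by (cases "i \<in> X") simp_all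
qed (use assms(1,2) in simp_all)

lemma restr_bounded_ops: "F \<subseteq> X \<Longrightarrow> restr F \<in> bounded_ops X"
  by (auto simp: bounded_ops_iff restr_restr Int_absorb1 Int_absorb2)

lemma closed_cspan_ket: "closed_cspan (ket ` X) = {x. restr X x = x}"
proof
  let ?S = "span (\<Union>c. scaleC c ` ket ` X)"
  have "?S \<subseteq> {x. restr X x = x}"
    by (rule span_minimal) (auto simp: subspace_def blinfun.add_right blinfun.scaleR_right)
  moreover have "closed {x. restr X x = x}"
    by (rule closed_Collect_eq) (auto intro!: continuous_intros)
  ultimately show "closed_cspan (ket ` X) \<subseteq> {x. restr X x = x}"
    unfolding closed_cspan_def by (rule closure_minimal)
  show "{x. restr X x = x} \<subseteq> closed_cspan (ket ` X)"
  proof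
    fix x assume "x \<in> {x. restr X x = x}"
    then have x: "restr X x = x" by simp
    show "x \<in> closed_cspan (ket ` X)"
      unfolding closed_cspan_def closure_approachable
    proof (intro allI impI)
      fix e :: real assume "0 < e"
      then obtain F where F: "finite F" "norm (restr (- F) x) < e" using restr_approx by blast
      let ?y = "restr F x"
      have "?y = restr (F \<inter> X) x" by (metis restr_restr_apply x)
      also have "\<dots> = (\<Sum>i\<in>F \<inter> X. coord x i *\<^sub>C ket i)" using F by (simp add: restr_finite)
      also have "\<dots> \<in> ?S" by (intro span_sum span_base) blast
      finally have "?y \<in> ?S" .
      moreover have "dist ?y x < e" using F(2) by (simp add: restr_Compl dist_norm norm_minus_commute)
      ultimately show "\<exists>y\<in>?S. dist y x < e" by blast
    qed
  qed
qed

lemma orth_proj_ket: "orth_proj (closed_cspan (ket ` X)) = restr X"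
  unfolding orth_proj_def closed_cspan_ket
proof (rule the_equality)
  have "cinner y (x - restr X x) = 0" if "restr X y = y" for x y
  proof -
    have "cinner y (restr (- X) x) = cinner (restr X y) (restr (- X) x)" by (simp add: that)
    also have "\<dots> = cinner y (restr X (restr (- X) x))"
      by (metis adj_restr cinner_adj_left clin_restr)
    also have "restr X (restr (- X) x) = 0" by (auto intro!: ell2_eqI)
    finally show ?thesis by (simp add: restr_Compl)
  qed
  then show "\<forall>x. restr X x \<in> {x. restr X x = x} \<and> (\<forall>y\<in>{x. restr X x = x}. cinner y (x - restr X x) = 0)"
    by simp
next
  fix P :: "'a op"
  assume P: "\<forall>x. P x \<in> {x. restr X x = x} \<and> (\<forall>y\<in>{x. restr X x = x}. cinner y (x - P x) = 0)"
  show "P = restr X"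
  proof (intro blinfun_eqI ell2_eqI)
    fix x i
    show "coord (P x) i = coord (restr X x) i"
    proof (cases "i \<in> X")
      case True
      then show ?thesis using bspec[OF conjunct2[OF spec[OF P, of x]], of "ket i"] by simp
    next
      case False
      have "coord (P x) i = coord (restr X (P x)) i" using P by simp
      then show ?thesis using False by simp
    qed
  qed
qed

section \<open>The essential norm\<close>

lemma op_comp_assoc: "(A o\<^sub>L B) o\<^sub>L C = A o\<^sub>L (B o\<^sub>L C)"
  by (rule blinfun_eqI) simp

lemma op_comp_id [simp]: "A o\<^sub>L id_blinfun = A" "id_blinfun o\<^sub>L A = A"
  by (rule blinfun_eqI, simp)+

lemma op_comp_zero [simp]: "(0 :: 'i op) o\<^sub>L A = 0" "A o\<^sub>L (0 :: 'i op) = 0"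
  by (rule blinfun_eqI, simp)+

lemma op_comp_distrib:
  "(S + T) o\<^sub>L U = (S o\<^sub>L U) + (T o\<^sub>L U)" "U o\<^sub>L (S + T) = (U o\<^sub>L S) + (U o\<^sub>L T)"
  "(S - T) o\<^sub>L U = (S o\<^sub>L U) - (T o\<^sub>L U)" "U o\<^sub>L (S - T) = (U o\<^sub>L S) - (U o\<^sub>L T)"
  for S T U :: "'i op"
  by (rule blinfun_eqI, simp add: blinfun.add_left blinfun.add_right blinfun.diff_left blinfun.diff_right)+

text \<open>
  The infimum is the distance of \<open>T\<close> to the compact operators: cutting off finitely many
  coordinates of the argument changes \<open>T\<close> by a finite-rank operator, and it makes a compact
  operator arbitrarily small.
\<close>

definition ess :: "'i op \<Rightarrow> real"
  where "ess T = (INF F\<in>{F. finite F}. norm (T o\<^sub>L restr (- F)))"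

lemma ess_le: "finite F \<Longrightarrow> ess T \<le> norm (T o\<^sub>L restr (- F))"
  unfolding ess_def by (rule cINF_lower) (auto intro!: bdd_belowI[of _ 0])

lemma ess_le_norm: "ess T \<le> norm T"
proof -
  have "T o\<^sub>L restr (- {}) = T" by (rule blinfun_eqI) simp
  then show ?thesis using ess_le[of "{}" T] by simp
qed

lemma le_ess: "(\<And>F. finite F \<Longrightarrow> x \<le> norm (T o\<^sub>L restr (- F))) \<Longrightarrow> x \<le> ess T"
  unfolding ess_def by (rule cINF_greatest) auto

lemma ess_nonneg [simp]: "0 \<le> ess T"
  by (rule le_ess) simp

lemma ess_lessD:
  assumes "ess T < e" obtains F where "finite F" "norm (T o\<^sub>L restr (- F)) < e"
  using assms unfolding ess_def
  by (subst (asm) cINF_less_iff) (auto intro!: bdd_belowI[of _ 0])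

text \<open>
  Transfers an estimate by the tails of \<open>T\<close> to \<open>ess T\<close>; the factor \<open>c\<close> may vanish, so this is not
  mere division.
\<close>

lemma le_mult_ess:
  assumes "\<And>F. finite F \<Longrightarrow> x \<le> c * norm (T o\<^sub>L restr (- F))" "0 \<le> c"
  shows "x \<le> c * ess T"
proof (cases "c = 0")
  case True
  then show ?thesis using assms(1)[of "{}"] by simp
next
  case False
  then have "x / c \<le> ess T" using assms by (intro le_ess) (simp add: field_simps)
  then show ?thesis using False assms(2) by (simp add: field_simps)
qed

lemma restr_tail_antimono:
  assumes "F \<subseteq> G"
  shows "norm (T o\<^sub>L restr (- G)) \<le> norm (T o\<^sub>L restr (- F))"
proof -
  have "T o\<^sub>L restr (- G) = (T o\<^sub>L restr (- F)) o\<^sub>L restr (- G)"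
    using assms by (simp add: op_comp_assoc restr_restr Int_absorb1)
  also have "norm \<dots> \<le> norm (T o\<^sub>L restr (- F)) * norm (restr (- G) :: 'a op)"
    by (rule norm_blinfun_compose)
  also have "\<dots> \<le> norm (T o\<^sub>L restr (- F)) * 1"
    by (intro mult_left_mono norm_restr_le) auto
  finally show ?thesis by simp
qed

lemma ess_add: "ess (S + T) \<le> ess S + ess T"
proof (rule field_le_epsilon)
  fix e :: real assume e: "0 < e"
  obtain F where F: "finite F" "norm (S o\<^sub>L restr (- F)) < ess S + e/2"
    using e by (auto intro: ess_lessD[of S "ess S + e/2"])
  obtain G where G: "finite G" "norm (T o\<^sub>L restr (- G)) < ess T + e/2"
    using e by (auto intro: ess_lessD[of T "ess T + e/2"])
  let ?H = "F \<union> G"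
  have "ess (S + T) \<le> norm ((S + T) o\<^sub>L restr (- ?H))" using F G by (intro ess_le) auto
  also have "(S + T) o\<^sub>L restr (- ?H) = (S o\<^sub>L restr (- ?H)) + (T o\<^sub>L restr (- ?H))"
    by (rule op_comp_distrib)
  also have "norm \<dots> \<le> norm (S o\<^sub>L restr (- ?H)) + norm (T o\<^sub>L restr (- ?H))"
    by (rule norm_triangle_ineq)
  also have "\<dots> \<le> norm (S o\<^sub>L restr (- F)) + norm (T o\<^sub>L restr (- G))"
    by (intro add_mono restr_tail_antimono) auto
  finally show "ess (S + T) \<le> ess S + ess T + e" using F G by simp
qed

lemma ess_0 [simp]: "ess 0 = 0"
  by (rule antisym) (use ess_le_norm[of 0] in simp_all)

lemma ess_scale [simp]: "ess (op_scale c T) = cmod c * ess T"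
proof -
  have le: "ess (op_scale c T) \<le> cmod c * ess T" for c and T :: "'a op"
    by (rule le_mult_ess) (use ess_le[of _ "op_scale c T"] in \<open>auto simp: op_scale_simps(9)\<close>)
  show ?thesis
  proof (cases "c = 0")
    case False
    have "T = op_scale (inverse c) (op_scale c T)" using False by (simp add: op_scale_simps)
    then have "ess T \<le> cmod (inverse c) * ess (op_scale c T)" by (metis le)
    then have "cmod c * ess T \<le> ess (op_scale c T)"
      using False by (simp add: norm_inverse norm_divide field_simps)
    with le[of c T] show ?thesis by simp
  qed (simp add: op_scale_simps)
qed

lemma ess_minus [simp]: "ess (- T) = ess T"
  using ess_scale[of "-1" T] by (simp add: op_scale_simps)

lemma ess_diff: "ess (S - T) \<le> ess S + ess T"
  using ess_add[of S "- T"] by simp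

lemma ess_diff_commute: "ess (S - T) = ess (T - S)"
  using ess_minus[of "S - T"] by simp

lemma ess_triangle: "ess (S - T) \<le> ess (S - R) + ess (R - T)"
  using ess_add[of "S - R" "R - T"] by simp

lemma ess_diff_abs: "\<bar>ess S - ess T\<bar> \<le> ess (S - T)"
  using ess_add[of "S - T" T] ess_add[of "T - S" S] ess_diff_commute[of S T] by simp

lemma ess_comp_le: "ess (A o\<^sub>L B) \<le> norm A * ess B"
proof (rule le_mult_ess)
  fix F :: "'a set" assume "finite F"
  then have "ess (A o\<^sub>L B) \<le> norm (A o\<^sub>L (B o\<^sub>L restr (- F)))"
    by (metis ess_le op_comp_assoc)
  also have "\<dots> \<le> norm A * norm (B o\<^sub>L restr (- F))" by (rule norm_blinfun_compose)
  finally show "ess (A o\<^sub>L B) \<le> norm A * norm (B o\<^sub>L restr (- F))" .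
qed simp

lemma ess_comp_restr_finite: "finite F \<Longrightarrow> ess (T o\<^sub>L restr F) = 0"
proof -
  assume "finite F"
  moreover have "(T o\<^sub>L restr F) o\<^sub>L restr (- F) = 0"
    by (rule blinfun_eqI, rule ell2_eqI) (simp add: restr_Compl blinfun.diff_right)
  ultimately show ?thesis using ess_le[of F "T o\<^sub>L restr F"] by (simp add: antisym)
qed

lemma ess_restr_finite: "finite F \<Longrightarrow> ess (restr F) = 0"
  using ess_comp_restr_finite[of F id_blinfun] by simp

lemma norm_restr_single: "norm (restr {i} x) = cmod (coord x i)"
  by (simp add: restr_finite)

text \<open>
  By additivity one coordinate suffices.  That coordinate of \<open>T x\<close> is the inner product of \<open>x\<close>
  with the vector \<open>T* e\<^sub>i\<close>, whose tails are small.
\<close>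

lemma ess_restr_comp:
  assumes "finite F" "clin T"
  shows "ess (restr F o\<^sub>L T) = 0"
  using assms(1)
proof (induction F rule: finite_induct)
  case empty
  have "restr {} o\<^sub>L T = 0" by (rule blinfun_eqI, rule ell2_eqI) simp
  then show ?case by simp
next
  case (insert i F)
  have "ess (restr {i} o\<^sub>L T) \<le> 0 + e" if e: "0 < e" for e
  proof -
    let ?v = "op_adj T (ket i)"
    obtain G where G: "finite G" "norm (restr (- G) ?v) < e" using restr_approx[OF e] by blast
    have "norm ((restr {i} o\<^sub>L T) o\<^sub>L restr (- G)) \<le> e"
    proof (rule norm_blinfun_bound)
      fix x
      have "norm (((restr {i} o\<^sub>L T) o\<^sub>L restr (- G)) x) = cmod (cinner (ket i) (T (restr (- G) x)))"
        by (simp add: norm_restr_single)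
      also have "\<dots> = cmod (cinner (op_adj (restr (- G)) ?v) x)"
        using assms(2) by (simp only: cinner_adj_left clin_adj clin_restr)
      also have "\<dots> \<le> norm (restr (- G) ?v) * norm x"
        by (simp only: adj_restr cinner_cauchy_schwarz)
      also have "\<dots> \<le> e * norm x" using G by (intro mult_right_mono) auto
      finally show "norm (((restr {i} o\<^sub>L T) o\<^sub>L restr (- G)) x) \<le> e * norm x" .
    qed (use e in simp)
    then show ?thesis using ess_le[OF G(1), of "restr {i} o\<^sub>L T"] by simp
  qed
  then have "ess (restr {i} o\<^sub>L T) \<le> 0" by (rule field_le_epsilon)
  moreover have "restr (insert i F) o\<^sub>L T = (restr {i} o\<^sub>L T) + (restr F o\<^sub>L T)"
    using insert(2) by (intro blinfun_eqI ell2_eqI) (auto simp: blinfun.add_left)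
  ultimately show ?case
    using ess_add[of "restr {i} o\<^sub>L T" "restr F o\<^sub>L T"] insert(3) by (simp add: antisym)
qed

lemma comp_split: "A o\<^sub>L B = (A o\<^sub>L restr (- G) o\<^sub>L B) + (A o\<^sub>L restr G o\<^sub>L B)"
  by (rule blinfun_eqI) (simp add: restr_Compl blinfun.diff_right blinfun.add_left)

text \<open>
  In \<open>A B = A (1 - P) B + A P B\<close> with a finite coordinate projection \<open>P\<close> the second summand has
  essential norm 0, and the first is controlled by a tail of \<open>A\<close>.
\<close>

lemma ess_mult:
  assumes "clin B"
  shows "ess (A o\<^sub>L B) \<le> ess A * ess B"
proof -
  have "ess (A o\<^sub>L B) \<le> ess B * ess A"
  proof (rule le_mult_ess)
    fix G :: "'a set" assume G: "finite G"
    have "ess (A o\<^sub>L B) \<le> ess (A o\<^sub>L restr (- G) o\<^sub>L B) + ess (A o\<^sub>L restr G o\<^sub>L B)"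
      by (subst comp_split[of A B G]) (rule ess_add)
    also have "ess (A o\<^sub>L restr G o\<^sub>L B) \<le> 0"
      using ess_comp_le[of A "restr G o\<^sub>L B"] ess_restr_comp[OF G assms]
      by (simp add: op_comp_assoc)
    finally show "ess (A o\<^sub>L B) \<le> ess B * norm (A o\<^sub>L restr (- G))"
      using ess_comp_le[of "A o\<^sub>L restr (- G)" B] by (simp add: mult.commute)
  qed simp
  then show ?thesis by (simp add: mult.commute)
qed

text \<open>
  The C*-identity of the operator norm, applied to the tails \<open>T (1 - P)\<close>.
\<close>

lemma ess_sq_le:
  assumes "clin T"
  shows "(ess T)\<^sup>2 \<le> ess (op_adj T o\<^sub>L T)"
proof (rule le_ess)
  fix F :: "'a set" assume F: "finite F"
  let ?P = "restr (- F) :: 'a op"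
  have "(ess T)\<^sup>2 \<le> (norm (T o\<^sub>L ?P))\<^sup>2" using F by (intro power_mono ess_le) auto
  also have "\<dots> \<le> norm (op_adj (T o\<^sub>L ?P) o\<^sub>L (T o\<^sub>L ?P))"
    using assms by (intro norm_sq_le_adj_comp) auto
  also have "op_adj (T o\<^sub>L ?P) o\<^sub>L (T o\<^sub>L ?P) = ?P o\<^sub>L ((op_adj T o\<^sub>L T) o\<^sub>L ?P)"
    using assms by (simp add: adj_comp op_comp_assoc)
  also have "norm \<dots> \<le> norm ?P * norm ((op_adj T o\<^sub>L T) o\<^sub>L ?P)" by (rule norm_blinfun_compose)
  also have "\<dots> \<le> 1 * norm ((op_adj T o\<^sub>L T) o\<^sub>L ?P)"
    by (intro mult_right_mono norm_restr_le) auto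
  finally show "(ess T)\<^sup>2 \<le> norm ((op_adj T o\<^sub>L T) o\<^sub>L ?P)" by simp
qed

lemma ess_adj [simp]: "clin T \<Longrightarrow> ess (op_adj T) = ess T"
proof -
  have le: "ess T \<le> ess (op_adj T)" if T: "clin T" for T :: "'a op"
  proof (cases "ess T = 0")
    case False
    have "ess T * ess T \<le> ess (op_adj T) * ess T"
      using order_trans[OF ess_sq_le[OF T] ess_mult[OF T]] by (simp add: power2_eq_square)
    then show ?thesis using False ess_nonneg[of T] by (simp add: mult_le_cancel_right)
  qed simp
  assume "clin T"
  then show ?thesis using le[of T] le[of "op_adj T"] by simp
qed

lemma ess_cstar: "clin T \<Longrightarrow> ess (op_adj T o\<^sub>L T) = (ess T)\<^sup>2"
  using ess_sq_le[of T] ess_mult[of T "op_adj T"] by (simp add: power2_eq_square)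

lemma blinfun_norm_le_unit:
  assumes "\<And>x. norm x \<le> 1 \<Longrightarrow> norm (blinfun_apply T x) \<le> b" "0 \<le> b"
  shows "norm T \<le> b"
proof (rule norm_blinfun_bound)
  fix x
  show "norm (T x) \<le> b * norm x"
  proof (cases "x = 0")
    case False
    have "norm (T (x /\<^sub>R norm x)) \<le> b" using False by (intro assms(1)) simp
    then show ?thesis using False by (simp add: blinfun.scaleR_right field_simps)
  qed simp
qed (rule assms(2))

text \<open>
  A finite net of the image of the unit ball is almost unchanged by a finite coordinate
  projection \<open>P\<close>, so \<open>(1 - P) T\<close> is small in norm, while \<open>P T\<close> has essential norm 0.
\<close>

lemma ess_compact:
  assumes "clin T" "compact (closure (T ` cball 0 1))"
  shows "ess T = 0"
proof -
  have "ess T \<le> 0 + e" if e: "0 < e" for e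
  proof -
    obtain k where k: "finite k" "closure (T ` cball 0 1) \<subseteq> (\<Union>y\<in>k. ball y (e/2))"
      using assms(2) e unfolding compact_eq_totally_bounded by (meson half_gt_zero)
    have "\<exists>G. finite G \<and> (\<forall>y\<in>k. norm (restr (- G) y) < e/2)"
      using k(1)
    proof (induction k rule: finite_induct)
      case (insert y k)
      then obtain G where G: "finite G" "\<forall>y\<in>k. norm (restr (- G) y) < e/2" by blast
      obtain H where H: "finite H" "norm (restr (- H) y) < e/2"
        using restr_approx[of "e/2" y] e by auto
      have "norm (restr (- (G \<union> H)) z) \<le> norm (restr (- G) z)"
           "norm (restr (- (G \<union> H)) z) \<le> norm (restr (- H) z)" for z
        using norm_restr_apply_le[of "- H" "restr (- G) z"] norm_restr_apply_le[of "- G" "restr (- H) z"]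
        by (simp_all add: Int_commute)
      then have "norm (restr (- (G \<union> H)) z) < e/2" if "z \<in> insert y k" for z
        using that G(2) H(2) by (metis insertE order_le_less_trans)
      then show ?case using G H by (intro exI[of _ "G \<union> H"]) blast
    qed auto
    then obtain G where G: "finite G" "\<And>y. y \<in> k \<Longrightarrow> norm (restr (- G) y) < e/2" by blast
    have "norm (restr (- G) o\<^sub>L T) \<le> e"
    proof (rule blinfun_norm_le_unit)
      fix x :: "'a ell2" assume "norm x \<le> 1"
      then have "T x \<in> closure (T ` cball 0 1)" by (intro subsetD[OF closure_subset]) auto
      then obtain y where y: "y \<in> k" "dist y (T x) < e/2" using k(2) by auto
      have "norm (restr (- G) (T x)) = norm (restr (- G) (T x - y) + restr (- G) y)"
        by (simp add: blinfun.diff_right)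
      also have "\<dots> \<le> norm (T x - y) + norm (restr (- G) y)"
        by (rule order_trans[OF norm_triangle_ineq add_right_mono[OF norm_restr_apply_le]])
      also have "\<dots> \<le> e" using y G(2)[OF y(1)] by (simp add: dist_norm norm_minus_commute)
      finally show "norm ((restr (- G) o\<^sub>L T) x) \<le> e" by simp
    qed (use e in simp)
    then have "ess (restr (- G) o\<^sub>L T) \<le> e" using ess_le_norm order_trans by blast
    moreover have "T = (restr (- G) o\<^sub>L T) + (restr G o\<^sub>L T)"
      by (rule blinfun_eqI) (simp add: blinfun.add_left restr_Compl)
    ultimately show ?thesis
      using ess_add[of "restr (- G) o\<^sub>L T" "restr G o\<^sub>L T"] ess_restr_comp[OF G(1) assms(1)] by simp
  qed
  then have "ess T \<le> 0" by (rule field_le_epsilon)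
  then show ?thesis by (simp add: antisym)
qed

lemma restr_cball_compact:
  "finite F \<Longrightarrow> \<exists>C. compact C \<and> restr F ` cball 0 1 \<subseteq> (C :: 'i ell2 set)"
proof (induction F rule: finite_induct)
  case empty
  have "restr {} x = 0" for x :: "'i ell2" by (rule ell2_eqI) simp
  then show ?case by (intro exI[of _ "{0}"]) auto
next
  case (insert i F)
  then obtain C :: "'i ell2 set" where C: "compact C" "restr F ` cball 0 1 \<subseteq> C" by blast
  let ?D = "(\<lambda>c. c *\<^sub>C ket i) ` cball 0 1"
  have "bounded_linear (\<lambda>c. c *\<^sub>C ket i)"
    by (rule bounded_linear_intro[where K = 1]) (auto intro!: ell2_eqI simp: scaleC_distrib scaleR_conv_of_real)
  then have "compact ?D"
    by (intro compact_continuous_image linear_continuous_on) auto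
  then have "compact {x + y | x y. x \<in> ?D \<and> y \<in> C}" using C(1) by (rule compact_sums)
  moreover have "restr (insert i F) x \<in> {x + y | x y. x \<in> ?D \<and> y \<in> C}" if "x \<in> cball 0 1" for x
  proof -
    have "restr (insert i F) x = coord x i *\<^sub>C ket i + restr F x"
      using insert(2) by (intro ell2_eqI) auto
    moreover have "coord x i *\<^sub>C ket i \<in> ?D"
      using that order_trans[OF coord_norm_le[of x i]] by auto
    ultimately show ?thesis using C(2) that by blast
  qed
  ultimately show ?case by blast
qed

text \<open>
  \<open>T\<close> is a norm limit of the operators \<open>T P\<close> with finite coordinate projections \<open>P\<close>, and these
  map the unit ball into compact sets; hence the image of the ball is totally bounded.
\<close>

lemma compact_if_ess_0:
  assumes "ess T = 0"
  shows "compact (closure (T ` cball 0 1))"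
  unfolding compact_eq_totally_bounded
proof (intro conjI allI impI)
  show "complete (closure (T ` cball 0 1))" by (simp add: complete_eq_closed)
  fix e :: real assume e: "0 < e"
  obtain F where F: "finite F" "norm (T o\<^sub>L restr (- F)) < e/3"
    using assms e by (auto intro: ess_lessD[of T "e/3"])
  obtain C where C: "compact C" "restr F ` cball 0 1 \<subseteq> C" using restr_cball_compact[OF F(1)] by blast
  have "compact (T ` C)" using C(1) by (intro compact_continuous_image) (auto intro!: continuous_intros)
  moreover have "0 < e/3" using e by simp
  ultimately obtain k where k: "finite k" "T ` C \<subseteq> (\<Union>y\<in>k. ball y (e/3))"
    unfolding compact_eq_totally_bounded by meson
  have "closure (T ` cball 0 1) \<subseteq> (\<Union>y\<in>k. ball y e)"
  proof
    fix z assume "z \<in> closure (T ` cball 0 1)"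
    then obtain x where x: "norm x \<le> 1" "dist (T x) z < e/3"
      using e unfolding closure_approachable by (metis (mono_tags) divide_pos_pos imageE mem_cball_0 zero_less_numeral)
    have "restr F x \<in> C" using C(2) x(1) by (auto simp: subset_iff)
    then have "T (restr F x) \<in> T ` C" by simp
    then obtain y where y: "y \<in> k" "dist y (T (restr F x)) < e/3" using k(2) by auto
    have "dist (T (restr F x)) (T x) = norm ((T o\<^sub>L restr (- F)) x)"
      by (simp add: dist_norm restr_Compl blinfun.diff_right norm_minus_commute)
    also have "\<dots> \<le> norm (T o\<^sub>L restr (- F)) * norm x" by (rule norm_blinfun)
    also have "\<dots> \<le> e/3 * 1" using F(2) x(1) e by (intro mult_mono) auto
    finally have "dist y z < e"
      using x(2) y(2) dist_triangle[of y z "T (restr F x)"] dist_triangle[of "T (restr F x)" z "T x"] by simp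
    then show "z \<in> (\<Union>y\<in>k. ball y e)" using y(1) by auto
  qed
  then show "\<exists>k. finite k \<and> closure (T ` cball 0 1) \<subseteq> (\<Union>x\<in>k. ball x e)" using k(1) by blast
qed

lemma compact_ops_iff: "T \<in> compact_ops X \<longleftrightarrow> T \<in> bounded_ops X \<and> ess T = 0"
  unfolding compact_ops_def using ess_compact[of T] compact_if_ess_0[of T] bounded_ops_clin[of T X]
  by blast

text \<open>
  Applied to the unitaries that implement the gauge action; these are diagonal, so they commute
  with all coordinate projections.
\<close>

lemma ess_conj_diagonal:
  assumes "norm U \<le> 1" "norm V \<le> 1" "\<And>F. V o\<^sub>L restr F = restr F o\<^sub>L V"
  shows "ess (U o\<^sub>L T o\<^sub>L V) \<le> ess T"
proof (rule le_ess)
  fix F :: "'a set" assume F: "finite F"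
  have "ess (U o\<^sub>L T o\<^sub>L V) \<le> norm (U o\<^sub>L T o\<^sub>L V o\<^sub>L restr (- F))" using F by (rule ess_le)
  also have "U o\<^sub>L T o\<^sub>L V o\<^sub>L restr (- F) = U o\<^sub>L ((T o\<^sub>L restr (- F)) o\<^sub>L V)"
    using assms(3)[of "- F"] by (simp add: op_comp_assoc)
  also have "norm \<dots> \<le> norm U * (norm (T o\<^sub>L restr (- F)) * norm V)"
    by (intro order_trans[OF norm_blinfun_compose] mult_left_mono norm_blinfun_compose) auto
  also have "\<dots> \<le> 1 * (norm (T o\<^sub>L restr (- F)) * 1)"
    by (intro mult_mono assms(1,2)) auto
  finally show "ess (U o\<^sub>L T o\<^sub>L V) \<le> norm (T o\<^sub>L restr (- F))" by simp
qed

lemma ess_ge_1: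
  fixes T :: "'i op"
  assumes "infinite {i. 1 \<le> norm (T (ket i))}"
  shows "1 \<le> ess T"
proof (rule le_ess)
  fix F :: "'i set" assume "finite F"
  then obtain i where i: "i \<notin> F" "1 \<le> norm (T (ket i))"
    using assms by (metis (mono_tags, lifting) finite_subset mem_Collect_eq subsetI)
  then have "1 \<le> norm ((T o\<^sub>L restr (- F)) (ket i))" by simp
  also have "\<dots> \<le> norm (T o\<^sub>L restr (- F))" using norm_blinfun[of "T o\<^sub>L restr (- F)" "ket i"] by simp
  finally show "1 \<le> norm (T o\<^sub>L restr (- F))" .
qed

lemma norm_sq_diff: "(norm (x - y :: 'i ell2))\<^sup>2 = (norm x)\<^sup>2 - 2 * Re (cinner x y) + (norm y)\<^sup>2"
  by (simp add: power2_norm_eq_inner Re_cinner inner_diff_left inner_diff_right inner_commute)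

text \<open>
  If \<open>T* T\<close> agreed with \<open>2 B - B* B\<close> for a self-adjoint \<open>B\<close>, then
  \<open>\<parallel>T x\<parallel>\<^sup>2 = \<parallel>x\<parallel>\<^sup>2 - \<parallel>x - B x\<parallel>\<^sup>2 \<le> \<parallel>x\<parallel>\<^sup>2\<close>.  The actual difference is small on vectors
  that vanish on a large finite set of coordinates, and only the real part of \<open>\<langle>x, B x\<rangle>\<close> enters.
\<close>

lemma ess_le_1_if_square_root:
  assumes T: "clin T" and B: "clin B"
    and K: "ess ((op_adj T o\<^sub>L T) - (op_scale 2 B - (op_adj B o\<^sub>L B))) = 0"
  shows "ess T \<le> 1"
proof (rule field_le_epsilon)
  fix e :: real assume e: "0 < e"
  define K where "K = (op_adj T o\<^sub>L T) - (op_scale 2 B - (op_adj B o\<^sub>L B))"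
  obtain F where F: "finite F" "norm (K o\<^sub>L restr (- F)) < e"
    using K e ess_lessD[of K e thesis] by (auto simp: K_def)
  have "norm (T o\<^sub>L restr (- F)) \<le> 1 + e"
  proof (rule norm_blinfun_bound)
    fix x
    let ?y = "restr (- F) x"
    have nT: "(norm (T ?y))\<^sup>2 = Re (cinner ?y ((op_adj T o\<^sub>L T) ?y))"
      using T by (simp add: cinner_adj_right Re_cinner power2_norm_eq_inner)
    have "op_adj T o\<^sub>L T = op_scale 2 B - (op_adj B o\<^sub>L B) + K" by (simp add: K_def)
    then have "cinner ?y ((op_adj T o\<^sub>L T) ?y)
        = 2 * cinner ?y (B ?y) - cinner (B ?y) (B ?y) + cinner ?y (K ?y)"
      using B by (simp add: blinfun.add_left blinfun.diff_left cinner_add_right cinner_diff_right cinner_adj_right)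
    then have "(norm (T ?y))\<^sup>2 = 2 * Re (cinner ?y (B ?y)) - (norm (B ?y))\<^sup>2 + Re (cinner ?y (K ?y))"
      unfolding nT by (simp add: Re_cinner power2_norm_eq_inner)
    also have "\<dots> \<le> (norm ?y)\<^sup>2 + Re (cinner ?y (K ?y))"
      using norm_sq_diff[of ?y "B ?y"] zero_le_power2[of "norm (?y - B ?y)"] by linarith
    also have "Re (cinner ?y (K ?y)) \<le> norm ?y * norm (K ?y)"
      by (simp add: Re_cinner norm_cauchy_schwarz)
    also have "norm ?y * norm (K ?y) \<le> norm x * (e * norm x)"
    proof (intro mult_mono norm_restr_apply_le)
      have "norm ((K o\<^sub>L restr (- F)) x) \<le> norm (K o\<^sub>L restr (- F)) * norm x" by (rule norm_blinfun)
      also have "\<dots> \<le> e * norm x" using F by (intro mult_right_mono) auto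
      finally show "norm (K ?y) \<le> e * norm x" by simp
    qed auto
    also have "(norm ?y)\<^sup>2 \<le> (norm x)\<^sup>2" by (intro power_mono norm_restr_apply_le) auto
    finally have "(norm (T ?y))\<^sup>2 \<le> (1 + e) * (norm x)\<^sup>2"
      by (simp add: power2_eq_square algebra_simps)
    also have "\<dots> \<le> ((1 + e) * norm x)\<^sup>2"
      unfolding power_mult_distrib using e by (intro mult_right_mono self_le_power) auto
    finally have "norm (T ?y) \<le> (1 + e) * norm x" by (rule power2_le_imp_le) (use e in simp)
    then show "norm ((T o\<^sub>L restr (- F)) x) \<le> (1 + e) * norm x" by simp
  qed (use e in simp)
  then show "ess T \<le> 1 + e" using ess_le[OF F(1), of T] by simp
qed

section \<open>Quotients of *-algebras\<close>

lemma a_minus_eq_diff: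
  fixes A :: "('a::ab_group_add, 'z) star_algebra_scheme"
  assumes "\<zero>\<^bsub>A\<^esub> = 0" "add A = (+)" "b \<in> carrier A" "- b \<in> carrier A"
  shows "a \<ominus>\<^bsub>A\<^esub> b = a - b"
proof -
  have "\<ominus>\<^bsub>A\<^esub> b = - b"
    unfolding a_inv_def m_inv_def
  proof (rule the_equality)
    fix y
    assume "y \<in> carrier (add_monoid A) \<and> b \<otimes>\<^bsub>add_monoid A\<^esub> y = \<one>\<^bsub>add_monoid A\<^esub> \<and>
      y \<otimes>\<^bsub>add_monoid A\<^esub> b = \<one>\<^bsub>add_monoid A\<^esub>"
    then have "y + b = 0" by (simp add: assms(1,2))
    then show "y = - b" by (simp add: eq_neg_iff_add_eq_0)
  qed (simp add: assms)
  then show ?thesis by (simp add: a_minus_def assms(2))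
qed

text \<open>
  All algebras to be divided are subspaces of additive groups given as types; the locale relates
  their record operations to the type-class operations, so that cosets can be computed with
  differences of elements.
\<close>

locale quotient_data =
  fixes A :: "('a::ab_group_add, 'z) star_algebra_scheme" and I :: "'a set"
  assumes zero_A [simp]: "\<zero>\<^bsub>A\<^esub> = 0" and add_A [simp]: "add A = (+)"
    and carrier_0: "0 \<in> carrier A"
    and carrier_diff: "a \<in> carrier A \<Longrightarrow> b \<in> carrier A \<Longrightarrow> a - b \<in> carrier A"
    and I_0: "0 \<in> I" and I_diff: "a \<in> I \<Longrightarrow> b \<in> I \<Longrightarrow> a - b \<in> I"
begin

lemma carrier_uminus: "a \<in> carrier A \<Longrightarrow> - a \<in> carrier A"
  using carrier_diff[OF carrier_0, of a] by simp

lemma carrier_add: "a \<in> carrier A \<Longrightarrow> b \<in> carrier A \<Longrightarrow> a + b \<in> carrier A"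
  using carrier_diff[of a "- b"] carrier_uminus[of b] by simp

lemma I_uminus: "a \<in> I \<Longrightarrow> - a \<in> I"
  using I_diff[OF I_0, of a] by simp

lemma I_add: "a \<in> I \<Longrightarrow> b \<in> I \<Longrightarrow> a + b \<in> I"
  using I_diff[of a "- b"] I_uminus[of b] by simp

lemma mem_coset_iff: "x \<in> I +>\<^bsub>A\<^esub> a \<longleftrightarrow> x - a \<in> I"
  unfolding a_r_coset_def' by (auto intro!: bexI[of _ "x - a"])

lemma mem_coset_self: "a \<in> I +>\<^bsub>A\<^esub> a"
  by (simp add: mem_coset_iff I_0)

lemma coset_eq_iff: "I +>\<^bsub>A\<^esub> a = I +>\<^bsub>A\<^esub> b \<longleftrightarrow> a - b \<in> I"
proof
  assume "I +>\<^bsub>A\<^esub> a = I +>\<^bsub>A\<^esub> b"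
  then show "a - b \<in> I" using mem_coset_self[of a] by (simp add: mem_coset_iff)
next
  assume ab: "a - b \<in> I"
  have "x - a \<in> I \<longleftrightarrow> x - b \<in> I" for x
    using I_add[of "x - a" "a - b"] I_diff[of "x - b" "a - b"] ab by auto
  then show "I +>\<^bsub>A\<^esub> a = I +>\<^bsub>A\<^esub> b" by (auto simp: mem_coset_iff)
qed

lemma coset_0: "I +>\<^bsub>A\<^esub> 0 = I"
  by (auto simp: mem_coset_iff)

lemma quot_carrier: "carrier (quot A I) = (\<lambda>a. I +>\<^bsub>A\<^esub> a) ` carrier A"
  by (auto simp: quot_def A_RCOSETS_def')

lemma quot_zero: "\<zero>\<^bsub>quot A I\<^esub> = I +>\<^bsub>A\<^esub> 0"
  by (simp add: quot_def coset_0)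

lemma quot_add: "(I +>\<^bsub>A\<^esub> a) \<oplus>\<^bsub>quot A I\<^esub> (I +>\<^bsub>A\<^esub> b) = I +>\<^bsub>A\<^esub> (a + b)"
proof -
  have *: "(\<exists>x. x - a \<in> I \<and> (\<exists>y. y - b \<in> I \<and> z = x + y)) \<longleftrightarrow> z - (a + b) \<in> I" for z
  proof
    assume "\<exists>x. x - a \<in> I \<and> (\<exists>y. y - b \<in> I \<and> z = x + y)"
    then obtain x y where "x - a \<in> I" "y - b \<in> I" "z = x + y" by blast
    then show "z - (a + b) \<in> I" using I_add[of "x - a" "y - b"] by (simp add: algebra_simps)
  next
    assume "z - (a + b) \<in> I"
    then show "\<exists>x. x - a \<in> I \<and> (\<exists>y. y - b \<in> I \<and> z = x + y)"
      by (intro exI[of _ "z - b"] conjI exI[of _ b]) (simp_all add: I_0 algebra_simps)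
  qed
  have "(I +>\<^bsub>A\<^esub> a) \<oplus>\<^bsub>quot A I\<^esub> (I +>\<^bsub>A\<^esub> b) = (I +>\<^bsub>A\<^esub> a) <+>\<^bsub>A\<^esub> (I +>\<^bsub>A\<^esub> b)"
    by (simp add: quot_def)
  also have "\<dots> = I +>\<^bsub>A\<^esub> (a + b)"
  proof (rule Set.set_eqI)
    show "z \<in> (I +>\<^bsub>A\<^esub> a) <+>\<^bsub>A\<^esub> (I +>\<^bsub>A\<^esub> b) \<longleftrightarrow> z \<in> I +>\<^bsub>A\<^esub> (a + b)" for z
      using *[of z] by (simp add: set_add_def' mem_coset_iff Bex_def)
  qed
  finally show ?thesis .
qed

lemma quot_mult:
  assumes "\<And>x y. x - a \<in> I \<Longrightarrow> y - b \<in> I \<Longrightarrow> (x \<otimes>\<^bsub>A\<^esub> y) - (a \<otimes>\<^bsub>A\<^esub> b) \<in> I"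
  shows "(I +>\<^bsub>A\<^esub> a) \<otimes>\<^bsub>quot A I\<^esub> (I +>\<^bsub>A\<^esub> b) = I +>\<^bsub>A\<^esub> (a \<otimes>\<^bsub>A\<^esub> b)"
proof -
  have "(I +>\<^bsub>A\<^esub> a) \<otimes>\<^bsub>quot A I\<^esub> (I +>\<^bsub>A\<^esub> b)
      = (\<Union>x\<in>I +>\<^bsub>A\<^esub> a. \<Union>y\<in>I +>\<^bsub>A\<^esub> b. I +>\<^bsub>A\<^esub> (x \<otimes>\<^bsub>A\<^esub> y))"
    by (simp add: quot_def rcoset_mult_def)
  also have "\<dots> = (\<Union>x\<in>I +>\<^bsub>A\<^esub> a. \<Union>y\<in>I +>\<^bsub>A\<^esub> b. I +>\<^bsub>A\<^esub> (a \<otimes>\<^bsub>A\<^esub> b))"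
    by (intro SUP_cong refl) (simp add: coset_eq_iff mem_coset_iff assms)
  also have "\<dots> = I +>\<^bsub>A\<^esub> (a \<otimes>\<^bsub>A\<^esub> b)"
    using mem_coset_self[of a] mem_coset_self[of b] by blast
  finally show ?thesis .
qed

lemma quot_unary:
  assumes "\<And>x. x - a \<in> I \<Longrightarrow> h x - h a \<in> I"
  shows "(\<Union>x\<in>I +>\<^bsub>A\<^esub> a. I +>\<^bsub>A\<^esub> h x) = I +>\<^bsub>A\<^esub> h a"
proof -
  have "(\<Union>x\<in>I +>\<^bsub>A\<^esub> a. I +>\<^bsub>A\<^esub> h x) = (\<Union>x\<in>I +>\<^bsub>A\<^esub> a. I +>\<^bsub>A\<^esub> h a)"
    by (intro SUP_cong refl) (simp add: coset_eq_iff mem_coset_iff assms)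
  also have "\<dots> = I +>\<^bsub>A\<^esub> h a" using mem_coset_self[of a] by blast
  finally show ?thesis .
qed

lemma quot_smult:
  assumes "\<And>x. x - a \<in> I \<Longrightarrow> (c \<odot>\<^bsub>A\<^esub> x) - (c \<odot>\<^bsub>A\<^esub> a) \<in> I"
  shows "c \<odot>\<^bsub>quot A I\<^esub> (I +>\<^bsub>A\<^esub> a) = I +>\<^bsub>A\<^esub> (c \<odot>\<^bsub>A\<^esub> a)"
  using quot_unary[of a "\<lambda>x. c \<odot>\<^bsub>A\<^esub> x"] assms by (simp add: quot_def)

lemma quot_star:
  assumes "\<And>x. x - a \<in> I \<Longrightarrow> star A x - star A a \<in> I"
  shows "star (quot A I) (I +>\<^bsub>A\<^esub> a) = I +>\<^bsub>A\<^esub> (star A a)"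
  using quot_unary[of a "star A"] assms by (simp add: quot_def)

lemma quot_abelian_monoid: "abelian_monoid (quot A I)"
  by (rule abelian_monoidI)
    (auto simp: quot_carrier quot_zero quot_add carrier_add carrier_0 algebra_simps)

lemma quot_finsum:
  assumes "finite S" "\<And>s. s \<in> S \<Longrightarrow> x s \<in> carrier A"
  shows "(\<Oplus>\<^bsub>quot A I\<^esub>s\<in>S. I +>\<^bsub>A\<^esub> x s) = I +>\<^bsub>A\<^esub> (\<Sum>s\<in>S. x s)"
proof -
  interpret Q: abelian_monoid "quot A I" by (rule quot_abelian_monoid)
  show ?thesis
    using assms
    by (induction S rule: finite_induct) (auto simp: quot_zero quot_carrier quot_add)
qed

end

section \<open>The free *-algebra\<close>

text \<open>
  The convolution of arbitrary functions on words is defined, since a word has finitely many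
  splittings.  Associativity and the other laws thus hold without finiteness of supports, which
  enter only through the carrier.
\<close>

definition fmul :: "'g star_poly \<Rightarrow> 'g star_poly \<Rightarrow> 'g star_poly"  (infixl "\<star>" 70)
  where "a \<star> b = (\<lambda>u. \<Sum>i\<le>length u. a (take i u) * b (drop i u))"

definition fscale :: "complex \<Rightarrow> 'g star_poly \<Rightarrow> 'g star_poly"
  where "fscale c a = (\<lambda>u. c * a u)"

definition word_star :: "('g \<times> bool) list \<Rightarrow> ('g \<times> bool) list"
  where "word_star u = rev (map (\<lambda>(g, s). (g, \<not> s)) u)"

definition fstar :: "'g star_poly \<Rightarrow> 'g star_poly"
  where "fstar a = (\<lambda>u. cnj (a (word_star u)))"

definition mono_word :: "('g \<times> bool) list \<Rightarrow> 'g star_poly"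
  where "mono_word u = (\<lambda>v. if v = u then 1 else 0)"

definition words :: "'g set \<Rightarrow> ('g \<times> bool) list set"
  where "words G = {u. u \<noteq> [] \<and> fst ` set u \<subseteq> G}"

definition fcar :: "'g set \<Rightarrow> 'g star_poly set"
  where "fcar G = {a. finite {u. a u \<noteq> 0} \<and> {u. a u \<noteq> 0} \<subseteq> words G}"

lemma free_star_algebra_simps [simp]:
  "carrier (free_star_algebra G \<nu>) = fcar G" "mult (free_star_algebra G \<nu>) = (\<star>)"
  "\<zero>\<^bsub>free_star_algebra G \<nu>\<^esub> = 0" "add (free_star_algebra G \<nu>) = (+)"
  "smult (free_star_algebra G \<nu>) = fscale" "star (free_star_algebra G \<nu>) = fstar"
  "nrm (free_star_algebra G \<nu>) = \<nu>"
  by (auto simp: free_star_algebra_def fcar_def words_def fmul_def fscale_def fstar_def word_star_def fun_eq_iff plus_fun_apply zero_fun_apply)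

text \<open>
  Elements of the free algebra are functions, but should be rewritten as elements of an additive
  group; pointwise evaluation is therefore used only on request.
\<close>

declare plus_fun_apply [simp del] zero_fun_apply [simp del]

lemma fun_diff_apply: "((f :: 'a \<Rightarrow> complex) - g) x = f x - g x"
  by (simp add: fun_diff_def)

lemma fun_uminus_apply: "(- (f :: 'a \<Rightarrow> complex)) x = - f x"
  by (simp add: fun_Compl_def)

lemmas fun_apply_simps = plus_fun_apply zero_fun_apply fun_diff_apply fun_uminus_apply

lemma fun_sum_apply: "(sum f A :: 'a \<Rightarrow> complex) x = (\<Sum>a\<in>A. f a x)"
  by (induction A rule: infinite_finite_induct) (auto simp: fun_apply_simps)

lemma fmul_assoc: "(a \<star> b) \<star> c = a \<star> (b \<star> (c :: 'g star_poly))"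
proof
  fix u :: "('g \<times> bool) list"
  let ?n = "length u"
  have "((a \<star> b) \<star> c) u
      = (\<Sum>i\<le>?n. \<Sum>j\<le>i. a (take j u) * b (drop j (take i u)) * c (drop i u))"
    unfolding fmul_def by (intro sum.cong) (auto simp: sum_distrib_right min_def intro!: sum.cong)
  also have "\<dots> = (\<Sum>(i, j)\<in>(SIGMA i:{..?n}. {..i}). a (take j u) * b (drop j (take i u)) * c (drop i u))"
    by (rule sum.Sigma) auto
  also have "\<dots> = (\<Sum>(j, k)\<in>(SIGMA j:{..?n}. {..?n - j}).
      a (take j u) * b (take k (drop j u)) * c (drop k (drop j u)))"
    by (rule sum.reindex_bij_witness[where i = "\<lambda>(j, k). (j + k, j)" and j = "\<lambda>(i, j). (j, i - j)"])
      (auto simp: drop_take add.commute)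
  also have "\<dots> = (\<Sum>j\<le>?n. \<Sum>k\<le>?n - j. a (take j u) * b (take k (drop j u)) * c (drop k (drop j u)))"
    by (rule sum.Sigma[symmetric]) auto
  also have "\<dots> = (a \<star> (b \<star> c)) u"
    unfolding fmul_def by (auto simp: sum_distrib_left mult.assoc intro!: sum.cong)
  finally show "((a \<star> b) \<star> c) u = (a \<star> (b \<star> c)) u" .
qed

lemma fmul_distrib:
  "(a + b) \<star> c = a \<star> c + b \<star> c" "c \<star> (a + b) = c \<star> a + c \<star> b"
  "(a - b) \<star> c = a \<star> c - b \<star> c" "c \<star> (a - b) = c \<star> a - c \<star> b"
  by (auto simp: fmul_def fun_eq_iff fun_apply_simps algebra_simps sum.distrib sum_subtractf)

lemma fmul_0 [simp]: "0 \<star> a = 0" "a \<star> 0 = 0"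
  by (auto simp: fmul_def fun_eq_iff fun_apply_simps)

lemma fmul_scale [simp]: "fscale c a \<star> b = fscale c (a \<star> b)" "a \<star> fscale c b = fscale c (a \<star> b)"
  by (auto simp: fmul_def fscale_def fun_eq_iff sum_distrib_left algebra_simps)

lemma fmul_sum_left: "sum f S \<star> a = (\<Sum>s\<in>S. f s \<star> a)"
  by (induction S rule: infinite_finite_induct) (simp_all add: fmul_distrib)

lemma fmul_sum_right: "a \<star> sum f S = (\<Sum>s\<in>S. a \<star> f s)"
  by (induction S rule: infinite_finite_induct) (simp_all add: fmul_distrib)

lemma fscale_simps [simp]:
  "fscale c 0 = 0" "fscale 0 a = 0" "fscale 1 a = a" "fscale c (fscale d a) = fscale (c * d) a"
  by (auto simp: fscale_def fun_eq_iff fun_apply_simps)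

lemma fscale_distrib:
  "fscale c (a + b) = fscale c a + fscale c b" "fscale c (a - b) = fscale c a - fscale c b"
  "fscale (c + d) a = fscale c a + fscale d a"
  by (auto simp: fscale_def fun_eq_iff fun_apply_simps algebra_simps)

lemma fscale_minus1: "fscale (-1) a = - (a :: 'g star_poly)"
  by (auto simp: fscale_def fun_eq_iff fun_apply_simps)

lemma word_star_word_star [simp]: "word_star (word_star u) = u"
  by (auto simp: word_star_def rev_map comp_def case_prod_beta)

lemma length_word_star [simp]: "length (word_star u) = length u"
  by (simp add: word_star_def)

lemma word_star_eq_iff: "word_star u = v \<longleftrightarrow> u = word_star v"
  by (metis word_star_word_star)

lemma word_star_words [simp]: "word_star u \<in> words G \<longleftrightarrow> u \<in> words G"
  by (auto simp: words_def word_star_def image_image case_prod_beta)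

lemma fstar_fmul: "fstar (a \<star> b) = fstar b \<star> fstar (a :: 'g star_poly)"
proof
  fix u :: "('g \<times> bool) list"
  let ?n = "length u"
  have t: "take i (word_star u) = word_star (drop (?n - i) u)" "drop i (word_star u) = word_star (take (?n - i) u)"
    if "i \<le> ?n" for i
    using that by (simp_all add: word_star_def take_rev drop_rev take_map drop_map)
  have "fstar (a \<star> b) u = (\<Sum>i\<le>?n. cnj (a (take i (word_star u))) * cnj (b (drop i (word_star u))))"
    by (simp add: fstar_def fmul_def)
  also have "\<dots> = (\<Sum>i\<le>?n. cnj (b (word_star (take i u))) * cnj (a (word_star (drop i u))))"
    by (rule sum.reindex_bij_witness[where i = "\<lambda>i. ?n - i" and j = "\<lambda>i. ?n - i"]) (auto simp: t)
  finally show "fstar (a \<star> b) u = (fstar b \<star> fstar a) u" by (simp add: fstar_def fmul_def)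
qed

lemma fstar_simps [simp]:
  "fstar (fstar a) = a" "fstar 0 = 0" "fstar (a + b) = fstar a + fstar b"
  "fstar (a - b) = fstar a - fstar b" "fstar (fscale c a) = fscale (cnj c) (fstar a)"
  by (auto simp: fstar_def fscale_def fun_eq_iff fun_apply_simps)

lemma fstar_sum: "fstar (sum f S) = (\<Sum>s\<in>S. fstar (f s))"
  by (induction S rule: infinite_finite_induct) simp_all

lemma mono_word_mult: "mono_word u \<star> mono_word v = mono_word (u @ v)"
proof
  fix w
  have "(mono_word u \<star> mono_word v) w = (\<Sum>i\<le>length w. if i = length u \<and> w = u @ v then 1 else 0)"
    unfolding fmul_def mono_word_def
  proof (intro sum.cong refl)
    fix i assume "i \<in> {..length w}"
    then have "take i w = u \<and> drop i w = v \<longleftrightarrow> i = length u \<and> w = u @ v"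
      by (metis append_eq_conv_conj append_take_drop_id atMost_iff length_take min.absorb2)
    then show "(if take i w = u then 1 else 0) * (if drop i w = v then 1 else 0) =
        (if i = length u \<and> w = u @ v then 1 else (0 :: complex))" by auto
  qed
  also have "\<dots> = mono_word (u @ v) w"
    by (cases "w = u @ v") (auto simp: mono_word_def)
  finally show "(mono_word u \<star> mono_word v) w = mono_word (u @ v) w" .
qed

lemma fstar_mono_word: "fstar (mono_word u) = mono_word (word_star u)"
proof
  fix v
  have "word_star v = u \<longleftrightarrow> v = word_star u" by (rule word_star_eq_iff)
  then show "fstar (mono_word u) v = mono_word (word_star u) v" by (simp add: fstar_def mono_word_def)
qed

lemma gen_eq: "gen g = mono_word [(g, False)]"
  by (simp add: gen_def mono_word_def)

lemma fstar_gen: "fstar (gen g) = mono_word [(g, True)]"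
  by (simp add: gen_eq fstar_mono_word word_star_def)

lemma fcar_0 [simp]: "0 \<in> fcar G"
  by (simp add: fcar_def fun_apply_simps)

lemma fcarI: "finite S \<Longrightarrow> S \<subseteq> words G \<Longrightarrow> {u. a u \<noteq> 0} \<subseteq> S \<Longrightarrow> a \<in> fcar G"
  unfolding fcar_def by (auto intro: finite_subset)

lemma fcarD: "a \<in> fcar G \<Longrightarrow> finite {u. a u \<noteq> 0}" "a \<in> fcar G \<Longrightarrow> {u. a u \<noteq> 0} \<subseteq> words G"
  by (auto simp: fcar_def)

lemma fcar_add [simp]: "a \<in> fcar G \<Longrightarrow> b \<in> fcar G \<Longrightarrow> a + b \<in> fcar G"
  by (rule fcarI[of "{u. a u \<noteq> 0} \<union> {u. b u \<noteq> 0}"]) (auto simp: fcarD fun_apply_simps dest: subsetD[OF fcarD(2)])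

lemma fcar_scale [simp]: "a \<in> fcar G \<Longrightarrow> fscale c a \<in> fcar G"
  unfolding fcar_def fscale_def by (auto intro: finite_subset[of _ "{u. a u \<noteq> 0}"])

lemma fcar_uminus [simp]: "a \<in> fcar G \<Longrightarrow> - a \<in> fcar G"
  using fcar_scale[of a G "-1"] by (simp add: fscale_minus1)

lemma fcar_diff [simp]: "a \<in> fcar G \<Longrightarrow> b \<in> fcar G \<Longrightarrow> a - b \<in> fcar G"
  using fcar_add[of a G "- b"] by simp

lemma fcar_sum [simp]: "(\<And>s. s \<in> S \<Longrightarrow> f s \<in> fcar G) \<Longrightarrow> sum f S \<in> fcar G"
  by (induction S rule: infinite_finite_induct) simp_all

lemma fcar_star [simp]: "a \<in> fcar G \<Longrightarrow> fstar a \<in> fcar G"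
proof -
  assume a: "a \<in> fcar G"
  have "{u. fstar a u \<noteq> 0} = word_star ` {u. a u \<noteq> 0}"
  proof (rule Set.set_eqI)
    fix u
    have "u \<in> word_star ` {u. a u \<noteq> 0} \<longleftrightarrow> a (word_star u) \<noteq> 0"
      using word_star_word_star[of u] by (metis (mono_tags, lifting) image_iff mem_Collect_eq word_star_word_star)
    then show "u \<in> {u. fstar a u \<noteq> 0} \<longleftrightarrow> u \<in> word_star ` {u. a u \<noteq> 0}"
      by (simp add: fstar_def)
  qed
  then show ?thesis using a by (auto simp: fcar_def)
qed

lemma fmul_nonzeroD: "(a \<star> b) u \<noteq> 0 \<Longrightarrow> \<exists>v w. u = v @ w \<and> a v \<noteq> 0 \<and> b w \<noteq> 0"
proof (rule ccontr)
  assume nz: "(a \<star> b) u \<noteq> 0" and no: "\<nexists>v w. u = v @ w \<and> a v \<noteq> 0 \<and> b w \<noteq> 0"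
  have "a (take i u) * b (drop i u) = 0" for i
    using no append_take_drop_id[of i u] by (metis mult_eq_0_iff)
  then have "(a \<star> b) u = 0" unfolding fmul_def by (intro sum.neutral ballI)
  then show False using nz by contradiction
qed

lemma fcar_mult [simp]: "a \<in> fcar G \<Longrightarrow> b \<in> fcar G \<Longrightarrow> a \<star> b \<in> fcar G"
proof -
  assume a: "a \<in> fcar G" and b: "b \<in> fcar G"
  have sub: "{u. (a \<star> b) u \<noteq> 0} \<subseteq> (\<lambda>(v, w). v @ w) ` ({u. a u \<noteq> 0} \<times> {u. b u \<noteq> 0})"
    using fmul_nonzeroD[of a b] by fastforce
  have "finite {u. (a \<star> b) u \<noteq> 0}"
    by (rule finite_subset[OF sub]) (use a b in \<open>auto simp: fcar_def\<close>)
  moreover have "u \<in> words G" if "(a \<star> b) u \<noteq> 0" for u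
  proof -
    obtain v w where vw: "u = v @ w" "a v \<noteq> 0" "b w \<noteq> 0" using fmul_nonzeroD[OF \<open>(a \<star> b) u \<noteq> 0\<close>] by blast
    then have "v \<in> words G" "w \<in> words G" using a b by (auto simp: fcar_def)
    then show ?thesis by (simp add: vw(1) words_def image_Un)
  qed
  ultimately show ?thesis by (auto simp: fcar_def)
qed

lemma fcar_mono_word [simp]: "mono_word u \<in> fcar G \<longleftrightarrow> u \<in> words G"
  by (auto simp: fcar_def mono_word_def)

lemma words_Cons: "l # u \<in> words G \<longleftrightarrow> fst l \<in> G \<and> (u = [] \<or> u \<in> words G)"
  by (auto simp: words_def)

lemma fcar_gen [simp]: "gen g \<in> fcar G \<longleftrightarrow> g \<in> G"
  by (simp add: gen_eq words_def)

lemma fcar_expand: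
  assumes "finite S" "{u. a u \<noteq> 0} \<subseteq> S"
  shows "a = (\<Sum>u\<in>S. fscale (a u) (mono_word u))"
proof
  fix v
  have "(\<Sum>u\<in>S. fscale (a u) (mono_word u)) v = (\<Sum>u\<in>S. if u = v then a u else 0)"
    unfolding fun_sum_apply by (intro sum.cong) (auto simp: fscale_def mono_word_def)
  then show "a v = (\<Sum>u\<in>S. fscale (a u) (mono_word u)) v" using assms by (auto simp: sum.delta)
qed

text \<open>
  Reduces linear identities on the free *-algebra to monomials.
\<close>

lemma free_induct [consumes 1, case_names zero add mono]:
  assumes a: "a \<in> fcar G" and P0: "P 0"
    and Padd: "\<And>a b. a \<in> fcar G \<Longrightarrow> b \<in> fcar G \<Longrightarrow> P a \<Longrightarrow> P b \<Longrightarrow> P (a + b)"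
    and Pmono: "\<And>c u. u \<in> words G \<Longrightarrow> P (fscale c (mono_word u))"
  shows "P a"
proof -
  let ?S = "{u. a u \<noteq> 0}"
  have *: "P (\<Sum>u\<in>S. fscale (a u) (mono_word u))" if "finite S" "S \<subseteq> words G" for S
    using that by (induction S rule: finite_induct) (auto intro!: P0 Padd Pmono fcar_sum)
  have "P (\<Sum>u\<in>?S. fscale (a u) (mono_word u))" using a by (intro *) (auto simp: fcar_def)
  moreover have "a = (\<Sum>u\<in>?S. fscale (a u) (mono_word u))"
    using a by (intro fcar_expand) (auto simp: fcar_def)
  ultimately show ?thesis by metis
qed

subsection \<open>Evaluation in operators\<close>

fun weval :: "('g \<Rightarrow> 'i op) \<Rightarrow> ('g \<times> bool) list \<Rightarrow> 'i op"
  where "weval t [] = id_blinfun"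
  | "weval t ((g, s) # u) = (if s then op_adj (t g) else t g) o\<^sub>L weval t u"

definition feval :: "('g \<Rightarrow> 'i op) \<Rightarrow> 'g star_poly \<Rightarrow> 'i op"
  where "feval t a = (\<Sum>u\<in>{u. a u \<noteq> 0}. op_scale (a u) (weval t u))"

lemma weval_append: "weval t (u @ v) = weval t u o\<^sub>L weval t v"
  by (induction t u rule: weval.induct) (auto simp: op_comp_assoc intro!: blinfun_eqI)

lemma feval_superset:
  assumes "finite S" "{u. a u \<noteq> 0} \<subseteq> S"
  shows "feval t a = (\<Sum>u\<in>S. op_scale (a u) (weval t u))"
  unfolding feval_def using assms by (intro sum.mono_neutral_left) (auto simp: op_scale_simps)

lemma feval_0 [simp]: "feval t 0 = 0"
  by (simp add: feval_def fun_apply_simps)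

lemma feval_add:
  assumes "a \<in> fcar G" "b \<in> fcar G"
  shows "feval t (a + b) = feval t a + feval t b"
proof -
  let ?S = "{u. a u \<noteq> 0} \<union> {u. b u \<noteq> 0}"
  have S: "finite ?S" using assms by (auto simp: fcar_def)
  have "feval t (a + b) = (\<Sum>u\<in>?S. op_scale ((a + b) u) (weval t u))"
    by (rule feval_superset[OF S]) (auto simp: fun_apply_simps)
  also have "\<dots> = (\<Sum>u\<in>?S. op_scale (a u) (weval t u)) + (\<Sum>u\<in>?S. op_scale (b u) (weval t u))"
    by (simp add: fun_apply_simps op_scale_simps sum.distrib)
  also have "\<dots> = feval t a + feval t b"
    using feval_superset[OF S, of a t] feval_superset[OF S, of b t] by auto
  finally show ?thesis .
qed

lemma feval_scale:
  assumes "a \<in> fcar G"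
  shows "feval t (fscale c a) = op_scale c (feval t a)"
proof -
  have "finite S \<Longrightarrow> op_scale c (\<Sum>u\<in>S. op_scale (a u) (weval t u)) = (\<Sum>u\<in>S. op_scale (c * a u) (weval t u))" for S
    by (induction S rule: finite_induct) (auto simp: op_scale_simps)
  moreover have "feval t (fscale c a) = (\<Sum>u\<in>{u. a u \<noteq> 0}. op_scale (c * a u) (weval t u))"
    using assms by (subst feval_superset[of "{u. a u \<noteq> 0}"]) (auto simp: fcar_def fscale_def)
  ultimately show ?thesis using assms by (simp add: feval_def fcar_def)
qed

lemma feval_uminus: "a \<in> fcar G \<Longrightarrow> feval t (- a) = - feval t a"
  using feval_scale[of a G t "-1"] by (simp add: fscale_minus1 op_scale_simps)

lemma feval_diff: "a \<in> fcar G \<Longrightarrow> b \<in> fcar G \<Longrightarrow> feval t (a - b) = feval t a - feval t b"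
  using feval_add[of a G "- b" t] by (simp add: feval_uminus)

lemma feval_sum: "(\<And>s. s \<in> S \<Longrightarrow> f s \<in> fcar G) \<Longrightarrow> feval t (sum f S) = (\<Sum>s\<in>S. feval t (f s))"
  by (induction S rule: infinite_finite_induct) (auto simp: feval_add[of _ G])

lemma feval_mono_word [simp]: "feval t (mono_word u) = weval t u"
  by (subst feval_superset[of "{u}"]) (auto simp: mono_word_def op_scale_simps)

context
  fixes t :: "'g \<Rightarrow> 'i op"
  assumes t: "\<And>g. clin (t g)"
begin

lemma clin_weval [simp]: "clin (weval t u)"
  by (induction u) (use t in auto)

lemma weval_word_star: "weval t (word_star u) = op_adj (weval t u)"
proof (induction u)
  case Nil
  have "op_adj id_blinfun = (id_blinfun :: 'i op)" by (rule op_adj_eqI) simp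
  then show ?case by (simp add: word_star_def)
next
  case (Cons l u)
  obtain g s where l: "l = (g, s)" by force
  have "weval t (word_star (l # u)) = weval t (word_star u) o\<^sub>L (if s then t g else op_adj (t g))"
    by (simp add: l word_star_def weval_append)
  then show ?case using t[of g] by (auto simp: l Cons adj_comp)
qed

lemma clin_feval [simp]: "clin (feval t a)"
proof -
  have "clin (\<Sum>u\<in>S. op_scale (a u) (weval t u))" for S
    by (induction S rule: infinite_finite_induct) auto
  then show ?thesis by (simp add: feval_def)
qed

lemma feval_mult:
  assumes "a \<in> fcar G" "b \<in> fcar G"
  shows "feval t (a \<star> b) = feval t a o\<^sub>L feval t b"
  using assms(1)
proof (induction rule: free_induct)
  case zero
  show ?case by simp
next
  case (add a a')
  have "feval t ((a + a') \<star> b) = feval t (a \<star> b) + feval t (a' \<star> b)"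
    using add assms by (simp add: fmul_distrib feval_add[of _ G])
  then show ?case using add by (simp add: feval_add[of _ G] op_comp_distrib)
next
  case (mono c u)
  show ?case using assms(2)
  proof (induction rule: free_induct)
    case zero
    show ?case by simp
  next
    case (add b b')
    have "feval t (fscale c (mono_word u) \<star> (b + b'))
        = feval t (fscale c (mono_word u) \<star> b) + feval t (fscale c (mono_word u) \<star> b')"
      unfolding fmul_distrib using add mono by (intro feval_add[of _ G]) auto
    then show ?case using add by (simp add: feval_add[of _ G] op_comp_distrib)
  next
    case (mono d v)
    have uv: "u @ v \<in> words G" using \<open>u \<in> words G\<close> mono by (auto simp: words_def)
    show ?case using mono \<open>u \<in> words G\<close> uv
      by (simp add: mono_word_mult feval_scale[of _ G] weval_append op_scale_simps mult.commute)
  qed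
qed

lemma feval_star:
  assumes "a \<in> fcar G"
  shows "feval t (fstar a) = op_adj (feval t a)"
  using assms
proof (induction rule: free_induct)
  case (add a b)
  then show ?case by (simp add: feval_add[of _ G] adj_add)
next
  case (mono c u)
  then show ?case by (simp add: feval_scale[of _ G] fstar_mono_word weval_word_star adj_scale)
qed simp

end

section \<open>C*-seminorms on the free *-algebra\<close>

locale free_cstar =
  fixes G :: "'g set" and \<rho> :: "'g star_poly \<Rightarrow> real"
  assumes cs: "cstar_seminorm (free_star_algebra G \<rho>) \<rho>"
begin

lemma rho_nonneg: "a \<in> fcar G \<Longrightarrow> 0 \<le> \<rho> a"
  and rho_add: "a \<in> fcar G \<Longrightarrow> b \<in> fcar G \<Longrightarrow> \<rho> (a + b) \<le> \<rho> a + \<rho> b"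
  and rho_scale: "a \<in> fcar G \<Longrightarrow> \<rho> (fscale c a) = cmod c * \<rho> a"
  and rho_mult: "a \<in> fcar G \<Longrightarrow> b \<in> fcar G \<Longrightarrow> \<rho> (a \<star> b) \<le> \<rho> a * \<rho> b"
  and rho_cstar: "a \<in> fcar G \<Longrightarrow> \<rho> (fstar a \<star> a) = (\<rho> a)\<^sup>2"
  using cs by (auto simp: cstar_seminorm_def)

lemma rho_0: "\<rho> 0 = 0"
  using rho_scale[of 0 0] by simp

lemma rho_uminus: "a \<in> fcar G \<Longrightarrow> \<rho> (- a) = \<rho> a"
  using rho_scale[of a "-1"] by (simp add: fscale_minus1)

lemma rho_diff: "a \<in> fcar G \<Longrightarrow> b \<in> fcar G \<Longrightarrow> \<rho> (a - b) \<le> \<rho> a + \<rho> b"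
  using rho_add[of a "- b"] by (simp add: rho_uminus)

lemma rho_diff_commute: "a \<in> fcar G \<Longrightarrow> b \<in> fcar G \<Longrightarrow> \<rho> (a - b) = \<rho> (b - a)"
  using rho_uminus[of "a - b"] by simp

lemma rho_sum: "(\<And>s. s \<in> S \<Longrightarrow> f s \<in> fcar G) \<Longrightarrow> \<rho> (sum f S) \<le> (\<Sum>s\<in>S. \<rho> (f s))"
proof (induction S rule: infinite_finite_induct)
  case (insert x S)
  then show ?case using rho_add[of "f x" "sum f S"] by simp
qed (simp_all add: rho_0)

lemma rho_star: "a \<in> fcar G \<Longrightarrow> \<rho> (fstar a) = \<rho> a"
proof -
  have le: "\<rho> a \<le> \<rho> (fstar a)" if a: "a \<in> fcar G" for a
  proof (cases "\<rho> a = 0")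
    case False
    have "\<rho> a * \<rho> a \<le> \<rho> (fstar a) * \<rho> a"
      using rho_cstar[OF a] rho_mult[of "fstar a" a] a by (simp add: power2_eq_square)
    then show ?thesis using False rho_nonneg[OF a] by (simp add: mult_le_cancel_right)
  qed (use a rho_nonneg in simp)
  assume "a \<in> fcar G"
  then show ?thesis using le[of a] le[of "fstar a"] by simp
qed

definition null :: "'g star_poly set"
  where "null = {a \<in> fcar G. \<rho> a = 0}"

lemma null_0: "0 \<in> null" by (simp add: null_def rho_0)

lemma null_diff: "a \<in> null \<Longrightarrow> b \<in> null \<Longrightarrow> a - b \<in> null"
  using rho_diff[of a b] rho_nonneg[of "a - b"] by (auto simp: null_def)

lemma null_add: "a \<in> null \<Longrightarrow> b \<in> null \<Longrightarrow> a + b \<in> null"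
  using rho_add[of a b] rho_nonneg[of "a + b"] by (auto simp: null_def)

lemma null_scale: "a \<in> null \<Longrightarrow> fscale c a \<in> null"
  by (auto simp: null_def rho_scale)

lemma null_star: "a \<in> null \<Longrightarrow> fstar a \<in> null"
  by (auto simp: null_def rho_star)

lemma null_mult: "a \<in> null \<Longrightarrow> b \<in> fcar G \<Longrightarrow> a \<star> b \<in> null" "a \<in> null \<Longrightarrow> b \<in> fcar G \<Longrightarrow> b \<star> a \<in> null"
  using rho_mult[of a b] rho_nonneg[of "a \<star> b"] rho_mult[of b a] rho_nonneg[of "b \<star> a"]
  by (auto simp: null_def)

lemma null_mult_congr:
  assumes "x - a \<in> null" "y - b \<in> null" "a \<in> fcar G" "b \<in> fcar G"
  shows "x \<star> y - a \<star> b \<in> null"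
proof -
  have "x \<in> fcar G" using assms fcar_add[of "x - a" G a] by (simp add: null_def)
  have "x \<star> y - a \<star> b = x \<star> (y - b) + (x - a) \<star> b" by (simp add: fmul_distrib)
  then show ?thesis
    using null_add[OF null_mult(2)[OF assms(2) \<open>x \<in> fcar G\<close>] null_mult(1)[OF assms(1,4)]] by simp
qed

lemma rho_diff_null: "a \<in> fcar G \<Longrightarrow> b \<in> fcar G \<Longrightarrow> a - b \<in> null \<Longrightarrow> \<rho> a = \<rho> b"
  using rho_add[of "a - b" b] rho_add[of "b - a" a] rho_diff_commute[of a b] by (simp add: null_def)

lemma quotient_data_null: "quotient_data (free_star_algebra G \<nu>) null"
  by unfold_locales (auto simp: null_0 null_diff)

lemma power_sq:
  assumes "h \<in> fcar G" "fstar h = h"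
  shows "((\<lambda>x. x \<star> x) ^^ m) h \<in> fcar G \<and> fstar (((\<lambda>x. x \<star> x) ^^ m) h) = ((\<lambda>x. x \<star> x) ^^ m) h
    \<and> \<rho> (((\<lambda>x. x \<star> x) ^^ m) h) = \<rho> h ^ (2 ^ m)"
proof (induction m)
  case (Suc m)
  let ?x = "((\<lambda>x. x \<star> x) ^^ m) h"
  have "\<rho> (?x \<star> ?x) = (\<rho> ?x)\<^sup>2" using rho_cstar[of ?x] Suc by simp
  then show ?case using Suc by (simp add: fstar_fmul power_mult[symmetric] mult.commute)
qed (use assms in simp)

end

text \<open>
  The power trick: an estimate with a factor that grows at most linearly in the exponent becomes
  an estimate with constant 1 on taking roots.
\<close>

lemma le_if_powers_le:
  fixes x y B B' :: real
  assumes "0 \<le> x" "0 \<le> y" and le: "\<And>m. x ^ (2 ^ m) \<le> (B * 2 ^ m + B') * y ^ (2 ^ m)"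
  shows "x \<le> y"
proof (rule ccontr)
  assume "\<not> x \<le> y"
  then have xy: "y < x" by simp
  then have x: "0 < x" using assms by simp
  define r where "r = y / x"
  have r: "0 \<le> r" "r < 1" using xy x assms by (auto simp: r_def)
  have two: "filterlim (\<lambda>m::nat. 2 ^ m :: nat) at_top at_top"
    by (rule filterlim_subseq) (auto intro!: strict_monoI)
  have "(\<lambda>k. of_nat k * r ^ k) \<longlonglongrightarrow> 0" using r by (intro powser_times_n_limit_0) simp
  moreover have "(\<lambda>k. r ^ k) \<longlonglongrightarrow> 0" using r by (intro LIMSEQ_power_zero) simp
  ultimately have "(\<lambda>k. B * (of_nat k * r ^ k) + B' * r ^ k) \<longlonglongrightarrow> B * 0 + B' * 0"
    by (intro tendsto_add tendsto_mult_left)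
  then have "(\<lambda>m. B * (of_nat (2 ^ m) * r ^ (2 ^ m)) + B' * r ^ (2 ^ m)) \<longlonglongrightarrow> B * 0 + B' * 0"
    by (rule filterlim_compose[OF _ two])
  moreover have "1 \<le> B * (of_nat (2 ^ m) * r ^ (2 ^ m)) + B' * r ^ (2 ^ m)" for m
  proof -
    have "1 = x ^ (2 ^ m) / x ^ (2 ^ m)" using x by simp
    also have "\<dots> \<le> (B * 2 ^ m + B') * y ^ (2 ^ m) / x ^ (2 ^ m)"
      using le[of m] x by (intro divide_right_mono) auto
    also have "\<dots> = B * (of_nat (2 ^ m) * r ^ (2 ^ m)) + B' * r ^ (2 ^ m)"
      by (simp add: r_def power_divide algebra_simps add_divide_distrib)
    finally show ?thesis .
  qed
  ultimately have "1 \<le> B * 0 + B' * (0 :: real)"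
    by (intro LIMSEQ_le_const) auto
  then show False by simp
qed

section \<open>Gauge-invariant uniqueness\<close>

text \<open>
  For a finite graph without sources the Cuntz-Krieger relations at the vertices are equalities,
  so that every vertex projection can be expanded through edges.
\<close>

locale ck_graph = wf_digraph F for F :: "('v, 'e) pre_digraph" +
  assumes finite_verts: "finite (verts F)" and finite_arcs: "finite (arcs F)"
    and no_sources: "x \<in> verts F \<Longrightarrow> in_arcs F x \<noteq> {}"
begin

abbreviation "C \<equiv> fcar (ck_gens F)"
abbreviation p :: "'v \<Rightarrow> ('v + 'e) star_poly" where "p x \<equiv> gen (Inl x)"
abbreviation s :: "'e \<Rightarrow> ('v + 'e) star_poly" where "s f \<equiv> gen (Inr f)"
abbreviation t :: "'e \<Rightarrow> ('v + 'e) star_poly" where "t f \<equiv> fstar (gen (Inr f))"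

lemma gens_simps [simp]:
  "Inl x \<in> ck_gens F \<longleftrightarrow> x \<in> verts F" "Inr f \<in> ck_gens F \<longleftrightarrow> f \<in> arcs F"
  by (auto simp: ck_gens_def)

definition ck_relations :: "(('v + 'e) star_poly \<Rightarrow> real) \<Rightarrow> bool"
  where "ck_relations \<rho> \<longleftrightarrow>
    (\<forall>x\<in>verts F. \<rho> (p x \<star> p x - p x) = 0 \<and> \<rho> (fstar (p x) - p x) = 0) \<and>
    (\<forall>x\<in>verts F. \<forall>y\<in>verts F. x \<noteq> y \<longrightarrow> \<rho> (p x \<star> p y) = 0) \<and>
    (\<forall>f\<in>arcs F. \<rho> (s f \<star> t f \<star> s f - s f) = 0) \<and>
    (\<forall>f\<in>arcs F. \<forall>g\<in>arcs F. f \<noteq> g \<longrightarrow> \<rho> (t f \<star> s g) = 0) \<and>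
    (\<forall>f\<in>arcs F. \<rho> (t f \<star> s f - p (tail F f)) = 0) \<and>
    (\<forall>x\<in>verts F. \<rho> ((\<Sum>f\<in>in_arcs F x. s f \<star> t f) - p x) = 0)"

lemma in_arcs_arcs: "f \<in> in_arcs F x \<Longrightarrow> f \<in> arcs F" "finite (in_arcs F x)"
  using finite_arcs by (auto simp: in_arcs_def)

lemma sum_in_arcs_C: "(\<Sum>f\<in>in_arcs F x. s f \<star> t f) \<in> C"
proof (rule fcar_sum)
  fix f assume "f \<in> in_arcs F x"
  then have "f \<in> arcs F" by (rule in_arcs_arcs)
  then show "s f \<star> t f \<in> C" by simp
qed

text \<open>
  Each relation between cosets modulo the kernel of \<open>\<rho>\<close> says that \<open>\<rho>\<close> vanishes on a
  difference.  The inequality of the definition follows from the equality with \<open>c = 0\<close>, as no vertex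
  is a source.
\<close>

lemma ck_seminorm_iff:
  "ck_seminorm F \<rho> \<longleftrightarrow> cstar_seminorm (free_star_algebra (ck_gens F) \<rho>) \<rho> \<and> ck_relations \<rho>"
proof -
  let ?A = "free_star_algebra (ck_gens F) \<rho>"
  let ?I = "{a \<in> carrier ?A. \<rho> a = 0}"
  let ?Q = "quot ?A ?I"
  let ?P = "\<lambda>x. ?I +>\<^bsub>?A\<^esub> gen (Inl x)" and ?S = "\<lambda>f. ?I +>\<^bsub>?A\<^esub> gen (Inr f)"
  have "ck_family F ?Q ?P ?S \<longleftrightarrow> ck_relations \<rho>" if cs: "cstar_seminorm ?A \<rho>"
  proof -
    interpret free_cstar "ck_gens F" \<rho> by unfold_locales (rule cs)
    have I: "?I = null" by (simp add: null_def)
    interpret quotient_data ?A null by (rule quotient_data_null)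
    let ?N = "quot ?A null"
    let ?c = "\<lambda>a. null +>\<^bsub>?A\<^esub> a"
    have mult: "?c a \<otimes>\<^bsub>?N\<^esub> ?c b = ?c (a \<star> b)" if "a \<in> C" "b \<in> C" for a b
      using quot_mult[of a b] null_mult_congr[of _ a _ b] that by simp
    have star: "star (?N) (?c a) = ?c (fstar a)" if "a \<in> C" for a
      using quot_star[of a] null_star[of "_ - a"] by simp
    have eq: "?c a = ?c b \<longleftrightarrow> \<rho> (a - b) = 0" if "a \<in> C" "b \<in> C" for a b
      unfolding coset_eq_iff using that by (simp add: null_def)
    have car: "?c a \<in> carrier (?N)" if "a \<in> C" for a
      using that by (auto simp: quot_carrier)
    have fs: "(\<Oplus>\<^bsub>?N\<^esub>f\<in>in_arcs F x. ?c (s f) \<otimes>\<^bsub>?N\<^esub> star (?N) (?c (s f)))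
        = ?c (\<Sum>f\<in>in_arcs F x. s f \<star> t f)" for x
    proof -
      interpret Q: abelian_monoid "?N" by (rule quot_abelian_monoid)
      have "(\<Oplus>\<^bsub>?N\<^esub>f\<in>in_arcs F x. ?c (s f) \<otimes>\<^bsub>?N\<^esub> star (?N) (?c (s f)))
          = (\<Oplus>\<^bsub>?N\<^esub>f\<in>in_arcs F x. ?c (s f \<star> t f))"
      proof (rule Q.finsum_cong'[OF refl])
        show "(\<lambda>f. ?c (s f \<star> t f)) \<in> in_arcs F x \<rightarrow> carrier (?N)"
          by (intro Pi_I car) (simp add: in_arcs_arcs)
        fix f assume "f \<in> in_arcs F x"
        then have "s f \<in> C" "t f \<in> C" by (simp_all add: in_arcs_arcs)
        then show "?c (s f) \<otimes>\<^bsub>?N\<^esub> star (?N) (?c (s f)) = ?c (s f \<star> t f)"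
          by (simp only: star mult)
      qed
      also have "\<dots> = ?c (\<Sum>f\<in>in_arcs F x. s f \<star> t f)"
        by (rule quot_finsum) (auto simp: in_arcs_arcs)
      finally show ?thesis .
    qed
    have le: "star_le (?N) (?c a) (?c a)" if "a \<in> C" for a
      unfolding star_le_def
    proof (rule bexI[of _ "?c 0"])
      have "star (?N) (?c 0) \<otimes>\<^bsub>?N\<^esub> ?c 0 = ?c 0"
        using star[of 0] mult[of 0 0] by simp
      then show "?c a = ?c a \<oplus>\<^bsub>?N\<^esub> (star (?N) (?c 0) \<otimes>\<^bsub>?N\<^esub> ?c 0)"
        by (simp add: quot_add del: free_star_algebra_simps)
    qed (intro car, simp)
    have zero: "\<zero>\<^bsub>?N\<^esub> = ?c 0" by (rule quot_zero)
    have 0: "?c \<circ> p \<in> verts F \<rightarrow> carrier (?N)" "?c \<circ> s \<in> arcs F \<rightarrow> carrier (?N)"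
      by (auto intro!: car simp del: free_star_algebra_simps)
    have 1: "?c (p x) \<otimes>\<^bsub>?N\<^esub> ?c (p x) = ?c (p x) \<longleftrightarrow> \<rho> (p x \<star> p x - p x) = 0"
        "star (?N) (?c (p x)) = ?c (p x) \<longleftrightarrow> \<rho> (fstar (p x) - p x) = 0" if "x \<in> verts F" for x
      using that by (simp_all add: mult star eq del: free_star_algebra_simps)
    have 2: "?c (p x) \<otimes>\<^bsub>?N\<^esub> ?c (p y) = ?c 0 \<longleftrightarrow> \<rho> (p x \<star> p y) = 0"
      if "x \<in> verts F" "y \<in> verts F" for x y
      using that by (simp add: mult eq del: free_star_algebra_simps)
    have 3: "?c (s f) \<otimes>\<^bsub>?N\<^esub> star (?N) (?c (s f)) \<otimes>\<^bsub>?N\<^esub> ?c (s f) = ?c (s f)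
        \<longleftrightarrow> \<rho> (s f \<star> t f \<star> s f - s f) = 0"
        "star (?N) (?c (s f)) \<otimes>\<^bsub>?N\<^esub> ?c (s f) = ?c (p (tail F f))
        \<longleftrightarrow> \<rho> (t f \<star> s f - p (tail F f)) = 0" if "f \<in> arcs F" for f
      using that by (simp_all add: mult star eq del: free_star_algebra_simps)
    have 4: "star (?N) (?c (s f)) \<otimes>\<^bsub>?N\<^esub> ?c (s g) = ?c 0 \<longleftrightarrow> \<rho> (t f \<star> s g) = 0"
      if "f \<in> arcs F" "g \<in> arcs F" for f g
      using that by (simp add: mult star eq del: free_star_algebra_simps)
    have 5: "?c (\<Sum>f\<in>in_arcs F x. s f \<star> t f) = ?c (p x) \<longleftrightarrow> \<rho> ((\<Sum>f\<in>in_arcs F x. s f \<star> t f) - p x) = 0"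
      if "x \<in> verts F" for x
      using that by (intro eq sum_in_arcs_C) simp
    have 6: "star_le (?N) (?c (\<Sum>f\<in>in_arcs F x. s f \<star> t f)) (?c (p x))"
      if "x \<in> verts F" "?c (\<Sum>f\<in>in_arcs F x. s f \<star> t f) = ?c (p x)" for x
      unfolding that(2) using that(1) by (intro le) simp
    have pi: "(\<lambda>x. ?c (p x)) \<in> verts F \<rightarrow> carrier (?N)" "(\<lambda>f. ?c (s f)) \<in> arcs F \<rightarrow> carrier (?N)"
      using 0 by (simp_all add: comp_def)
    have c1: "(\<forall>x\<in>verts F. ?c (p x) \<otimes>\<^bsub>?N\<^esub> ?c (p x) = ?c (p x) \<and> star (?N) (?c (p x)) = ?c (p x))
        \<longleftrightarrow> (\<forall>x\<in>verts F. \<rho> (p x \<star> p x - p x) = 0 \<and> \<rho> (fstar (p x) - p x) = 0)"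
      using 1 by (intro ball_cong refl) (simp del: free_star_algebra_simps)
    have c2: "(\<forall>x\<in>verts F. \<forall>y\<in>verts F. x \<noteq> y \<longrightarrow> ?c (p x) \<otimes>\<^bsub>?N\<^esub> ?c (p y) = ?c 0)
        \<longleftrightarrow> (\<forall>x\<in>verts F. \<forall>y\<in>verts F. x \<noteq> y \<longrightarrow> \<rho> (p x \<star> p y) = 0)"
      using 2 by (intro ball_cong refl) (simp del: free_star_algebra_simps)
    have c3: "(\<forall>f\<in>arcs F. ?c (s f) \<otimes>\<^bsub>?N\<^esub> star (?N) (?c (s f)) \<otimes>\<^bsub>?N\<^esub> ?c (s f) = ?c (s f))
        \<longleftrightarrow> (\<forall>f\<in>arcs F. \<rho> (s f \<star> t f \<star> s f - s f) = 0)"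
      using 3 by (intro ball_cong refl) (simp del: free_star_algebra_simps)
    have c4: "(\<forall>f\<in>arcs F. \<forall>g\<in>arcs F. f \<noteq> g \<longrightarrow> star (?N) (?c (s f)) \<otimes>\<^bsub>?N\<^esub> ?c (s g) = ?c 0)
        \<longleftrightarrow> (\<forall>f\<in>arcs F. \<forall>g\<in>arcs F. f \<noteq> g \<longrightarrow> \<rho> (t f \<star> s g) = 0)"
      using 4 by (intro ball_cong refl) (simp del: free_star_algebra_simps)
    have c5: "(\<forall>f\<in>arcs F. star (?N) (?c (s f)) \<otimes>\<^bsub>?N\<^esub> ?c (s f) = ?c (p (tail F f)))
        \<longleftrightarrow> (\<forall>f\<in>arcs F. \<rho> (t f \<star> s f - p (tail F f)) = 0)"
      using 3 by (intro ball_cong refl) (simp del: free_star_algebra_simps)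
    have c6: "(\<forall>x\<in>verts F. star_le (?N) (?c (\<Sum>f\<in>in_arcs F x. s f \<star> t f)) (?c (p x))) \<and>
        (\<forall>x\<in>verts F. in_arcs F x \<noteq> {} \<longrightarrow> ?c (\<Sum>f\<in>in_arcs F x. s f \<star> t f) = ?c (p x))
        \<longleftrightarrow> (\<forall>x\<in>verts F. \<rho> ((\<Sum>f\<in>in_arcs F x. s f \<star> t f) - p x) = 0)"
      using no_sources 5 6 by blast
    show ?thesis
      unfolding I ck_family_def ck_relations_def fs zero
      by (simp only: pi c1 c2 c3 c4 c5 c6 simp_thms)
  qed
  then show ?thesis unfolding ck_seminorm_def Let_def by blast
qed

text \<open>
  Equality for all Cuntz-Krieger seminorms at once: the comparison of two seminorms below needs one
  expansion whose coefficients serve both.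
\<close>

definition ckeq :: "('v + 'e) star_poly \<Rightarrow> ('v + 'e) star_poly \<Rightarrow> bool"  (infix "\<doteq>" 50)
  where "a \<doteq> b \<longleftrightarrow> a \<in> C \<and> b \<in> C \<and> (\<forall>\<rho>. ck_seminorm F \<rho> \<longrightarrow> \<rho> (a - b) = 0)"

lemma ck_free_cstar: "ck_seminorm F \<rho> \<Longrightarrow> free_cstar (ck_gens F) \<rho>"
  by (simp add: ck_seminorm_iff free_cstar_def)

lemma ckeq_iff: "a \<doteq> b \<longleftrightarrow> a \<in> C \<and> b \<in> C \<and> (\<forall>\<rho>. ck_seminorm F \<rho> \<longrightarrow> a - b \<in> free_cstar.null (ck_gens F) \<rho>)"
  unfolding ckeq_def using ck_free_cstar by (auto simp: free_cstar.null_def)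

lemma ckeq_C: "a \<doteq> b \<Longrightarrow> a \<in> C" "a \<doteq> b \<Longrightarrow> b \<in> C"
  by (auto simp: ckeq_def)

lemma ckeq_rho: "a \<doteq> b \<Longrightarrow> ck_seminorm F \<rho> \<Longrightarrow> \<rho> a = \<rho> b"
  using free_cstar.rho_diff_null[OF ck_free_cstar] by (auto simp: ckeq_iff)

lemma ckeq_refl: "a \<in> C \<Longrightarrow> a \<doteq> a"
  using free_cstar.rho_0[OF ck_free_cstar] by (auto simp: ckeq_def)

lemma ckeq_sym: "a \<doteq> b \<Longrightarrow> b \<doteq> a"
  using free_cstar.rho_diff_commute[OF ck_free_cstar] by (auto simp: ckeq_def)

lemma ckeq_trans [trans]: "a \<doteq> b \<Longrightarrow> b \<doteq> c \<Longrightarrow> a \<doteq> c"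
  unfolding ckeq_iff using free_cstar.null_add[OF ck_free_cstar, of _ "a - b" "b - c"] by auto

lemma ckeq_eq_trans [trans]: "a = b \<Longrightarrow> b \<doteq> c \<Longrightarrow> a \<doteq> c" "a \<doteq> b \<Longrightarrow> b = c \<Longrightarrow> a \<doteq> c"
  by simp_all

lemma ckeq_add: "a \<doteq> b \<Longrightarrow> c \<doteq> d \<Longrightarrow> a + c \<doteq> b + d"
  unfolding ckeq_iff using free_cstar.null_add[OF ck_free_cstar, of _ "a - b" "c - d"]
  by (auto simp: algebra_simps)

lemma ckeq_scale: "a \<doteq> b \<Longrightarrow> fscale c a \<doteq> fscale c b"
  unfolding ckeq_iff using free_cstar.null_scale[OF ck_free_cstar, of _ "a - b"]
  by (auto simp: fscale_distrib)

lemma ckeq_star: "a \<doteq> b \<Longrightarrow> fstar a \<doteq> fstar b"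
  unfolding ckeq_iff using free_cstar.null_star[OF ck_free_cstar, of _ "a - b"] by auto

lemma ckeq_mult: "a \<doteq> b \<Longrightarrow> c \<doteq> d \<Longrightarrow> a \<star> c \<doteq> b \<star> d"
  unfolding ckeq_iff using free_cstar.null_mult_congr[OF ck_free_cstar, of _ a b c d] by auto

lemma ckeq_mult_left: "a \<doteq> b \<Longrightarrow> c \<in> C \<Longrightarrow> c \<star> a \<doteq> c \<star> b"
  by (intro ckeq_mult ckeq_refl)

lemma ckeq_mult_right: "a \<doteq> b \<Longrightarrow> c \<in> C \<Longrightarrow> a \<star> c \<doteq> b \<star> c"
  by (intro ckeq_mult ckeq_refl)

lemma ckeq_sum: "(\<And>x. x \<in> S \<Longrightarrow> f x \<doteq> g x) \<Longrightarrow> sum f S \<doteq> sum g S"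
  by (induction S rule: infinite_finite_induct) (auto intro: ckeq_refl ckeq_add)

lemma ck_pp: "x \<in> verts F \<Longrightarrow> p x \<star> p x \<doteq> p x"
  and ck_pstar: "x \<in> verts F \<Longrightarrow> fstar (p x) \<doteq> p x"
  and ck_pq: "x \<in> verts F \<Longrightarrow> y \<in> verts F \<Longrightarrow> x \<noteq> y \<Longrightarrow> p x \<star> p y \<doteq> 0"
  and ck_sts: "f \<in> arcs F \<Longrightarrow> s f \<star> t f \<star> s f \<doteq> s f"
  and ck_ts0: "f \<in> arcs F \<Longrightarrow> g \<in> arcs F \<Longrightarrow> f \<noteq> g \<Longrightarrow> t f \<star> s g \<doteq> 0"
  and ck_ts: "f \<in> arcs F \<Longrightarrow> t f \<star> s f \<doteq> p (tail F f)"
  and ck_sum: "x \<in> verts F \<Longrightarrow> (\<Sum>f\<in>in_arcs F x. s f \<star> t f) \<doteq> p x"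
  unfolding ckeq_def ck_seminorm_iff ck_relations_def by (auto simp: sum_in_arcs_C)

lemma ck_p_p: "x \<in> verts F \<Longrightarrow> y \<in> verts F \<Longrightarrow> p x \<star> p y \<doteq> (if y = x then p y else 0)"
  by (auto intro: ck_pp ck_pq)

lemma ck_t_s: "f \<in> arcs F \<Longrightarrow> g \<in> arcs F \<Longrightarrow> t f \<star> s g \<doteq> (if f = g then p (tail F f) else 0)"
  by (auto intro: ck_ts ck_ts0)

lemma ck_tst: "f \<in> arcs F \<Longrightarrow> t f \<star> s f \<star> t f \<doteq> t f"
  using ckeq_star[OF ck_sts[of f]] by (simp add: fstar_fmul fmul_assoc)

text \<open>
  Expand \<open>p\<^sub>x\<close> as the sum of the range projections of the edges ending at \<open>x\<close>; by orthogonality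
  only the term of \<open>f\<close> itself can survive.
\<close>

lemma ck_t_p:
  assumes f: "f \<in> arcs F" and x: "x \<in> verts F"
  shows "t f \<star> p x \<doteq> (if head F f = x then t f else 0)"
proof -
  have "t f \<star> p x \<doteq> t f \<star> (\<Sum>g\<in>in_arcs F x. s g \<star> t g)"
    using f x by (intro ckeq_mult_left ckeq_sym[OF ck_sum]) auto
  also have "\<dots> = (\<Sum>g\<in>in_arcs F x. t f \<star> s g \<star> t g)" by (simp add: fmul_sum_right fmul_assoc)
  also have "\<dots> \<doteq> (\<Sum>g\<in>in_arcs F x. if g = f then t f else 0)"
  proof (rule ckeq_sum)
    fix g assume "g \<in> in_arcs F x"
    then have g: "g \<in> arcs F" by (simp add: in_arcs_arcs)
    show "t f \<star> s g \<star> t g \<doteq> (if g = f then t f else 0)"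
    proof (cases "g = f")
      case True
      then show ?thesis using ck_tst[OF f] by simp
    next
      case False
      have "t f \<star> s g \<star> t g \<doteq> 0 \<star> t g" using False f g by (intro ckeq_mult_right ck_ts0) auto
      then show ?thesis using False by simp
    qed
  qed
  also have "\<dots> = (if head F f = x then t f else 0)"
    using f in_arcs_arcs(2)[of x] by (simp add: in_arcs_def)
  finally show ?thesis .
qed

lemma ck_s_p:
  assumes f: "f \<in> arcs F" and x: "x \<in> verts F"
  shows "s f \<star> p x \<doteq> (if tail F f = x then s f else 0)"
proof -
  have *: "s f \<star> t f \<star> s f \<star> p x \<doteq> s f \<star> p x" using f x by (intro ckeq_mult_right ck_sts) auto
  have "s f \<star> p x \<doteq> s f \<star> (t f \<star> s f) \<star> p x" using ckeq_sym[OF *] by (simp add: fmul_assoc)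
  also have "\<dots> \<doteq> s f \<star> p (tail F f) \<star> p x"
    using f x by (intro ckeq_mult_right ckeq_mult_left ck_ts) auto
  also have "\<dots> = s f \<star> (p (tail F f) \<star> p x)" by (simp add: fmul_assoc)
  also have "\<dots> \<doteq> s f \<star> (if tail F f = x then p x else 0)"
    using f x ck_p_p[of "tail F f" x] by (intro ckeq_mult_left) (auto split: if_splits)
  finally have 1: "s f \<star> p x \<doteq> s f \<star> (if tail F f = x then p x else 0)" .
  show ?thesis
  proof (cases "tail F f = x")
    case True
    have "s f \<star> p x \<doteq> s f \<star> (t f \<star> s f)"
      using f True by (intro ckeq_mult_left ckeq_sym[OF ck_ts, of f, unfolded True]) auto
    also have "\<dots> \<doteq> s f" using ck_sts[OF f] by (simp add: fmul_assoc)
    finally show ?thesis using True by simp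
  qed (use 1 in simp)
qed

lemma ck_p_s: "f \<in> arcs F \<Longrightarrow> x \<in> verts F \<Longrightarrow> p x \<star> s f \<doteq> (if head F f = x then s f else 0)"
proof -
  assume f: "f \<in> arcs F" and x: "x \<in> verts F"
  have "p x \<star> s f \<doteq> fstar (p x) \<star> s f" using f x by (intro ckeq_mult_right ckeq_sym[OF ck_pstar]) auto
  also have "\<dots> = fstar (t f \<star> p x)" by (simp add: fstar_fmul)
  also have "\<dots> \<doteq> fstar (if head F f = x then t f else 0)" by (intro ckeq_star ck_t_p f x)
  finally show ?thesis by (simp split: if_splits)
qed

lemma ck_p_t: "f \<in> arcs F \<Longrightarrow> x \<in> verts F \<Longrightarrow> p x \<star> t f \<doteq> (if tail F f = x then t f else 0)"
proof -
  assume f: "f \<in> arcs F" and x: "x \<in> verts F"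
  have "p x \<star> t f \<doteq> fstar (p x) \<star> t f" using f x by (intro ckeq_mult_right ckeq_sym[OF ck_pstar]) auto
  also have "\<dots> = fstar (s f \<star> p x)" by (simp add: fstar_fmul)
  also have "\<dots> \<doteq> fstar (if tail F f = x then s f else 0)" by (intro ckeq_star ck_s_p f x)
  finally show ?thesis by (simp split: if_splits)
qed

definition unit :: "('v + 'e) star_poly"
  where "unit = (\<Sum>x\<in>verts F. p x)"

lemma unit_C [simp]: "unit \<in> C"
  by (simp add: unit_def)

text \<open>
  The sum of the vertex projections is a unit modulo the relations, although the free algebra has
  no unit; it suffices to check the letters.
\<close>

lemma unit_letter:
  assumes "fst l \<in> ck_gens F"
  shows "unit \<star> mono_word [l] \<doteq> mono_word [l]"
proof -
  have pick: "unit \<star> b \<doteq> b" if "y \<in> verts F" "\<And>x. x \<in> verts F \<Longrightarrow> p x \<star> b \<doteq> (if y = x then b else 0)" for b y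
  proof -
    have "unit \<star> b = (\<Sum>x\<in>verts F. p x \<star> b)" by (simp add: unit_def fmul_sum_left)
    also have "\<dots> \<doteq> (\<Sum>x\<in>verts F. if y = x then b else 0)" by (intro ckeq_sum that)
    finally show ?thesis using that(1) finite_verts by (simp add: sum.delta)
  qed
  consider (v) x where "l = (Inl x, False)" "x \<in> verts F" | (v') x where "l = (Inl x, True)" "x \<in> verts F"
    | (e) f where "l = (Inr f, False)" "f \<in> arcs F" | (e') f where "l = (Inr f, True)" "f \<in> arcs F"
    using assms by (cases l; cases "fst l"; cases "snd l") auto
  then show ?thesis
  proof cases
    case v
    have "unit \<star> p x \<doteq> p x" using v by (intro pick[of x] ck_p_p)
    then show ?thesis using v by (simp add: gen_eq)
  next
    case v'
    have 1: "unit \<star> p x \<doteq> p x" using v' by (intro pick[of x] ck_p_p)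
    have "unit \<star> fstar (p x) \<doteq> unit \<star> p x" using v' by (intro ckeq_mult_left ck_pstar) auto
    also note 1
    also have "p x \<doteq> fstar (p x)" using v' by (intro ckeq_sym[OF ck_pstar])
    finally show ?thesis using v' by (simp add: fstar_gen)
  next
    case e
    have "unit \<star> s f \<doteq> s f" using e by (intro pick[of "head F f"] ck_p_s) auto
    then show ?thesis using e by (simp add: gen_eq)
  next
    case e'
    have "unit \<star> t f \<doteq> t f" using e' by (intro pick[of "tail F f"] ck_p_t) auto
    then show ?thesis using e' by (simp add: fstar_gen)
  qed
qed

lemma unit_left: "a \<in> C \<Longrightarrow> unit \<star> a \<doteq> a"
proof (induction rule: free_induct)
  case zero
  then show ?case by (simp add: ckeq_refl)
next
  case (add a b)
  then show ?case by (simp add: fmul_distrib ckeq_add)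
next
  case (mono c u)
  have "unit \<star> mono_word u \<doteq> mono_word u"
  proof (cases u)
    case Nil
    then show ?thesis using mono by (simp add: words_def)
  next
    case (Cons l v)
    have l: "fst l \<in> ck_gens F" using mono by (simp add: words_Cons Cons)
    show ?thesis
    proof (cases "v = []")
      case True
      then show ?thesis using unit_letter[OF l] Cons by simp
    next
      case False
      then have "mono_word v \<in> C" using mono by (simp add: words_Cons Cons)
      then have "unit \<star> mono_word [l] \<star> mono_word v \<doteq> mono_word [l] \<star> mono_word v"
        by (intro ckeq_mult_right unit_letter l)
      then show ?thesis by (simp add: fmul_assoc mono_word_mult Cons)
    qed
  qed
  then show ?case by (simp add: ckeq_scale)
qed

lemma unit_star: "fstar unit \<doteq> unit"
  unfolding unit_def fstar_sum by (intro ckeq_sum ck_pstar)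

lemma unit_right: "a \<in> C \<Longrightarrow> a \<star> unit \<doteq> a"
proof -
  assume a: "a \<in> C"
  have "a \<star> unit \<doteq> a \<star> fstar unit" using a by (intro ckeq_mult_left ckeq_sym[OF unit_star])
  also have "\<dots> = fstar (unit \<star> fstar a)" by (simp add: fstar_fmul)
  also have "\<dots> \<doteq> fstar (fstar a)" using a by (intro ckeq_star unit_left) simp
  finally show ?thesis by simp
qed

lemma unit_arcs: "unit \<doteq> (\<Sum>f\<in>arcs F. s f \<star> t f)"
proof -
  have "unit \<doteq> (\<Sum>x\<in>verts F. \<Sum>f\<in>in_arcs F x. s f \<star> t f)"
    unfolding unit_def by (intro ckeq_sum ckeq_sym[OF ck_sum])
  also have "\<dots> = (\<Sum>f\<in>(\<Union>x\<in>verts F. in_arcs F x). s f \<star> t f)"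
    using finite_verts in_arcs_arcs by (intro sum.UNION_disjoint[symmetric]) (auto simp: in_arcs_def)
  also have "(\<Union>x\<in>verts F. in_arcs F x) = arcs F" by (auto simp: in_arcs_def)
  finally show ?thesis .
qed

lemma split_middle:
  assumes "a \<in> C" "b \<in> C"
  shows "a \<star> b \<doteq> (\<Sum>f\<in>arcs F. (a \<star> s f) \<star> (t f \<star> b))"
proof -
  have "a \<star> b \<doteq> a \<star> (unit \<star> b)" using assms by (intro ckeq_mult_left ckeq_sym[OF unit_left])
  also have "\<dots> \<doteq> a \<star> ((\<Sum>f\<in>arcs F. s f \<star> t f) \<star> b)"
    using assms by (intro ckeq_mult_left ckeq_mult_right unit_arcs)
  also have "\<dots> = (\<Sum>f\<in>arcs F. (a \<star> s f) \<star> (t f \<star> b))"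
    by (simp add: fmul_sum_left fmul_sum_right fmul_assoc)
  finally show ?thesis .
qed

lemma split_left: "a \<in> C \<Longrightarrow> a \<doteq> (\<Sum>f\<in>arcs F. s f \<star> (t f \<star> a))"
proof -
  assume a: "a \<in> C"
  have "a \<doteq> unit \<star> a" using a by (intro ckeq_sym[OF unit_left])
  also have "\<dots> \<doteq> (\<Sum>f\<in>arcs F. s f \<star> t f) \<star> a" using a by (intro ckeq_mult_right unit_arcs)
  finally show ?thesis by (simp add: fmul_sum_left fmul_assoc)
qed

lemma split_right: "a \<in> C \<Longrightarrow> a \<doteq> (\<Sum>f\<in>arcs F. (a \<star> s f) \<star> t f)"
proof -
  assume a: "a \<in> C"
  have "a \<doteq> a \<star> unit" using a by (intro ckeq_sym[OF unit_right])
  also have "\<dots> \<doteq> a \<star> (\<Sum>f\<in>arcs F. s f \<star> t f)" using a by (intro ckeq_mult_left unit_arcs)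
  finally show ?thesis by (simp add: fmul_sum_right fmul_assoc)
qed

text \<open>
  Membership in the span of the products \<open>S\<^sub>\<mu> S\<^sub>\<nu>*\<close> with paths \<open>\<mu>\<close>, \<open>\<nu>\<close> of lengths \<open>k\<close> and
  \<open>l\<close>.  Instead of listing paths, the definition strips edges: \<open>a\<close> is recovered from its compressions as
  \<open>\<Sum>\<^sub>f s\<^sub>f (s\<^sub>f* a)\<close> and \<open>\<Sum>\<^sub>f (a s\<^sub>f) s\<^sub>f*\<close>, and \<open>k\<close> steps on the left and \<open>l\<close> steps on the
  right must lead to combinations of vertex projections.
\<close>

fun mspan :: "nat \<Rightarrow> nat \<Rightarrow> ('v + 'e) star_poly \<Rightarrow> bool"
  where "mspan 0 0 a \<longleftrightarrow> (\<exists>c. a \<doteq> (\<Sum>x\<in>verts F. fscale (c x) (p x)))"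
  | "mspan (Suc k) l a \<longleftrightarrow> a \<in> C \<and> (\<forall>f\<in>arcs F. mspan k l (t f \<star> a))"
  | "mspan 0 (Suc l) a \<longleftrightarrow> a \<in> C \<and> (\<forall>f\<in>arcs F. mspan 0 l (a \<star> s f))"

lemma mspan_C: "mspan k l a \<Longrightarrow> a \<in> C"
  by (cases "(k, l, a)" rule: mspan.cases) (auto simp: ckeq_def)

lemma mspan_cong: "mspan k l a \<Longrightarrow> a \<doteq> b \<Longrightarrow> mspan k l b"
proof (induction k l a arbitrary: b rule: mspan.induct)
  case (1 a)
  then obtain c where "a \<doteq> (\<Sum>x\<in>verts F. fscale (c x) (p x))" by auto
  then have "b \<doteq> (\<Sum>x\<in>verts F. fscale (c x) (p x))" by (rule ckeq_trans[OF ckeq_sym[OF 1(2)]])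
  then show ?case by auto
next
  case (2 k l a)
  have "mspan k l (t f \<star> b)" if "f \<in> arcs F" for f
    by (rule 2(1)[OF that]) (use 2(2,3) that in \<open>auto intro: ckeq_mult_left\<close>)
  then show ?case using ckeq_C[OF 2(3)] by simp
next
  case (3 l a)
  have "mspan 0 l (b \<star> s f)" if "f \<in> arcs F" for f
    by (rule 3(1)[OF that]) (use 3(2,3) that in \<open>auto intro: ckeq_mult_right\<close>)
  then show ?case using ckeq_C[OF 3(3)] by simp
qed

lemma mspan_add: "mspan k l a \<Longrightarrow> mspan k l b \<Longrightarrow> mspan k l (a + b)"
proof (induction k l a arbitrary: b rule: mspan.induct)
  case (1 a)
  then obtain c d where "a \<doteq> (\<Sum>x\<in>verts F. fscale (c x) (p x))" "b \<doteq> (\<Sum>x\<in>verts F. fscale (d x) (p x))"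
    by auto
  then have "a + b \<doteq> (\<Sum>x\<in>verts F. fscale (c x + d x) (p x))"
    using ckeq_add by (simp add: fscale_distrib sum.distrib)
  then show ?case by auto
qed (auto simp: fmul_distrib)

lemma mspan_scale: "mspan k l a \<Longrightarrow> mspan k l (fscale c a)"
proof (induction k l a rule: mspan.induct)
  case (1 a)
  then obtain d where "a \<doteq> (\<Sum>x\<in>verts F. fscale (d x) (p x))" by auto
  then have "fscale c a \<doteq> fscale c (\<Sum>x\<in>verts F. fscale (d x) (p x))" by (rule ckeq_scale)
  also have "fscale c (\<Sum>x\<in>S. fscale (d x) (p x)) = (\<Sum>x\<in>S. fscale (c * d x) (p x))" for S
    by (induction S rule: infinite_finite_induct) (auto simp: fscale_distrib)
  finally have "fscale c a \<doteq> (\<Sum>x\<in>verts F. fscale (c * d x) (p x))" .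
  then show ?case unfolding mspan.simps by (rule exI[of _ "\<lambda>x. c * d x"])
qed auto

lemma mspan_0: "mspan k l 0"
proof (induction k l "0 :: ('v + 'e) star_poly" rule: mspan.induct)
  case 1
  have "0 \<doteq> (\<Sum>x\<in>verts F. fscale 0 (p x))" by (simp add: ckeq_refl)
  then show ?case unfolding mspan.simps by (rule exI[of _ "\<lambda>_. 0"])
qed auto

lemma mspan_sum: "(\<And>x. x \<in> S \<Longrightarrow> mspan k l (f x)) \<Longrightarrow> mspan k l (sum f S)"
  by (induction S rule: infinite_finite_induct) (simp_all add: mspan_0 mspan_add)

lemma mspan_p: "x \<in> verts F \<Longrightarrow> mspan 0 0 (p x)"
proof -
  assume x: "x \<in> verts F"
  have "(\<Sum>y\<in>verts F. fscale (if y = x then 1 else 0) (p y)) = (\<Sum>y\<in>verts F. if y = x then p y else 0)"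
    by (intro sum.cong) auto
  also have "\<dots> = p x" using x finite_verts by (simp add: sum.delta)
  finally have "p x \<doteq> (\<Sum>y\<in>verts F. fscale (if y = x then 1 else 0) (p y))"
    using ckeq_refl[of "p x"] x by simp
  then show ?thesis unfolding mspan.simps by (rule exI[of _ "\<lambda>y. if y = x then 1 else 0"])
qed

lemma mspan_t_s: "f \<in> arcs F \<Longrightarrow> g \<in> arcs F \<Longrightarrow> mspan 0 0 (t f \<star> s g)"
  by (rule mspan_cong[OF _ ckeq_sym[OF ck_t_s]]) (auto simp: mspan_p mspan_0 simp del: mspan.simps)

text \<open>
  Inserting the unit \<open>\<Sum>\<^sub>f s\<^sub>f s\<^sub>f*\<close> between the factors strips one edge from the right of \<open>a\<close>
  and one from the left of \<open>b\<close>.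
\<close>

lemma mspan_mult0: "mspan 0 l a \<Longrightarrow> mspan l m b \<Longrightarrow> mspan 0 m (a \<star> b)"
proof (induction l arbitrary: a b)
  case 0
  show ?case using 0
  proof (induction m arbitrary: b)
    case 0
    then obtain c d where c: "a \<doteq> (\<Sum>x\<in>verts F. fscale (c x) (p x))" and d: "b \<doteq> (\<Sum>x\<in>verts F. fscale (d x) (p x))"
      unfolding mspan.simps by blast
    have "a \<star> b \<doteq> (\<Sum>x\<in>verts F. fscale (c x) (p x)) \<star> (\<Sum>y\<in>verts F. fscale (d y) (p y))"
      by (rule ckeq_mult[OF c d])
    also have "\<dots> = (\<Sum>x\<in>verts F. \<Sum>y\<in>verts F. fscale (c x * d y) (p x \<star> p y))"
      unfolding fmul_sum_left unfolding fmul_sum_right by (simp add: mult.commute)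
    finally have "(\<Sum>x\<in>verts F. \<Sum>y\<in>verts F. fscale (c x * d y) (p x \<star> p y)) \<doteq> a \<star> b" by (rule ckeq_sym)
    moreover have "mspan 0 0 (p x \<star> p y)" if "x \<in> verts F" "y \<in> verts F" for x y
      using that by (intro mspan_cong[OF _ ckeq_sym[OF ck_p_p]]) (auto simp: mspan_p mspan_0 simp del: mspan.simps)
    then have "mspan 0 0 (\<Sum>x\<in>verts F. \<Sum>y\<in>verts F. fscale (c x * d y) (p x \<star> p y))"
      by (intro mspan_sum mspan_scale)
    ultimately show ?case by (rule mspan_cong[rotated])
  next
    case (Suc m)
    have "mspan 0 m (a \<star> (b \<star> s f))" if "f \<in> arcs F" for f
      using Suc that by (intro Suc.IH) auto
    then show ?case using Suc.prems[THEN mspan_C] by (simp add: fmul_assoc)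
  qed
next
  case (Suc l)
  have "mspan 0 m ((a \<star> s f) \<star> (t f \<star> b))" if "f \<in> arcs F" for f
    using Suc.prems that by (intro Suc.IH) auto
  then have "mspan 0 m (\<Sum>f\<in>arcs F. (a \<star> s f) \<star> (t f \<star> b))" by (rule mspan_sum)
  then show ?case
    using Suc.prems[THEN mspan_C] by (elim mspan_cong) (intro ckeq_sym[OF split_middle])
qed

lemma mspan_mult: "mspan k l a \<Longrightarrow> mspan l m b \<Longrightarrow> mspan k m (a \<star> b)"
proof (induction k arbitrary: a)
  case 0
  then show ?case by (rule mspan_mult0)
next
  case (Suc k)
  have "mspan k m ((t f \<star> a) \<star> b)" if "f \<in> arcs F" for f
    using Suc that by (intro Suc.IH) auto
  then show ?case using Suc.prems[THEN mspan_C] by (auto simp: fmul_assoc)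
qed

text \<open>
  Vertex projections are sums of range projections of edges, so all paths can be prolonged by one
  edge at their common source.
\<close>

lemma mspan_Suc: "mspan k l a \<Longrightarrow> mspan (Suc k) (Suc l) a"
proof (induction k l a rule: mspan.induct)
  case (1 a)
  then obtain c where c: "a \<doteq> (\<Sum>x\<in>verts F. fscale (c x) (p x))" by auto
  have "mspan 0 0 (t f \<star> a \<star> s g)" if f: "f \<in> arcs F" and g: "g \<in> arcs F" for f g
  proof -
    have "t f \<star> a \<star> s g \<doteq> t f \<star> (\<Sum>x\<in>verts F. fscale (c x) (p x)) \<star> s g"
      using f g by (intro ckeq_mult_right ckeq_mult_left c) auto
    also have "\<dots> = (\<Sum>x\<in>verts F. fscale (c x) (t f \<star> p x \<star> s g))"
      by (simp add: fmul_sum_left fmul_sum_right)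
    finally have *: "(\<Sum>x\<in>verts F. fscale (c x) (t f \<star> p x \<star> s g)) \<doteq> t f \<star> a \<star> s g" by (rule ckeq_sym)
    have "mspan 0 0 (t f \<star> p x \<star> s g)" if x: "x \<in> verts F" for x
    proof (rule mspan_cong)
      show "(if head F f = x then t f else 0) \<star> s g \<doteq> t f \<star> p x \<star> s g"
        using f g x by (intro ckeq_mult_right ckeq_sym[OF ck_t_p]) auto
      show "mspan 0 0 ((if head F f = x then t f else 0) \<star> s g)"
        using f g by (auto simp: mspan_0 mspan_t_s simp del: mspan.simps)
    qed
    then show ?thesis by (intro mspan_cong[OF _ *] mspan_sum mspan_scale)
  qed
  then show ?case using ckeq_C(1)[OF c] by (auto simp del: mspan.simps(1))
next
  case (2 k l a)
  then show ?case by (auto simp del: mspan.simps simp: mspan.simps(2)[of k] mspan.simps(2)[of "Suc k"])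
next
  case (3 l a)
  have "mspan 0 (Suc l) ((t f \<star> a) \<star> s g)" if f: "f \<in> arcs F" and g: "g \<in> arcs F" for f g
  proof -
    have "mspan (Suc 0) (Suc l) (a \<star> s g)" using 3 g by auto
    then show ?thesis using f by (auto simp: fmul_assoc simp del: mspan.simps(1,3))
  qed
  then show ?case using 3(2) by (auto simp del: mspan.simps(1) simp: fmul_assoc)
qed

lemma mspan_shift: "mspan k l a \<Longrightarrow> mspan (k + j) (l + j) a"
  by (induction j) (auto intro: mspan_Suc simp del: mspan.simps)

end

text \<open>
  The degree for which the gauge action multiplies edges by \<open>z\<close> and their adjoints by the conjugate.
\<close>

definition letter_degree :: "('v + 'e) \<times> bool \<Rightarrow> int"
  where "letter_degree l = (case fst l of Inl _ \<Rightarrow> 0 | Inr _ \<Rightarrow> if snd l then - 1 else 1)"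

definition wdegree :: "(('v + 'e) \<times> bool) list \<Rightarrow> int"
  where "wdegree u = sum_list (map letter_degree u)"

definition gauge_act :: "complex \<Rightarrow> ('v + 'e) star_poly \<Rightarrow> ('v + 'e) star_poly"
  where "gauge_act z a = (\<lambda>u. z powi wdegree u * a u)"

definition component :: "int \<Rightarrow> ('v + 'e) star_poly \<Rightarrow> ('v + 'e) star_poly"
  where "component d a = (\<lambda>u. if wdegree u = d then a u else 0)"

definition degree_le :: "nat \<Rightarrow> ('v + 'e) star_poly \<Rightarrow> bool"
  where "degree_le D a \<longleftrightarrow> (\<forall>u. a u \<noteq> 0 \<longrightarrow> \<bar>wdegree u\<bar> \<le> int D)"

lemma wdegree_append: "wdegree (u @ v) = wdegree u + wdegree v"
  by (simp add: wdegree_def)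

lemma wdegree_word_star: "wdegree (word_star u) = - wdegree u"
proof (induction u)
  case (Cons l u)
  have "letter_degree (fst l, \<not> snd l) = - letter_degree l"
    by (cases "fst l") (auto simp: letter_degree_def)
  then show ?case using Cons by (auto simp: word_star_def wdegree_def case_prod_beta)
qed (simp add: word_star_def wdegree_def)

lemma component_fcar: "a \<in> fcar G \<Longrightarrow> component d a \<in> fcar G"
  by (rule fcarI[of "{u. a u \<noteq> 0}"]) (auto simp: component_def fcarD dest: subsetD[OF fcarD(2)])

lemma gauge_act_fcar: "a \<in> fcar G \<Longrightarrow> gauge_act z a \<in> fcar G"
  by (rule fcarI[of "{u. a u \<noteq> 0}"]) (auto simp: gauge_act_def fcarD dest: subsetD[OF fcarD(2)])

lemma degree_le_exists: "a \<in> fcar G \<Longrightarrow> \<exists>D. degree_le D a"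
proof -
  assume a: "a \<in> fcar G"
  let ?S = "{u. a u \<noteq> 0}"
  have S: "finite ?S" using a by (rule fcarD)
  have "nat \<bar>wdegree u\<bar> \<le> (\<Sum>u\<in>?S. nat \<bar>wdegree u\<bar>)" if "u \<in> ?S" for u
    by (rule member_le_sum[OF that _ S]) simp
  then have "degree_le (\<Sum>u\<in>?S. nat \<bar>wdegree u\<bar>) a" by (auto simp: degree_le_def nat_le_iff simp del: of_nat_sum)
  then show ?thesis by blast
qed

lemma degree_le_mult:
  assumes "degree_le D a" "degree_le D' b"
  shows "degree_le (D + D') (a \<star> b)"
  unfolding degree_le_def
proof (intro allI impI)
  fix u assume "(a \<star> b) u \<noteq> 0"
  then obtain v w where "u = v @ w" "a v \<noteq> 0" "b w \<noteq> 0" using fmul_nonzeroD by blast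
  then show "\<bar>wdegree u\<bar> \<le> int (D + D')"
    using assms by (fastforce simp: degree_le_def wdegree_append)
qed

lemma degree_le_power: "degree_le D h \<Longrightarrow> degree_le (D * 2 ^ m) (((\<lambda>x. x \<star> x) ^^ m) h)"
proof (induction m)
  case (Suc m)
  then have "degree_le (D * 2 ^ m) (((\<lambda>x. x \<star> x) ^^ m) h)" by simp
  from degree_le_mult[OF this this] show ?case by (simp add: mult_2_right mult.assoc[symmetric] distrib_right)
qed simp

lemma component_sum:
  assumes "degree_le D a"
  shows "a = (\<Sum>d\<in>{- int D..int D}. component d a)"
proof
  fix u
  have "(\<Sum>d\<in>{- int D..int D}. component d a) u = (\<Sum>d\<in>{- int D..int D}. if wdegree u = d then a u else 0)"
    by (simp add: fun_sum_apply component_def)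
  also have "\<dots> = a u" using assms by (auto simp: degree_le_def abs_le_iff)
  finally show "a u = (\<Sum>d\<in>{- int D..int D}. component d a) u" by simp
qed

text \<open>
  The sum of the \<open>k\<close>-th powers of the \<open>M\<close>-th roots of unity.
\<close>

lemma sum_cis_powi:
  fixes k :: int
  assumes "0 < M" "\<bar>k\<bar> < int M"
  shows "(\<Sum>j<M. cis (2 * pi * real j / M) powi k) = (if k = 0 then of_nat M else 0)"
proof (cases "k = 0")
  case False
  define z where "z = cis (2 * pi * of_int k / M)"
  have "(\<Sum>j<M. cis (2 * pi * real j / M) powi k) = (\<Sum>j<M. z ^ j)"
    unfolding z_def by (intro sum.cong refl) (simp add: cis_power_int Complex.DeMoivre algebra_simps)
  moreover have "z \<noteq> 1"
  proof
    assume "z = 1"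
    then have "cos (2 * pi * of_int k / M) = 1" by (simp add: z_def complex_eq_iff)
    then obtain n :: int where "2 * pi * of_int k / M = of_int n * 2 * pi"
      using cos_one_2pi_int by blast
    then have "real_of_int k = of_int n * M" using assms by (simp add: field_simps)
    then have "real_of_int k = real_of_int (n * int M)" by simp
    then have k: "k = n * int M" by (simp only: of_int_eq_iff)
    then have "n \<noteq> 0" using False by auto
    then have "1 * int M \<le> \<bar>n\<bar> * int M" by (intro mult_right_mono) auto
    then have "int M \<le> \<bar>k\<bar>" by (simp add: k abs_mult)
    then show False using assms by simp
  qed
  moreover have "z ^ M = 1"
  proof -
    have "z ^ M = cis (2 * pi * of_int k)" using assms by (simp add: z_def Complex.DeMoivre)
    also have "\<dots> = 1" by (metis cis_multiple_2pi Ints_of_int)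
    finally show ?thesis .
  qed
  ultimately show ?thesis using False by (simp add: geometric_sum)
qed simp

text \<open>
  For degrees of absolute value at most \<open>D\<close> the differences of degrees are less than \<open>2D + 1\<close>, so
  the roots of unity of this order separate the components; no integral over the circle is needed.
\<close>

lemma component_eq_average:
  assumes "degree_le D a" "\<bar>d\<bar> \<le> int D"
  shows "component d a = fscale (1 / of_nat (2 * D + 1))
    (\<Sum>j<2 * D + 1. fscale (cis (2 * pi * real j / (2 * D + 1)) powi (- d)) (gauge_act (cis (2 * pi * real j / (2 * D + 1))) a))"
proof
  fix u
  let ?M = "2 * D + 1"
  let ?z = "\<lambda>j. cis (2 * pi * real j / real ?M)"
  have "(\<Sum>j<?M. fscale (?z j powi (- d)) (gauge_act (?z j) a)) u = (\<Sum>j<?M. ?z j powi (wdegree u - d) * a u)"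
    by (simp add: fun_sum_apply fscale_def gauge_act_def power_int_add[symmetric] mult.assoc[symmetric]
        del: power_int_minus sum.lessThan_Suc cong: sum.cong)
  also have "\<dots> = (\<Sum>j<?M. ?z j powi (wdegree u - d)) * a u" by (rule sum_distrib_right[symmetric])
  also have "\<dots> = of_nat ?M * component d a u"
  proof (cases "a u = 0")
    case False
    then have "\<bar>wdegree u - d\<bar> < int ?M" using assms by (auto simp: degree_le_def)
    then show ?thesis by (subst sum_cis_powi) (auto simp: component_def)
  qed (simp add: component_def)
  finally have *: "(\<Sum>j<?M. fscale (?z j powi (- d)) (gauge_act (?z j) a)) u = of_nat ?M * component d a u" .
  have "fscale (1 / of_nat ?M) (\<Sum>j<?M. fscale (?z j powi (- d)) (gauge_act (?z j) a)) u
      = 1 / of_nat ?M * (\<Sum>j<?M. fscale (?z j powi (- d)) (gauge_act (?z j) a)) u"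
    by (simp only: fscale_def)
  also have "\<dots> = component d a u" unfolding * using of_nat_neq_0[of "2 * D", where 'a = complex] by (simp del: of_nat_Suc)
  finally show "component d a u = fscale (1 / of_nat ?M) (\<Sum>j<?M. fscale (cis (2 * pi * real j / (2 * D + 1)) powi (- d)) (gauge_act (cis (2 * pi * real j / (2 * D + 1))) a)) u"
    by simp
qed

context ck_graph
begin

lemma mspan_letter:
  assumes "fst l \<in> ck_gens F"
  shows "\<exists>k m. int k - int m = letter_degree l \<and> mspan k m (mono_word [l])"
proof -
  consider (v) x where "l = (Inl x, False)" "x \<in> verts F" | (v') x where "l = (Inl x, True)" "x \<in> verts F"
    | (e) f where "l = (Inr f, False)" "f \<in> arcs F" | (e') f where "l = (Inr f, True)" "f \<in> arcs F"
    using assms by (cases l; cases "fst l"; cases "snd l") auto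
  then show ?thesis
  proof cases
    case v
    then show ?thesis using mspan_p[of x]
      by (intro exI[of _ 0]) (simp add: gen_eq letter_degree_def del: mspan.simps)
  next
    case v'
    have "mspan 0 0 (fstar (p x))" by (rule mspan_cong[OF mspan_p ckeq_sym[OF ck_pstar]]) (use v' in auto)
    then show ?thesis using v'
      by (intro exI[of _ 0]) (simp add: fstar_gen letter_degree_def del: mspan.simps)
  next
    case e
    have "mspan 1 0 (s f)" using e mspan_t_s[of _ f] by (simp del: mspan.simps(1))
    then show ?thesis using e
      by (intro exI[of _ 1] exI[of _ 0]) (simp add: gen_eq letter_degree_def del: mspan.simps)
  next
    case e'
    have "mspan 0 1 (t f)" using e' mspan_t_s[of f] by (simp del: mspan.simps(1))
    then show ?thesis using e'
      by (intro exI[of _ 0] exI[of _ 1]) (simp add: fstar_gen letter_degree_def del: mspan.simps)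
  qed
qed

text \<open>
  Letters lie in \<open>mspan k l\<close> for suitable lengths, and two such memberships can be multiplied after
  prolonging paths until the inner lengths agree.
\<close>

lemma mspan_word:
  assumes "u \<in> words (ck_gens F)"
  shows "\<exists>k m. int k - int m = wdegree u \<and> mspan k m (mono_word u)"
  using assms
proof (induction u)
  case Nil
  then show ?case by (simp add: words_def)
next
  case (Cons l u)
  have l: "fst l \<in> ck_gens F" using Cons.prems by (simp add: words_Cons)
  obtain k m where km: "int k - int m = letter_degree l" "mspan k m (mono_word [l])"
    using mspan_letter[OF l] by blast
  show ?case
  proof (cases "u = []")
    case True
    then show ?thesis using km by (auto simp: wdegree_def simp del: mspan.simps)
  next
    case False
    then have "u \<in> words (ck_gens F)" using Cons.prems by (simp add: words_Cons)
    then obtain k' m' where km': "int k' - int m' = wdegree u" "mspan k' m' (mono_word u)"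
      using Cons.IH by blast
    have "mspan (k + k') (m + k') (mono_word [l])" using km(2) by (rule mspan_shift)
    moreover have "mspan (m + k') (m' + m) (mono_word u)" using mspan_shift[OF km'(2), of m] by (simp only: add.commute)
    ultimately have "mspan (k + k') (m' + m) (mono_word [l] \<star> mono_word u)" by (rule mspan_mult)
    then have "mspan (k + k') (m' + m) (mono_word (l # u))" by (simp only: mono_word_mult append_Cons append_Nil)
    moreover have "int (k + k') - int (m' + m) = wdegree (l # u)" using km(1) km'(1) by (simp add: wdegree_def)
    ultimately show ?thesis by blast
  qed
qed

lemma mspan_words:
  assumes "finite S" "S \<subseteq> words (ck_gens F)" "\<And>u. u \<in> S \<Longrightarrow> wdegree u = d"
  shows "\<exists>k m. int k - int m = d \<and> (\<forall>u\<in>S. mspan k m (mono_word u))"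
  using assms
proof (induction S rule: finite_induct)
  case empty
  show ?case by (intro exI[of _ "nat d"] exI[of _ "nat (- d)"]) simp
next
  case (insert u S)
  obtain k m where km: "int k - int m = d" "\<forall>u\<in>S. mspan k m (mono_word u)" using insert by auto
  obtain k' m' where km': "int k' - int m' = d" "mspan k' m' (mono_word u)"
    using mspan_word[of u] insert.prems by auto
  have "mspan (k + k') (m + k') (mono_word v)" if "v \<in> S" for v using km(2) that mspan_shift by blast
  moreover have "mspan (k + k') (m + k') (mono_word u)"
  proof -
    have "m + k' = m' + k" using km(1) km'(1) by linarith
    then show ?thesis using mspan_shift[OF km'(2), of k] by (simp only: add.commute)
  qed
  moreover have "int (k + k') - int (m + k') = d" using km(1) by simp
  ultimately show ?case by (metis insertE)
qed

lemma mspan_homogeneous: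
  assumes a: "a \<in> C" and d: "\<And>u. a u \<noteq> 0 \<Longrightarrow> wdegree u = d"
  shows "\<exists>k m. int k - int m = d \<and> mspan k m a"
proof -
  let ?S = "{u. a u \<noteq> 0}"
  obtain k m where km: "int k - int m = d" "\<And>u. u \<in> ?S \<Longrightarrow> mspan k m (mono_word u)"
    using mspan_words[of ?S d] fcarD[OF a] d by auto
  have "mspan k m (\<Sum>u\<in>?S. fscale (a u) (mono_word u))" using km by (intro mspan_sum mspan_scale)
  moreover have "(\<Sum>u\<in>?S. fscale (a u) (mono_word u)) = a"
    by (rule fcar_expand[symmetric]) (use fcarD[OF a] in auto)
  ultimately show ?thesis using km(1) by metis
qed

lemma ck_norm_p: "ck_seminorm F \<rho> \<Longrightarrow> x \<in> verts F \<Longrightarrow> \<rho> (p x) \<le> 1"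
proof -
  assume r: "ck_seminorm F \<rho>" and x: "x \<in> verts F"
  interpret free_cstar "ck_gens F" \<rho> using r by (rule ck_free_cstar)
  have "fstar (p x) \<star> p x \<doteq> p x \<star> p x" using x by (intro ckeq_mult_right ck_pstar) auto
  also have "\<dots> \<doteq> p x" using x by (rule ck_pp)
  finally have "(\<rho> (p x))\<^sup>2 = \<rho> (p x)" using ckeq_rho[OF _ r] rho_cstar[of "p x"] x by simp
  then have "\<rho> (p x) = 0 \<or> \<rho> (p x) = 1" by (simp add: power2_eq_square)
  then show ?thesis by auto
qed

lemma ck_norm_s:
  assumes r: "ck_seminorm F \<rho>" and f: "f \<in> arcs F"
  shows "\<rho> (s f) \<le> 1" "\<rho> (t f) \<le> 1"
proof -
  interpret free_cstar "ck_gens F" \<rho> using r by (rule ck_free_cstar)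
  have "(\<rho> (s f))\<^sup>2 = \<rho> (p (tail F f))" using ckeq_rho[OF ck_ts r] rho_cstar[of "s f"] f by simp
  also have "\<dots> \<le> 1" using f by (intro ck_norm_p r) simp
  finally show "\<rho> (s f) \<le> 1" using power2_le_imp_le[of "\<rho> (s f)" 1] by simp
  then show "\<rho> (t f) \<le> 1" using rho_star[of "s f"] f by simp
qed

end

text \<open>
  The two seminorms enter asymmetrically: \<open>\<sigma>\<close> must not kill any vertex projection, because the
  coefficients of an element are read off by compressing it to multiples of these.
\<close>

locale ck_comparison = ck_graph F for F :: "('v, 'e) pre_digraph" +
  fixes \<rho> \<sigma> :: "('v + 'e) star_poly \<Rightarrow> real"
  assumes ck_rho: "ck_seminorm F \<rho>" and ck_sigma: "ck_seminorm F \<sigma>"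
    and sigma_p: "x \<in> verts F \<Longrightarrow> \<sigma> (p x) \<noteq> 0"
begin

sublocale R: free_cstar "ck_gens F" \<rho> by (rule ck_free_cstar[OF ck_rho])
sublocale S: free_cstar "ck_gens F" \<sigma> by (rule ck_free_cstar[OF ck_sigma])

text \<open>
  On combinations of vertex projections the coefficients are bounded by \<open>\<sigma>\<close>.  Each stripped edge
  costs a factor given by the number of edges.  The resulting constant grows with \<open>k\<close> and \<open>m\<close>, but
  it does not depend on the element.
\<close>

lemma mspan_bound: "\<exists>K\<ge>0. \<forall>a. mspan k m a \<longrightarrow> \<rho> a \<le> K * \<sigma> a"
proof (induction k)
  case 0
  show ?case
  proof (induction m)
    case 0
    have "\<rho> a \<le> card (verts F) * \<sigma> a" if a: "mspan 0 0 a" for a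
    proof -
      obtain c where c: "a \<doteq> (\<Sum>x\<in>verts F. fscale (c x) (p x))" using a by auto
      have aC: "a \<in> C" using a by (rule mspan_C)
      have cx: "cmod (c x) \<le> \<sigma> a" if x: "x \<in> verts F" for x
      proof -
        have "p x \<star> a \<doteq> p x \<star> (\<Sum>y\<in>verts F. fscale (c y) (p y))"
          using x c by (intro ckeq_mult_left) auto
        also have "\<dots> = (\<Sum>y\<in>verts F. fscale (c y) (p x \<star> p y))" by (simp add: fmul_sum_right)
        also have "\<dots> \<doteq> (\<Sum>y\<in>verts F. fscale (c y) (if y = x then p y else 0))"
          using x by (intro ckeq_sum ckeq_scale ck_p_p)
        also have "\<dots> = (\<Sum>y\<in>verts F. if y = x then fscale (c y) (p y) else 0)"
          by (intro sum.cong) auto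
        also have "\<dots> = fscale (c x) (p x)" using x finite_verts by simp
        finally have "\<sigma> (fscale (c x) (p x)) = \<sigma> (p x \<star> a)" using ckeq_rho[OF _ ck_sigma] by metis
        then have "\<sigma> (p x) * cmod (c x) \<le> \<sigma> (p x) * \<sigma> a"
          using x aC S.rho_mult[of "p x" a] by (simp add: S.rho_scale mult.commute)
        moreover have "0 < \<sigma> (p x)" using S.rho_nonneg[of "p x"] sigma_p[OF x] x by simp
        ultimately show ?thesis by (simp add: mult_le_cancel_left_pos)
      qed
      have "\<rho> a = \<rho> (\<Sum>x\<in>verts F. fscale (c x) (p x))" using c ck_rho by (rule ckeq_rho)
      also have "\<dots> \<le> (\<Sum>x\<in>verts F. \<rho> (fscale (c x) (p x)))" by (rule R.rho_sum) simp
      also have "\<dots> \<le> (\<Sum>x\<in>verts F. \<sigma> a)"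
      proof (rule sum_mono)
        fix x assume x: "x \<in> verts F"
        have "\<rho> (fscale (c x) (p x)) = cmod (c x) * \<rho> (p x)" using x by (simp add: R.rho_scale)
        also have "\<dots> \<le> cmod (c x) * 1" using ck_norm_p[OF ck_rho x] by (intro mult_left_mono) auto
        finally show "\<rho> (fscale (c x) (p x)) \<le> \<sigma> a" using cx[OF x] by simp
      qed
      finally show ?thesis by simp
    qed
    then show ?case by (intro exI[of _ "real (card (verts F))"]) auto
  next
    case (Suc m)
    then obtain K where K: "K \<ge> 0" "\<And>a. mspan 0 m a \<Longrightarrow> \<rho> a \<le> K * \<sigma> a" by blast
    have "\<rho> a \<le> (card (arcs F) * K) * \<sigma> a" if a: "mspan 0 (Suc m) a" for a
    proof -
      have aC: "a \<in> C" using a by (rule mspan_C)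
      have "\<rho> a = \<rho> (\<Sum>f\<in>arcs F. (a \<star> s f) \<star> t f)" using split_right[OF aC] ck_rho by (rule ckeq_rho)
      also have "\<dots> \<le> (\<Sum>f\<in>arcs F. \<rho> ((a \<star> s f) \<star> t f))" using aC by (intro R.rho_sum) simp
      also have "\<dots> \<le> (\<Sum>f\<in>arcs F. K * \<sigma> a)"
      proof (rule sum_mono)
        fix f assume f: "f \<in> arcs F"
        have "\<rho> ((a \<star> s f) \<star> t f) \<le> \<rho> (a \<star> s f) * \<rho> (t f)" using aC f by (intro R.rho_mult) auto
        also have "\<dots> \<le> \<rho> (a \<star> s f) * 1"
          using aC f ck_norm_s[OF ck_rho f] by (intro mult_left_mono R.rho_nonneg) auto
        also have "\<dots> \<le> K * \<sigma> (a \<star> s f)" using a f K(2)[of "a \<star> s f"] by simp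
        also have "\<dots> \<le> K * (\<sigma> a * 1)"
          using aC f ck_norm_s[OF ck_sigma f] K(1)
          by (intro mult_left_mono order_trans[OF S.rho_mult] S.rho_nonneg) auto
        finally show "\<rho> ((a \<star> s f) \<star> t f) \<le> K * \<sigma> a" by simp
      qed
      finally show ?thesis by simp
    qed
    then show ?case using K(1) by (intro exI[of _ "card (arcs F) * K"]) auto
  qed
next
  case (Suc k)
  then obtain K where K: "K \<ge> 0" "\<And>a. mspan k m a \<Longrightarrow> \<rho> a \<le> K * \<sigma> a" by blast
  have "\<rho> a \<le> (card (arcs F) * K) * \<sigma> a" if a: "mspan (Suc k) m a" for a
  proof -
    have aC: "a \<in> C" using a by (rule mspan_C)
    have "\<rho> a = \<rho> (\<Sum>f\<in>arcs F. s f \<star> (t f \<star> a))" using split_left[OF aC] ck_rho by (rule ckeq_rho)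
    also have "\<dots> \<le> (\<Sum>f\<in>arcs F. \<rho> (s f \<star> (t f \<star> a)))" using aC by (intro R.rho_sum) simp
    also have "\<dots> \<le> (\<Sum>f\<in>arcs F. K * \<sigma> a)"
    proof (rule sum_mono)
      fix f assume f: "f \<in> arcs F"
      have "\<rho> (s f \<star> (t f \<star> a)) \<le> \<rho> (s f) * \<rho> (t f \<star> a)" using aC f by (intro R.rho_mult) auto
      also have "\<dots> \<le> 1 * \<rho> (t f \<star> a)"
        using aC f ck_norm_s[OF ck_rho f] by (intro mult_right_mono R.rho_nonneg) auto
      also have "\<dots> \<le> K * \<sigma> (t f \<star> a)" using a f K(2)[of "t f \<star> a"] by simp
      also have "\<dots> \<le> K * (1 * \<sigma> a)"
        using aC f ck_norm_s[OF ck_sigma f] K(1)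
        by (intro mult_left_mono order_trans[OF S.rho_mult] mult_right_mono S.rho_nonneg) auto
      finally show "\<rho> (s f \<star> (t f \<star> a)) \<le> K * \<sigma> a" by simp
    qed
    finally show ?thesis by simp
  qed
  then show ?case using K(1) by (intro exI[of _ "card (arcs F) * K"]) auto
qed

lemma mspan_power: "mspan k k h \<Longrightarrow> mspan k k (((\<lambda>x. x \<star> x) ^^ m) h)"
  by (induction m) (auto intro: mspan_mult simp del: mspan.simps)

text \<open>
  \<open>h = b* b\<close> has degree 0 and hence lies in some \<open>mspan k k\<close>, together with all its powers; the power
  trick removes the constant of \<open>mspan_bound\<close>.
\<close>

lemma homogeneous_le:
  assumes b: "b \<in> C" and d: "\<And>u. b u \<noteq> 0 \<Longrightarrow> wdegree u = d"
  shows "\<rho> b \<le> \<sigma> b"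
proof -
  define h where "h = fstar b \<star> b"
  have h: "h \<in> C" "fstar h = h" using b by (simp_all add: h_def fstar_fmul)
  have "wdegree u = 0" if hu: "h u \<noteq> 0" for u
  proof -
    obtain v w where vw: "u = v @ w" "fstar b v \<noteq> 0" "b w \<noteq> 0"
      using fmul_nonzeroD[of "fstar b" b u] hu by (auto simp: h_def)
    then have "wdegree (word_star v) = d" "wdegree w = d" using d by (auto simp: fstar_def)
    then show ?thesis using vw(1) by (simp add: wdegree_append wdegree_word_star)
  qed
  then obtain k m where "int k - int m = 0" "mspan k m h" using mspan_homogeneous[OF h(1), of 0] by blast
  then have mspan: "mspan k k h" by simp
  obtain K where K: "K \<ge> 0" "\<And>a. mspan k k a \<Longrightarrow> \<rho> a \<le> K * \<sigma> a" using mspan_bound by blast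
  have "\<rho> h \<le> \<sigma> h"
  proof (rule le_if_powers_le[where B = 0 and B' = K])
    show "0 \<le> \<rho> h" "0 \<le> \<sigma> h" using h by (simp_all add: R.rho_nonneg S.rho_nonneg)
    show "\<rho> h ^ 2 ^ m \<le> (0 * 2 ^ m + K) * \<sigma> h ^ 2 ^ m" for m
      using K(2)[OF mspan_power[OF mspan, of m]] R.power_sq[OF h, of m] S.power_sq[OF h, of m] by simp
  qed
  then have "(\<rho> b)\<^sup>2 \<le> (\<sigma> b)\<^sup>2" using b by (simp add: h_def R.rho_cstar S.rho_cstar)
  then show ?thesis by (rule power2_le_imp_le) (use b S.rho_nonneg in simp)
qed

text \<open>
  The component is an average of gauge translates of \<open>a\<close>, multiplied by scalars of modulus 1.
\<close>

lemma component_le: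
  assumes gauge: "\<And>z a. cmod z = 1 \<Longrightarrow> a \<in> C \<Longrightarrow> \<sigma> (gauge_act z a) \<le> \<sigma> a"
    and a: "a \<in> C" "degree_le D a" "\<bar>d\<bar> \<le> int D"
  shows "\<sigma> (component d a) \<le> \<sigma> a"
proof -
  let ?M = "2 * D + 1"
  let ?z = "\<lambda>j. cis (2 * pi * real j / (2 * D + 1))"
  have gC: "gauge_act z a \<in> C" for z using a(1) by (rule gauge_act_fcar)
  have "\<sigma> (component d a) = \<sigma> (fscale (1 / of_nat ?M) (\<Sum>j<?M. fscale (?z j powi (- d)) (gauge_act (?z j) a)))"
    by (subst component_eq_average[OF a(2,3)]) simp
  also have "\<dots> = 1 / ?M * \<sigma> (\<Sum>j<?M. fscale (?z j powi (- d)) (gauge_act (?z j) a))"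
  proof -
    have "cmod (1 / of_nat ?M) = 1 / ?M" by (simp only: norm_divide norm_one norm_of_nat)
    moreover have "(\<Sum>j<?M. fscale (?z j powi (- d)) (gauge_act (?z j) a)) \<in> C" using gC by (intro fcar_sum) simp
    ultimately show ?thesis by (simp only: S.rho_scale)
  qed
  also have "\<dots> \<le> 1 / ?M * (\<Sum>j<?M. \<sigma> (fscale (?z j powi (- d)) (gauge_act (?z j) a)))"
    using gC by (intro mult_left_mono S.rho_sum) auto
  also have "\<dots> \<le> 1 / ?M * (\<Sum>j<?M. \<sigma> a)"
  proof (intro mult_left_mono sum_mono)
    fix j
    have "\<sigma> (fscale (?z j powi (- d)) (gauge_act (?z j) a)) = \<sigma> (gauge_act (?z j) a)"
      using gC by (simp add: S.rho_scale norm_power_int norm_inverse)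
    also have "\<dots> \<le> \<sigma> a" using a(1) by (intro gauge) auto
    finally show "\<sigma> (fscale (?z j powi (- d)) (gauge_act (?z j) a)) \<le> \<sigma> a" .
  qed auto
  also have "\<dots> = \<sigma> a" using of_nat_neq_0[of "2 * D", where 'a = real] by (simp del: of_nat_Suc sum.lessThan_Suc)
  finally show ?thesis .
qed

text \<open>
  Summing over homogeneous components costs the factor \<open>2D + 1\<close> for elements of degree at most
  \<open>D\<close>.  For the powers of \<open>h = a* a\<close> this factor grows linearly in the exponent, which the power
  trick tolerates.
\<close>

theorem gauge_invariant_uniqueness:
  assumes gauge: "\<And>z a. cmod z = 1 \<Longrightarrow> a \<in> C \<Longrightarrow> \<sigma> (gauge_act z a) \<le> \<sigma> a"
    and a: "a \<in> C"
  shows "\<rho> a \<le> \<sigma> a"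
proof -
  have poly: "\<rho> b \<le> (2 * D + 1) * \<sigma> b" if b: "b \<in> C" "degree_le D b" for b D
  proof -
    have "\<rho> b = \<rho> (\<Sum>d\<in>{- int D..int D}. component d b)" using component_sum[OF b(2)] by simp
    also have "\<dots> \<le> (\<Sum>d\<in>{- int D..int D}. \<rho> (component d b))"
      using b(1) by (intro R.rho_sum component_fcar)
    also have "\<dots> \<le> (\<Sum>d\<in>{- int D..int D}. \<sigma> b)"
    proof (rule sum_mono)
      fix d assume d: "d \<in> {- int D..int D}"
      have "\<rho> (component d b) \<le> \<sigma> (component d b)"
        by (rule homogeneous_le[of _ d, OF component_fcar[OF b(1)]]) (simp add: component_def split: if_splits)
      also have "\<dots> \<le> \<sigma> b" using d by (intro component_le[OF gauge b]) auto
      finally show "\<rho> (component d b) \<le> \<sigma> b" .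
    qed
    finally show ?thesis by simp
  qed
  define h where "h = fstar a \<star> a"
  have h: "h \<in> C" "fstar h = h" using a by (simp_all add: h_def fstar_fmul)
  obtain D where D: "degree_le D h" using degree_le_exists[OF h(1)] by blast
  have "\<rho> h \<le> \<sigma> h"
  proof (rule le_if_powers_le[where B = "2 * real D" and B' = 1])
    show "0 \<le> \<rho> h" "0 \<le> \<sigma> h" using h by (simp_all add: R.rho_nonneg S.rho_nonneg)
    show "\<rho> h ^ 2 ^ m \<le> (2 * real D * 2 ^ m + 1) * \<sigma> h ^ 2 ^ m" for m
      using poly[OF _ degree_le_power[OF D, of m]] R.power_sq[OF h, of m] S.power_sq[OF h, of m]
      by (simp add: mult.assoc add.commute)
  qed
  then have "(\<rho> a)\<^sup>2 \<le> (\<sigma> a)\<^sup>2" using a by (simp add: h_def R.rho_cstar S.rho_cstar)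
  then show ?thesis by (rule power2_le_imp_le) (use a S.rho_nonneg in simp)
qed

end

section \<open>Paths and their remainders\<close>

lemma path_cons_inj: "inj (path_cons e)"
  by (rule injI) (simp add: path_cons_def prod_eq_iff)

lemma path_cons_eq_iff: "path_cons e u = path_cons e' u' \<longleftrightarrow> e = e' \<and> u = u'"
  by (auto simp: path_cons_def prod_eq_iff)

lemma path_range_cons [simp]: "path_range E (path_cons e w) = head E e"
  by (simp add: path_range_def path_cons_def)

lemma path_range_Nil [simp]: "path_range E (x, []) = x"
  by (simp add: path_range_def)

lemma path_len_Nil [simp]: "path_len (x, []) = 0"
  by (simp add: path_len_def)

lemma path_len_cons [simp]: "path_len (path_cons e w) = Suc (path_len w)"
  by (simp add: path_len_def path_cons_def)

context wf_digraph
begin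

lemma paths_Nil [simp]: "(x, []) \<in> paths G \<longleftrightarrow> x \<in> verts G"
proof -
  have "(\<exists>y. awalk x [] y) \<longleftrightarrow> x \<in> verts G" using awalk_Nil_iff[of x] by blast
  then show ?thesis by (simp add: paths_def)
qed

lemma paths_awalk:
  assumes "(x, l) \<in> paths G"
  shows "awalk x (rev l) (path_range G (x, l))"
proof -
  obtain y where y: "awalk x (rev l) y" using assms by (auto simp: paths_def)
  have "y = path_range G (x, l)"
  proof (cases l)
    case Nil
    then show ?thesis using y by (simp add: awalk_Nil_iff)
  next
    case (Cons e l')
    then have "awalk x (rev l' @ [e]) y" using y by simp
    then have "awalk (awlast x (rev l')) [e] y" by (simp only: awalk_append_iff)
    then have "awalk (head G e) [] y" by (simp only: awalk_Cons_iff)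
    then show ?thesis by (simp add: Cons path_range_def awalk_Nil_iff)
  qed
  then show ?thesis using y by simp
qed

lemma paths_Cons: "(x, e # l) \<in> paths G \<longleftrightarrow>
  (x, l) \<in> paths G \<and> e \<in> arcs G \<and> tail G e = path_range G (x, l)"
proof
  assume a: "(x, e # l) \<in> paths G"
  have "(path_range G (x, l), [e]) \<in> paths G" using path_split(2)[of x "[e]" l] a by simp
  then have "awalk (path_range G (x, l)) [e] (head G e)"
    using paths_awalk[of _ "[e]"] by (simp add: path_range_def)
  then show "(x, l) \<in> paths G \<and> e \<in> arcs G \<and> tail G e = path_range G (x, l)"
    using path_split(1)[of x "[e]" l] a by (simp add: awalk_Cons_iff)
next
  assume a: "(x, l) \<in> paths G \<and> e \<in> arcs G \<and> tail G e = path_range G (x, l)"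
  then have "awalk x (rev l) (tail G e)" using paths_awalk[of x l] by simp
  moreover have "awalk (tail G e) [e] (head G e)" using a by (simp add: awalk_Cons_iff awalk_Nil_iff)
  ultimately have "awalk x (rev l @ [e]) (head G e)" by (rule awalk_appendI)
  then show "(x, e # l) \<in> paths G" by (auto simp: paths_def)
qed

lemma path_cons_paths: "path_cons e w \<in> paths G \<longleftrightarrow>
  w \<in> paths G \<and> e \<in> arcs G \<and> tail G e = path_range G w"
  using paths_Cons[of "fst w" e "snd w"] by (simp add: path_cons_def)

lemma path_range_verts: "w \<in> paths G \<Longrightarrow> path_range G w \<in> verts G"
  by (cases w; cases "snd w") (auto simp: path_range_def paths_Cons)

lemma path_src_verts: "w \<in> paths G \<Longrightarrow> path_src w \<in> verts G"
  by (auto simp: paths_def path_src_def awalk_def)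

lemma paths_append:
  "(x, q) \<in> paths G \<Longrightarrow> (path_range G (x, q), r) \<in> paths G \<Longrightarrow> (x, r @ q) \<in> paths G"
  by (induction r) (auto simp: paths_Cons path_range_append)

lemma path_rem_paths:
  assumes "w \<in> paths G"
  shows "path_rem G n w \<in> paths G"
  using assms path_split(2)[of "fst w" "take (path_len w mod n) (snd w)" "drop (path_len w mod n) (snd w)"]
  by (simp add: path_rem_def Let_def)

lemma paths_snd_subset: "(x, l) \<in> paths G \<Longrightarrow> set l \<subseteq> arcs G"
  by (induction l) (auto simp: paths_Cons)

end

lemma path_len_rem: "path_len (path_rem E n w) = path_len w mod n"
  by (simp add: path_rem_def Let_def path_len_def mod_less_eq_dividend)

lemma path_range_rem: "path_range E (path_rem E n w) = path_range E w"
proof -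
  let ?m = "path_len w mod n"
  have "path_range E (path_range E (fst w, drop ?m (snd w)), take ?m (snd w)) = path_range E (fst w, take ?m (snd w) @ drop ?m (snd w))"
    by (simp only: path_range_append)
  then show ?thesis by (simp add: path_rem_def Let_def)
qed

lemma path_rem_self: "path_len w < n \<Longrightarrow> path_rem E n w = w"
  by (simp add: path_rem_def path_len_def path_range_def prod_eq_iff)

text \<open>
  This is the statement that remainders move along the edges of \<open>E(n)\<close>: a remainder of full length
  \<open>n - 1\<close> is completed to a block of \<open>n\<close> edges and dropped.
\<close>

lemma path_rem_cons:
  assumes "n \<ge> 1"
  shows "path_rem E n (path_cons e w)
    = (if path_len (path_rem E n w) < n - 1 then path_cons e (path_rem E n w) else (head E e, []))"
proof -
  let ?m = "path_len w mod n"
  have m: "?m < n" using assms by simp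
  show ?thesis
  proof (cases "?m < n - 1")
    case True
    then have "Suc (path_len w) mod n = Suc ?m" by (simp add: mod_Suc)
    then show ?thesis using True
      by (simp add: path_len_rem) (simp add: path_rem_def path_len_def path_cons_def Let_def)
  next
    case False
    then have "Suc ?m = n" using m by simp
    then have "Suc (path_len w) mod n = 0" by (simp add: mod_Suc)
    then show ?thesis using False
      by (simp add: path_len_rem) (simp add: path_rem_def path_len_def path_cons_def path_range_def Let_def)
  qed
qed

locale shift_setting =
  fixes E :: "('v, 'e) pre_digraph" and n :: nat
  assumes fin_E: "fin_digraph E"
    and no_sinks: "\<And>x. x \<in> verts E \<Longrightarrow> out_arcs E x \<noteq> {}"
    and no_sources_E: "\<And>x. x \<in> verts E \<Longrightarrow> in_arcs E x \<noteq> {}"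
    and n: "n \<ge> 1"
begin

sublocale E: fin_digraph E by (rule fin_E)

abbreviation "X \<equiv> paths E"
abbreviation "rm \<equiv> path_rem E n"
abbreviation "F \<equiv> path_graph E n"

lemma path_with_range:
  "x \<in> verts E \<Longrightarrow> \<exists>w\<in>X. path_range E w = x \<and> path_len w = k"
proof (induction k arbitrary: x)
  case 0
  then show ?case by (intro bexI[of _ "(x, [])"]) (simp_all add: path_len_def)
next
  case (Suc k)
  obtain e where "e \<in> in_arcs E x" using no_sources_E[OF Suc.prems] by blast
  then have e: "e \<in> arcs E" "head E e = x" by simp_all
  then obtain w where "w \<in> X" "path_range E w = tail E e" "path_len w = k"
    using Suc.IH[of "tail E e"] by auto
  then show ?case using e by (intro bexI[of _ "path_cons e w"]) (simp_all add: E.path_cons_paths)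
qed

lemma F_simps [simp]:
  "w \<in> verts F \<longleftrightarrow> w \<in> X \<and> path_len w < n"
  "f \<in> arcs F \<longleftrightarrow> fst f \<in> arcs E \<and> snd f \<in> X \<and> path_len (snd f) < n \<and> tail E (fst f) = path_range E (snd f)"
  "tail F f = snd f"
  "head F f = (if path_len (snd f) < n - 1 then path_cons (fst f) (snd f) else (head E (fst f), []))"
  by (auto simp: path_graph_def split: prod.splits)

lemma rm_verts: "u \<in> X \<Longrightarrow> rm u \<in> verts F"
  using n by (simp add: E.path_rem_paths path_len_rem)

lemma rm_cons: "rm (path_cons e u) = head F (e, rm u)"
  using n by (simp add: path_rem_cons)

lemma finite_F_verts: "finite (verts F)"
proof -
  have "verts F \<subseteq> verts E \<times> {l. set l \<subseteq> arcs E \<and> length l \<le> n}"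
  proof
    fix w assume w: "w \<in> verts F"
    obtain x l where xl: "w = (x, l)" by force
    have "x \<in> verts E" using E.path_src_verts[of w] w by (simp add: xl path_src_def)
    moreover have "set l \<subseteq> arcs E" using E.paths_snd_subset[of x l] w by (simp add: xl)
    moreover have "length l \<le> n" using w by (simp add: xl path_len_def)
    ultimately show "w \<in> verts E \<times> {l. set l \<subseteq> arcs E \<and> length l \<le> n}" by (simp add: xl)
  qed
  then show ?thesis by (rule finite_subset) (simp add: finite_lists_length_le)
qed

sublocale ck_graph F
proof
  show "tail F f \<in> verts F" if "f \<in> arcs F" for f using that by simp
  show "head F f \<in> verts F" if "f \<in> arcs F" for f
    using that n by (auto simp: E.path_cons_paths)
  show "finite (verts F)" by (rule finite_F_verts)
  have "arcs F \<subseteq> arcs E \<times> verts F" by auto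
  then show "finite (arcs F)" by (rule finite_subset) (simp add: finite_F_verts del: F_simps)
  show "in_arcs F w \<noteq> {}" if w: "w \<in> verts F" for w
  proof -
    obtain x l where xl: "w = (x, l)" by force
    show ?thesis
    proof (cases l)
      case Nil
      then have x: "x \<in> verts E" using w by (simp add: xl)
      obtain e where "e \<in> in_arcs E x" using no_sources_E[OF x] by blast
      then have e: "e \<in> arcs E" "head E e = x" by simp_all
      obtain u where u: "u \<in> X" "path_range E u = tail E e" "path_len u = n - 1"
        using path_with_range[of "tail E e" "n - 1"] e by auto
      have "(e, u) \<in> in_arcs F w" using e u n by (simp add: in_arcs_def xl Nil)
      then show ?thesis by blast
    next
      case (Cons e l')
      have "(e, (x, l')) \<in> in_arcs F w"
        using w by (auto simp: in_arcs_def xl Cons E.paths_Cons path_len_def path_cons_def)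
      then show ?thesis by blast
    qed
  qed
qed

text \<open>
  Without sources there are arbitrarily long paths into the source of \<open>w\<close>; prefixing \<open>w\<close> by a path whose
  length is a multiple of \<open>n\<close> does not change the remainder.
\<close>

lemma infinite_rm_fibre:
  assumes w: "w \<in> verts F"
  shows "infinite {u \<in> X. rm u = w}"
proof
  assume fin: "finite {u \<in> X. rm u = w}"
  have ex: "\<exists>u\<in>X. rm u = w \<and> path_len u \<ge> k" for k
  proof -
    have x: "fst w \<in> verts E" using E.path_src_verts[of w] w by (simp add: path_src_def)
    obtain v where v: "v \<in> X" "path_range E v = fst w" "path_len v = k * n"
      using path_with_range[OF x, of "k * n"] by blast
    let ?u = "(fst v, snd w @ snd v)"
    have "?u \<in> X" using v w by (intro E.paths_append) simp_all
    moreover have "path_len ?u mod n = path_len w" using v w by (simp add: path_len_def)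
    then have "rm ?u = w" using v(2) by (simp add: path_rem_def Let_def path_len_def prod_eq_iff)
    moreover have "path_len ?u \<ge> k" using v(3) n by (simp add: path_len_def trans_le_add2)
    ultimately show ?thesis by blast
  qed
  obtain u where u: "u \<in> X" "rm u = w" "path_len u \<ge> Suc (Max (path_len ` {u \<in> X. rm u = w}))"
    using ex by blast
  then have "path_len u \<le> Max (path_len ` {u \<in> X. rm u = w})" using fin by (intro Max_ge) auto
  then show False using u(3) by simp
qed

section \<open>The Cuntz-Krieger family of remainders and edges\<close>

text \<open>
  The condition on the range guarantees that \<open>path_cons\<close> produces paths from the domain for every
  \<open>f\<close> whose first component is an edge; for edges of \<open>E(n)\<close> the set is the fibre of the remainder.
\<close>

definition edge_dom :: "'e \<times> ('v, 'e) path \<Rightarrow> ('v, 'e) path set"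
  where "edge_dom f = {u \<in> X. rm u = snd f \<and> tail E (fst f) = path_range E u}"

definition edge_op :: "'e \<times> ('v, 'e) path \<Rightarrow> ('v, 'e) path op"
  where "edge_op f = wshift (edge_dom f) (path_cons (fst f)) (\<lambda>_. 1)"

definition rem_op :: "('v, 'e) path \<Rightarrow> ('v, 'e) path op"
  where "rem_op w = restr {u \<in> X. rm u = w}"

lemma edge_dom_arcs: "f \<in> arcs F \<Longrightarrow> edge_dom f = {u \<in> X. rm u = snd f}"
  unfolding edge_dom_def using path_range_rem[of E n] by (auto) metis+

lemma inj_path_cons [simp]: "inj_on (path_cons e) D"
  using path_cons_inj by (rule inj_on_subset) simp

lemma edge_op_ket: "edge_op f (ket u) = (if u \<in> edge_dom f then ket (path_cons (fst f) u) else 0)"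
  unfolding edge_op_def by (subst wshift_ket) auto

end

lemma clin_wshift: "inj_on g D \<Longrightarrow> (\<And>i. i \<in> D \<Longrightarrow> cmod (c i) \<le> 1) \<Longrightarrow> clin (wshift D g c)"
  by (rule bounded_ops_clin[of _ UNIV]) (rule wshift_bounded_ops, auto)

lemma adj_wshift:
  assumes "inj_on g D" "\<And>i. i \<in> D \<Longrightarrow> cmod (c i) \<le> 1"
  shows "op_adj (wshift D g c) = wshift (g ` D) (inv_into D g) (\<lambda>j. cnj (c (inv_into D g j)))"
proof (rule op_adj_eqI_ket)
  have inj: "inj_on (inv_into D g) (g ` D)" by (rule inj_on_inv_into) simp
  have c: "cmod (cnj (c (inv_into D g j))) \<le> 1" if "j \<in> g ` D" for j
    using that assms by (auto simp: inv_into_f_f)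
  show "clin (wshift (g ` D) (inv_into D g) (\<lambda>j. cnj (c (inv_into D g j))))"
    by (rule clin_wshift) (use inj c in auto)
  show "clin (wshift D g c)" by (rule clin_wshift[OF assms])
  fix i j
  show "cinner (ket j) (wshift (g ` D) (inv_into D g) (\<lambda>j. cnj (c (inv_into D g j))) (ket i))
      = cinner (wshift D g c (ket j)) (ket i)"
    using assms(1) by (auto simp: wshift_ket[OF inj c] wshift_ket[OF assms] inv_into_f_f)
qed

lemma adj_wshift_comp:
  assumes "inj_on g D"
  shows "op_adj (wshift D g (\<lambda>_. 1)) o\<^sub>L wshift D g (\<lambda>_. 1) = restr D"
    "wshift D g (\<lambda>_. 1) o\<^sub>L op_adj (wshift D g (\<lambda>_. 1)) = restr (g ` D)"
proof -
  let ?T = "wshift D g (\<lambda>_. 1)" and ?S = "wshift (g ` D) (inv_into D g) (\<lambda>_. 1)"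
  have inj: "inj_on (inv_into D g) (g ` D)" by (rule inj_on_inv_into) simp
  have adj: "op_adj ?T = ?S" using adj_wshift[OF assms, of "\<lambda>_. 1"] by simp
  have cT: "clin ?T" "clin ?S" using assms inj by (auto intro!: clin_wshift)
  have T: "?T (ket i) = (if i \<in> D then ket (g i) else 0)" for i
    using assms by (subst wshift_ket) auto
  have S: "?S (ket i) = (if i \<in> g ` D then ket (inv_into D g i) else 0)" for i
    using inj by (subst wshift_ket) auto
  show "op_adj ?T o\<^sub>L ?T = restr D" unfolding adj
    by (rule op_eqI_ket) (use cT assms in \<open>auto simp: S T\<close>)
  show "?T o\<^sub>L op_adj ?T = restr (g ` D)" unfolding adj
    by (rule op_eqI_ket) (use cT assms in \<open>auto simp: S T\<close>)
qed

lemma restr_sum_disjoint: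
  assumes "finite A" "\<And>a b. a \<in> A \<Longrightarrow> b \<in> A \<Longrightarrow> a \<noteq> b \<Longrightarrow> D a \<inter> D b = {}"
  shows "(\<Sum>a\<in>A. restr (D a)) = restr (\<Union>a\<in>A. D a)"
  using assms
proof (induction A rule: finite_induct)
  case empty
  show ?case by (intro blinfun_eqI ell2_eqI) simp
next
  case (insert a A)
  have "D a \<inter> (\<Union>a\<in>A. D a) = {}" using insert(2,4) by blast
  then have "restr (D a) + restr (\<Union>a\<in>A. D a) = restr (\<Union>a\<in>insert a A. D a)"
    by (intro blinfun_eqI ell2_eqI) (auto simp: blinfun.add_left)
  then show ?case using insert by simp
qed

context shift_setting
begin

lemma edge_op_adj_edge_op: "op_adj (edge_op f) o\<^sub>L edge_op f = restr (edge_dom f)"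
  and edge_op_edge_op_adj: "edge_op f o\<^sub>L op_adj (edge_op f) = restr (path_cons (fst f) ` edge_dom f)"
  unfolding edge_op_def by (rule adj_wshift_comp, simp)+

lemma clin_edge_op [simp]: "clin (edge_op f)"
  unfolding edge_op_def by (rule clin_wshift) auto

lemma clin_rem_op [simp]: "clin (rem_op w)"
  by (simp add: rem_op_def)

lemma adj_edge_op_ket:
  "op_adj (edge_op f) (ket v) = (if v \<in> path_cons (fst f) ` edge_dom f then ket (fst v, tl (snd v)) else 0)"
proof -
  let ?inv = "inv_into (edge_dom f) (path_cons (fst f))"
  have inj: "inj_on ?inv (path_cons (fst f) ` edge_dom f)" by (rule inj_on_inv_into) simp
  have "op_adj (edge_op f) = wshift (path_cons (fst f) ` edge_dom f) ?inv (\<lambda>_. 1)"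
    unfolding edge_op_def using adj_wshift[of "path_cons (fst f)" "edge_dom f" "\<lambda>_. 1"] by simp
  then show ?thesis by (auto simp: wshift_ket[OF inj]) (simp add: path_cons_def)
qed

lemma adj_edge_op_ket_cons:
  "op_adj (edge_op f) (ket (path_cons e u)) = (if e = fst f \<and> u \<in> edge_dom f then ket u else 0)"
  by (auto simp: adj_edge_op_ket path_cons_eq_iff) (simp add: path_cons_def)

lemma edge_op_orth: "f \<noteq> g \<Longrightarrow> op_adj (edge_op f) o\<^sub>L edge_op g = 0"
  by (rule op_eqI_ket) (auto simp: edge_op_ket adj_edge_op_ket_cons edge_dom_def prod_eq_iff)

lemma edge_op_bounded_ops: "f \<in> arcs F \<Longrightarrow> edge_op f \<in> bounded_ops X"
  unfolding edge_op_def by (rule wshift_bounded_ops) (auto simp: edge_dom_def E.path_cons_paths)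

lemma rem_proj_eq: "rem_proj E n w = rem_op w"
  by (simp add: rem_proj_def orth_proj_ket rem_op_def)

text \<open>
  The description of \<open>edge_shift\<close> determines the operator, since bounded operators are determined by
  their values on basis vectors.
\<close>

lemma edge_shift_eq:
  assumes f: "f \<in> arcs F"
  shows "edge_shift E n f = edge_op f"
proof -
  obtain e w where ew: "f = (e, w)" by (cases f)
  have ket: "edge_op f (ket u) = (if rm u = w then ket (path_cons e u) else 0)" if "u \<in> X" for u
    using that f by (simp add: edge_op_ket edge_dom_arcs ew del: F_simps)
  show ?thesis
    unfolding edge_shift_def ew prod.case
  proof (rule the_equality)
    show "edge_op (e, w) \<in> bounded_ops X \<and> (\<forall>w'\<in>X. edge_op (e, w) (ket w') = (if rm w' = w then ket (path_cons e w') else 0))"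
      using edge_op_bounded_ops[OF f] ket by (simp add: ew)
  next
    fix T :: "('v, 'e) path op"
    assume T: "T \<in> bounded_ops X \<and> (\<forall>w'\<in>X. T (ket w') = (if rm w' = w then ket (path_cons e w') else 0))"
    show "T = edge_op (e, w)"
      by (rule bounded_ops_eqI[of _ X]) (use T edge_op_bounded_ops[OF f] ket in \<open>simp_all add: ew\<close>)
  qed
qed

text \<open>
  Every path of positive length arises from exactly one edge of \<open>E(n)\<close>, namely its last edge together with
  the remainder of the rest.
\<close>

lemma sum_edge_op:
  assumes w: "w \<in> verts F"
  shows "(\<Sum>f\<in>in_arcs F w. edge_op f o\<^sub>L op_adj (edge_op f)) = restr {u \<in> X. rm u = w \<and> snd u \<noteq> []}"
proof -
  have "(\<Sum>f\<in>in_arcs F w. edge_op f o\<^sub>L op_adj (edge_op f)) = restr (\<Union>f\<in>in_arcs F w. path_cons (fst f) ` edge_dom f)"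
    unfolding edge_op_edge_op_adj
  proof (rule restr_sum_disjoint[OF in_arcs_arcs(2)])
    fix f g :: "'e \<times> ('v, 'e) path" assume fg: "f \<noteq> g"
    have "f = g" if "path_cons (fst f) u = path_cons (fst g) u'" "u \<in> edge_dom f" "u' \<in> edge_dom g" for u u'
      using that by (simp add: path_cons_eq_iff edge_dom_def prod_eq_iff[of f g])
    with fg show "path_cons (fst f) ` edge_dom f \<inter> path_cons (fst g) ` edge_dom g = {}" by blast
  qed
  also have "(\<Union>f\<in>in_arcs F w. path_cons (fst f) ` edge_dom f) = {u \<in> X. rm u = w \<and> snd u \<noteq> []}"
  proof (rule Set.set_eqI, rule iffI)
    fix v assume "v \<in> (\<Union>f\<in>in_arcs F w. path_cons (fst f) ` edge_dom f)"
    then obtain f u where fu: "f \<in> in_arcs F w" "u \<in> edge_dom f" "v = path_cons (fst f) u" by blast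
    have f: "f \<in> arcs F" "head F f = w" using fu(1) by (simp_all add: in_arcs_def del: F_simps)
    have u: "u \<in> X" "rm u = snd f" "tail E (fst f) = path_range E u" using fu(2) by (simp_all add: edge_dom_def)
    have "rm v = w" using rm_cons[of "fst f" u] f(2) u(2) fu(3) by (simp del: F_simps)
    moreover have "v \<in> X" using f(1) u by (simp add: fu(3) E.path_cons_paths)
    moreover have "snd v \<noteq> []" by (simp add: fu(3) path_cons_def)
    ultimately show "v \<in> {u \<in> X. rm u = w \<and> snd u \<noteq> []}" by simp
  next
    fix v assume "v \<in> {u \<in> X. rm u = w \<and> snd u \<noteq> []}"
    then have v: "v \<in> X" "rm v = w" "snd v \<noteq> []" by auto
    then obtain e l where el: "snd v = e # l" by (cases "snd v") auto
    define u where "u = (fst v, l)"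
    have vu: "v = path_cons e u" by (simp add: u_def path_cons_def el[symmetric])
    have u: "u \<in> X" "e \<in> arcs E" "tail E e = path_range E u" using v(1) by (simp_all add: vu E.path_cons_paths)
    have "(e, rm u) \<in> arcs F" using u rm_verts[OF u(1)] by (simp add: path_range_rem)
    moreover have "head F (e, rm u) = w" using v(2) unfolding vu rm_cons .
    ultimately have "(e, rm u) \<in> in_arcs F w" by (simp add: in_arcs_def del: F_simps)
    moreover have "u \<in> edge_dom (e, rm u)" using u by (simp add: edge_dom_def)
    ultimately show "v \<in> (\<Union>f\<in>in_arcs F w. path_cons (fst f) ` edge_dom f)" unfolding vu by force
  qed
  finally show ?thesis .
qed

lemma rem_op_minus_sum_edge_op:
  assumes w: "w \<in> verts F"
  shows "rem_op w - (\<Sum>f\<in>in_arcs F w. edge_op f o\<^sub>L op_adj (edge_op f)) = restr {u \<in> X. rm u = w \<and> snd u = []}"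
  unfolding sum_edge_op[OF w] rem_op_def
  by (intro blinfun_eqI ell2_eqI) (auto simp: blinfun.diff_left)

lemma finite_empty_paths: "finite {u \<in> X. rm u = w \<and> snd u = []}"
  by (rule finite_subset[of _ "verts E \<times> {[]}"]) (auto simp: prod_eq_iff dest: E.path_src_verts simp flip: path_src_def)

definition gen_op :: "('v, 'e) path + 'e \<times> ('v, 'e) path \<Rightarrow> ('v, 'e) path op"
  where "gen_op g = (case g of Inl w \<Rightarrow> rem_op w | Inr f \<Rightarrow> edge_op f)"

lemma clin_gen_op [simp]: "clin (gen_op g)"
  by (simp add: gen_op_def split: sum.split)

definition \<psi> :: "(('v, 'e) path + 'e \<times> ('v, 'e) path) star_poly \<Rightarrow> ('v, 'e) path op"
  where "\<psi> = feval gen_op"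

lemma psi_0 [simp]: "\<psi> 0 = 0" by (simp add: \<psi>_def)

lemma psi_simps:
  "a \<in> C \<Longrightarrow> b \<in> C \<Longrightarrow> \<psi> (a + b) = \<psi> a + \<psi> b" "a \<in> C \<Longrightarrow> b \<in> C \<Longrightarrow> \<psi> (a - b) = \<psi> a - \<psi> b"
  "a \<in> C \<Longrightarrow> \<psi> (fscale c a) = op_scale c (\<psi> a)"
  "a \<in> C \<Longrightarrow> b \<in> C \<Longrightarrow> \<psi> (a \<star> b) = \<psi> a o\<^sub>L \<psi> b" "a \<in> C \<Longrightarrow> \<psi> (fstar a) = op_adj (\<psi> a)"
  by (simp_all add: \<psi>_def feval_add[of _ "ck_gens F"] feval_diff[of _ "ck_gens F"] feval_scale[of _ "ck_gens F"]
      feval_mult[of _ _ "ck_gens F"] feval_star[of _ _ "ck_gens F"])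

lemma psi_sum: "(\<And>x. x \<in> S \<Longrightarrow> f x \<in> C) \<Longrightarrow> \<psi> (sum f S) = (\<Sum>x\<in>S. \<psi> (f x))"
  unfolding \<psi>_def by (rule feval_sum[of _ _ "ck_gens F"])

lemma clin_psi [simp]: "clin (\<psi> a)"
  by (simp add: \<psi>_def)

lemma psi_gen: "\<psi> (p w) = rem_op w" "\<psi> (s f) = edge_op f"
  by (simp_all add: \<psi>_def gen_eq gen_op_def)

definition \<sigma> :: "(('v, 'e) path + 'e \<times> ('v, 'e) path) star_poly \<Rightarrow> real"
  where "\<sigma> a = ess (\<psi> a)"

text \<open>
  All relations hold exactly for the operators, except the one at the vertices, which fails by the
  projection onto finitely many paths of length zero.
\<close>

lemma ck_seminorm_sigma: "ck_seminorm F \<sigma>"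
  unfolding ck_seminorm_iff
proof
  show "cstar_seminorm (free_star_algebra (ck_gens F) \<sigma>) \<sigma>"
    unfolding cstar_seminorm_def
    by (auto simp: \<sigma>_def psi_simps ess_add ess_mult ess_cstar)
  have Q: "rem_op w o\<^sub>L rem_op w = rem_op w" "op_adj (rem_op w) = rem_op w" for w
    by (simp_all add: rem_op_def restr_restr)
  have Q0: "rem_op w o\<^sub>L rem_op w' = 0" if "w \<noteq> w'" for w w'
    using that by (intro blinfun_eqI ell2_eqI) (auto simp: rem_op_def)
  have TT: "op_adj (edge_op f) o\<^sub>L edge_op f = rem_op (snd f)" if "f \<in> arcs F" for f
    unfolding edge_op_adj_edge_op rem_op_def using that by (simp only: edge_dom_arcs)
  have TTT: "edge_op f o\<^sub>L op_adj (edge_op f) o\<^sub>L edge_op f = edge_op f" for f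
    unfolding edge_op_edge_op_adj by (rule op_eqI_ket) (auto simp: edge_op_ket)
  show "ck_relations \<sigma>"
    unfolding ck_relations_def
  proof (intro conjI ballI impI)
    fix w assume w: "w \<in> verts F"
    have pw: "p w \<in> C" using w by simp
    show "\<sigma> (p w \<star> p w - p w) = 0" "\<sigma> (fstar (p w) - p w) = 0"
      using pw by (simp_all add: \<sigma>_def psi_simps psi_gen Q del: fcar_gen)
    show "\<sigma> ((\<Sum>f\<in>in_arcs F w. s f \<star> t f) - p w) = 0"
    proof -
      have "\<psi> (\<Sum>f\<in>in_arcs F w. s f \<star> t f) = (\<Sum>f\<in>in_arcs F w. \<psi> (s f \<star> t f))"
      proof (rule psi_sum)
        fix f assume "f \<in> in_arcs F w"
        then have "f \<in> arcs F" by (rule in_arcs_arcs)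
        then show "s f \<star> t f \<in> C" by (simp del: F_simps)
      qed
      also have "\<dots> = (\<Sum>f\<in>in_arcs F w. edge_op f o\<^sub>L op_adj (edge_op f))"
      proof (intro sum.cong refl)
        fix f assume "f \<in> in_arcs F w"
        then have "f \<in> arcs F" by (rule in_arcs_arcs)
        then have "s f \<in> C" by (simp del: F_simps)
        then show "\<psi> (s f \<star> t f) = edge_op f o\<^sub>L op_adj (edge_op f)" by (simp add: psi_simps psi_gen del: fcar_gen)
      qed
      finally have "\<sigma> ((\<Sum>f\<in>in_arcs F w. s f \<star> t f) - p w) = ess (rem_op w - (\<Sum>f\<in>in_arcs F w. edge_op f o\<^sub>L op_adj (edge_op f)))"
        using sum_in_arcs_C pw by (simp add: \<sigma>_def psi_simps psi_gen ess_diff_commute del: fcar_gen)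
      then show ?thesis by (simp only: rem_op_minus_sum_edge_op[OF w] ess_restr_finite[OF finite_empty_paths])
    qed
  next
    fix w w' assume "w \<in> verts F" "w' \<in> verts F" "w \<noteq> w'"
    then show "\<sigma> (p w \<star> p w') = 0" by (simp add: \<sigma>_def psi_simps psi_gen Q0)
  next
    fix f assume f: "f \<in> arcs F"
    then have sf: "s f \<in> C" "p (snd f) \<in> C" by simp_all
    then show "\<sigma> (s f \<star> t f \<star> s f - s f) = 0"
      by (simp add: \<sigma>_def psi_simps psi_gen TTT del: fcar_gen)
    show "\<sigma> (t f \<star> s f - p (tail F f)) = 0"
      using sf by (simp add: \<sigma>_def psi_simps psi_gen TT[OF f] del: fcar_gen)
    fix g assume g: "g \<in> arcs F" "f \<noteq> g"
    then have "s g \<in> C" by simp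
    with sf show "\<sigma> (t f \<star> s g) = 0"
      using g by (simp add: \<sigma>_def psi_simps psi_gen edge_op_orth del: fcar_gen)
  qed
qed

lemma sigma_p: "w \<in> verts F \<Longrightarrow> \<sigma> (p w) \<noteq> 0"
proof -
  assume w: "w \<in> verts F"
  have "{u \<in> X. rm u = w} \<subseteq> {u. 1 \<le> norm (rem_op w (ket u))}" by (auto simp: rem_op_def)
  then have "1 \<le> ess (rem_op w)"
    using infinite_rm_fibre[OF w] finite_subset by (intro ess_ge_1) blast
  then show ?thesis by (simp add: \<sigma>_def psi_gen)
qed

text \<open>
  Conjugation by these diagonal unitaries implements the gauge action.
\<close>

definition U :: "complex \<Rightarrow> ('v, 'e) path op"
  where "U z = wshift UNIV id (\<lambda>u. z ^ path_len u)"

context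
  fixes z :: complex
  assumes z: "cmod z = 1"
begin

lemma U_ket: "U z (ket u) = z ^ path_len u *\<^sub>C ket u" "U (cnj z) (ket u) = cnj z ^ path_len u *\<^sub>C ket u"
  unfolding U_def by (subst wshift_ket; simp add: norm_power z)+

lemma clin_U [simp]: "clin (U z)" "clin (U (cnj z))"
  unfolding U_def by (rule clin_wshift; simp add: norm_power z)+

lemma norm_U: "norm (U z) \<le> 1" "norm (U (cnj z)) \<le> 1"
  unfolding U_def by (rule norm_wshift_le; simp add: norm_power z)+

lemma z_cnj: "z * cnj z = 1" "cnj z * z = 1"
proof -
  show "z * cnj z = 1" using z by (simp add: complex_norm_square[symmetric])
  then show "cnj z * z = 1" by (simp add: mult.commute)
qed

lemma z_cnj_power: "z ^ k * cnj z ^ k = 1" "cnj z ^ k * z ^ k = 1"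
  by (simp_all add: power_mult_distrib[symmetric] z_cnj)

lemma cnj_z: "cnj z = inverse z"
  using inverse_unique[OF z_cnj(1)] by simp

lemma U_U: "U (cnj z) o\<^sub>L U z = id_blinfun"
  by (rule op_eqI_ket) (simp_all add: U_ket z_cnj_power)

lemma adj_U: "op_adj (U z) = U (cnj z)"
  by (rule op_adj_eqI_ket) (simp_all add: U_ket)

lemma adj_U': "op_adj (U (cnj z)) = U z"
  using adj_adj[of "U z"] by (simp add: adj_U)

lemma U_conj_gen_op: "U z o\<^sub>L gen_op g o\<^sub>L U (cnj z) = op_scale (z powi letter_degree (g, False)) (gen_op g)"
proof (cases g)
  case (Inl w)
  show ?thesis
    by (rule op_eqI_ket) (auto simp: Inl gen_op_def letter_degree_def rem_op_def U_ket z_cnj_power)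
next
  case (Inr f)
  have c: "cnj z ^ k * (z * z ^ k) = z" for k
  proof -
    have "cnj z ^ k * (z * z ^ k) = z * (cnj z ^ k * z ^ k)" by (simp only: mult.left_commute)
    then show ?thesis by (simp add: z_cnj_power)
  qed
  show ?thesis
    by (rule op_eqI_ket) (auto simp: Inr gen_op_def letter_degree_def edge_op_ket U_ket c)
qed

lemma U_conj_letter: "U z o\<^sub>L (if b then op_adj (gen_op g) else gen_op g) o\<^sub>L U (cnj z)
    = op_scale (z powi letter_degree (g, b)) (if b then op_adj (gen_op g) else gen_op g)"
proof (cases b)
  case True
  have "U z o\<^sub>L op_adj (gen_op g) o\<^sub>L U (cnj z) = op_adj (U z o\<^sub>L gen_op g o\<^sub>L U (cnj z))"
    by (simp add: adj_comp adj_U adj_U' op_comp_assoc)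
  also have "\<dots> = op_scale (cnj (z powi letter_degree (g, False))) (op_adj (gen_op g))"
    unfolding U_conj_gen_op by (simp add: adj_scale)
  also have "cnj (z powi letter_degree (g, False)) = z powi letter_degree (g, b)"
    using True by (cases g) (simp_all add: letter_degree_def cnj_z power_int_minus)
  finally show ?thesis using True by simp
qed (simp add: U_conj_gen_op)

lemma z_nonzero: "z \<noteq> 0"
  using z by auto

lemma U_conj_weval: "U z o\<^sub>L weval gen_op u o\<^sub>L U (cnj z) = op_scale (z powi wdegree u) (weval gen_op u)"
proof (induction u)
  case Nil
  have "U z o\<^sub>L U (cnj z) = id_blinfun"
    by (rule op_eqI_ket) (simp_all add: U_ket z_cnj_power)
  then show ?case by (simp add: wdegree_def op_scale_simps)
next
  case (Cons l u)
  obtain g b where l: "l = (g, b)" by force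
  let ?A = "if b then op_adj (gen_op g) else gen_op g" and ?B = "weval gen_op u"
  have "U z o\<^sub>L (?A o\<^sub>L ?B) o\<^sub>L U (cnj z) = (U z o\<^sub>L ?A) o\<^sub>L ((U (cnj z) o\<^sub>L U z) o\<^sub>L (?B o\<^sub>L U (cnj z)))"
    unfolding U_U op_comp_id by (simp only: op_comp_assoc)
  also have "\<dots> = (U z o\<^sub>L ?A o\<^sub>L U (cnj z)) o\<^sub>L (U z o\<^sub>L ?B o\<^sub>L U (cnj z))" by (simp only: op_comp_assoc)
  also have "\<dots> = op_scale (z powi letter_degree l * z powi wdegree u) (?A o\<^sub>L ?B)"
    unfolding U_conj_letter Cons by (simp add: l op_scale_simps)
  also have "z powi letter_degree l * z powi wdegree u = z powi wdegree (l # u)"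
    using z_nonzero by (simp add: wdegree_def power_int_add)
  finally show ?case by (simp add: l)
qed

lemma psi_gauge_act: "a \<in> C \<Longrightarrow> \<psi> (gauge_act z a) = U z o\<^sub>L \<psi> a o\<^sub>L U (cnj z)"
proof (induction rule: free_induct)
  case zero
  have "gauge_act z (0 :: (('v, 'e) path + 'e \<times> ('v, 'e) path) star_poly) = 0" by (rule ext) (simp add: gauge_act_def fun_apply_simps)
  then show ?case by simp
next
  case (add a b)
  have "gauge_act z (a + b) = gauge_act z a + gauge_act z b"
    by (rule ext) (simp add: gauge_act_def fun_apply_simps distrib_left)
  then show ?case using add by (simp add: psi_simps gauge_act_fcar op_comp_distrib)
next
  case (mono c u)
  have "gauge_act z (fscale c (mono_word u)) = fscale (z powi wdegree u * c) (mono_word u)"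
    by (rule ext) (simp add: gauge_act_def fscale_def mono_word_def)
  then have "\<psi> (gauge_act z (fscale c (mono_word u))) = op_scale c (op_scale (z powi wdegree u) (weval gen_op u))"
    using mono by (simp add: psi_simps op_scale_simps mult.commute) (simp add: \<psi>_def)
  also have "\<dots> = U z o\<^sub>L \<psi> (fscale c (mono_word u)) o\<^sub>L U (cnj z)"
    using mono unfolding U_conj_weval[symmetric]
    by (simp add: psi_simps op_scale_simps) (simp add: \<psi>_def)
  finally show ?case .
qed

lemma sigma_gauge_act: "a \<in> C \<Longrightarrow> \<sigma> (gauge_act z a) \<le> \<sigma> a"
proof -
  assume a: "a \<in> C"
  have "U (cnj z) o\<^sub>L restr D = restr D o\<^sub>L U (cnj z)" for D
    by (rule op_eqI_ket) (auto simp: U_ket)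
  then show ?thesis
    unfolding \<sigma>_def psi_gauge_act[OF a] using norm_U by (intro ess_conj_diagonal)
qed

end

text \<open>
  \<open>\<sigma>\<close> is gauge-invariant and does not vanish on vertex projections, as their ranges are
  infinite-dimensional.
\<close>

lemma ck_seminorm_le_sigma:
  assumes r: "ck_seminorm F \<rho>" and a: "a \<in> C"
  shows "\<rho> a \<le> \<sigma> a"
proof -
  interpret ck_comparison F \<rho> \<sigma>
    by unfold_locales (use r ck_seminorm_sigma sigma_p in \<open>auto simp del: F_simps\<close>)
  show ?thesis by (rule gauge_invariant_uniqueness[OF sigma_gauge_act a])
qed

lemma nrm_ck_free:
  assumes a: "a \<in> C"
  shows "nrm (ck_free F) a = \<sigma> a"
proof -
  have "(SUP \<rho>\<in>{\<rho>. ck_seminorm F \<rho>}. \<rho> a) = \<sigma> a"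
    by (rule cSup_eq_maximum) (use ck_seminorm_sigma ck_seminorm_le_sigma[OF _ a] in auto)
  then show ?thesis by (simp add: ck_free_def)
qed

end

section \<open>The algebra generated by the periodic weighted shifts\<close>

lemma bounded_linear_scaleC: "bounded_linear (\<lambda>x :: 'i ell2. c *\<^sub>C x)"
  by (rule bounded_linear_intro[where K = "cmod c"]) (simp_all add: scaleC_distrib(1,6) mult.commute)

lemma closed_if_approachable:
  "(\<And>x. \<forall>e>0. \<exists>y\<in>S. dist y x < e \<Longrightarrow> x \<in> S) \<Longrightarrow> closed (S :: 'a :: metric_space set)"
  by (metis closure_approachable closure_subset_eq subsetI)

lemma closed_bounded_ops: "closed (bounded_ops X)"
proof -
  have eq: "bounded_ops X = {T :: 'a op. \<forall>c x. blinfun_apply T (c *\<^sub>C x) = c *\<^sub>C blinfun_apply T x}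
      \<inter> {T. restr X o\<^sub>L T = T} \<inter> {T. T o\<^sub>L restr X = T}"
    by (auto simp: bounded_ops_iff clin_def)
  have "closed {T :: 'a op. \<forall>c x. blinfun_apply T (c *\<^sub>C x) = c *\<^sub>C blinfun_apply T x}"
    by (intro closed_Collect_all closed_Collect_eq bounded_linear.continuous_on[OF bounded_linear_scaleC])
      (auto intro!: continuous_intros)
  moreover have "closed {T :: 'a op. restr X o\<^sub>L T = T}" "closed {T :: 'a op. T o\<^sub>L restr X = T}"
    by (intro closed_Collect_eq bounded_bilinear.continuous_on[OF bounded_bilinear_blinfun_compose]
        continuous_on_const continuous_on_id)+
  ultimately show ?thesis unfolding eq by (intro closed_Int)
qed

lemma op_algebra_simps [simp]:
  "carrier (op_algebra X) = bounded_ops X" "mult (op_algebra X) = (o\<^sub>L)" "\<zero>\<^bsub>op_algebra X\<^esub> = 0"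
  "add (op_algebra X) = (+)" "smult (op_algebra X) = op_scale" "star (op_algebra X) = op_adj"
  "nrm (op_algebra X) = norm"
  by (simp_all add: op_algebra_def)

lemma op_algebra_minus: "T \<in> bounded_ops X \<Longrightarrow> S \<ominus>\<^bsub>op_algebra X\<^esub> T = S - T"
  by (rule a_minus_eq_diff) auto

lemma cstar_subalgebra_op:
  "cstar_subalgebra (op_algebra X) B \<longleftrightarrow> B \<subseteq> bounded_ops X \<and> 0 \<in> B \<and>
    (\<forall>S\<in>B. \<forall>T\<in>B. S + T \<in> B \<and> S o\<^sub>L T \<in> B) \<and> (\<forall>c. \<forall>T\<in>B. op_scale c T \<in> B) \<and> (\<forall>T\<in>B. op_adj T \<in> B) \<and>
    (\<forall>T\<in>bounded_ops X. (\<forall>e>0. \<exists>S\<in>B. norm (T - S) < e) \<longrightarrow> T \<in> B)"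
proof -
  have "(\<forall>e>0. \<exists>S\<in>B. norm (T \<ominus>\<^bsub>op_algebra X\<^esub> S) < e) \<longleftrightarrow> (\<forall>e>0. \<exists>S\<in>B. norm (T - S) < e)"
    if "B \<subseteq> bounded_ops X" for T
    using that op_algebra_minus[of _ X T] by (metis subsetD)
  then show ?thesis unfolding cstar_subalgebra_def op_algebra_simps by blast
qed

lemma cstar_generated_least: "cstar_subalgebra A B \<Longrightarrow> S \<subseteq> B \<Longrightarrow> cstar_generated A S \<subseteq> B"
  unfolding cstar_generated_def by blast

lemma cstar_generated_superset: "S \<subseteq> cstar_generated A S"
  unfolding cstar_generated_def by blast

lemma cstar_subalgebra_generated:
  assumes "S \<subseteq> bounded_ops X"
  shows "cstar_subalgebra (op_algebra X) (cstar_generated (op_algebra X) S)"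
proof -
  let ?M = "{B. cstar_subalgebra (op_algebra X) B \<and> S \<subseteq> B}"
  have "cstar_subalgebra (op_algebra X) (bounded_ops X)" unfolding cstar_subalgebra_op by auto
  then have M: "bounded_ops X \<in> ?M" using assms by blast
  show ?thesis
    unfolding cstar_subalgebra_op
  proof (intro conjI ballI allI impI)
    show "cstar_generated (op_algebra X) S \<subseteq> bounded_ops X" using M unfolding cstar_generated_def by blast
    fix T assume T: "T \<in> bounded_ops X" and ap: "\<forall>e>0. \<exists>S'\<in>cstar_generated (op_algebra X) S. norm (T - S') < e"
    have "T \<in> B" if B: "B \<in> ?M" for B
    proof -
      have "\<forall>e>0. \<exists>S'\<in>B. norm (T - S') < e" using ap B unfolding cstar_generated_def by blast
      then show ?thesis using B T by (simp add: cstar_subalgebra_op)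
    qed
    then show "T \<in> cstar_generated (op_algebra X) S" unfolding cstar_generated_def by blast
  qed (auto simp: cstar_generated_def cstar_subalgebra_op)
qed

context shift_setting
begin

abbreviation "A \<equiv> shift_algebra E n"

lemma A_subalgebra: "cstar_subalgebra (op_algebra X) A"
  unfolding shift_algebra_def
  by (rule cstar_subalgebra_generated) (auto simp: weighted_shift_def)

lemma A_bounded: "T \<in> A \<Longrightarrow> T \<in> bounded_ops X"
  and A_0: "0 \<in> A" and A_add: "S \<in> A \<Longrightarrow> T \<in> A \<Longrightarrow> S + T \<in> A"
  and A_mult: "S \<in> A \<Longrightarrow> T \<in> A \<Longrightarrow> S o\<^sub>L T \<in> A"
  and A_scale: "T \<in> A \<Longrightarrow> op_scale c T \<in> A" and A_adj: "T \<in> A \<Longrightarrow> op_adj T \<in> A"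
  using A_subalgebra unfolding cstar_subalgebra_op by blast+

lemma A_clin [simp]: "T \<in> A \<Longrightarrow> clin T"
  using A_bounded bounded_ops_clin by blast

lemma A_diff: "S \<in> A \<Longrightarrow> T \<in> A \<Longrightarrow> S - T \<in> A"
  using A_add[of S "op_scale (-1) T"] A_scale[of T "-1"] by (simp add: op_scale_simps)

lemma A_sum: "(\<And>x. x \<in> S \<Longrightarrow> f x \<in> A) \<Longrightarrow> sum f S \<in> A"
  by (induction S rule: infinite_finite_induct) (auto intro: A_0 A_add)

lemma closed_A: "closed A"
proof (rule closed_if_approachable)
  fix T assume ap: "\<forall>e>0. \<exists>S\<in>A. dist S T < e"
  have "\<forall>e>0. \<exists>S\<in>bounded_ops X. dist S T < e" using ap A_bounded by blast
  then have "T \<in> bounded_ops X" using closed_approachable[OF closed_bounded_ops] by blast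
  moreover have "\<forall>e>0. \<exists>S\<in>A. norm (T - S) < e" using ap by (simp add: dist_norm norm_minus_commute)
  ultimately show "T \<in> A" using A_subalgebra unfolding cstar_subalgebra_op by blast
qed

text \<open>
  The weights that are 1 for the edge \<open>e\<close> following a path with remainder \<open>w\<close>, and 0 otherwise, have
  period \<open>n\<close>.
\<close>

lemma edge_op_in_A:
  assumes f: "f \<in> arcs F"
  shows "edge_op f \<in> A"
proof -
  obtain e w where ew: "f = (e, w)" by (cases f)
  define lam :: "('v, 'e) path \<Rightarrow> complex" where "lam v = (if \<exists>u. v = path_cons e u \<and> rm u = w then 1 else 0)" for v
  define T where "T e' = (if e' = e then edge_op f else 0)" for e'
  have lam: "lam (path_cons e' u) = (if e' = e \<and> rm u = w then 1 else 0)" for e' u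
    by (auto simp: lam_def path_cons_eq_iff)
  have "weighted_shift E lam T"
    unfolding weighted_shift_def
  proof (intro ballI conjI)
    show "T e' \<in> bounded_ops X" for e' using edge_op_bounded_ops[OF f] by (auto simp: T_def)
    show "T e' (ket u) = (if tail E e' = path_range E u then lam (path_cons e' u) *\<^sub>C ket (path_cons e' u) else 0)"
      if "u \<in> X" for e' u
      using that by (auto simp: T_def lam edge_op_ket edge_dom_def ew)
  qed
  moreover have "has_period E n lam" unfolding has_period_def by (simp add: lam)
  moreover have "T e = edge_op f" "e \<in> arcs E" using f by (simp_all add: T_def ew)
  ultimately have "\<exists>T' e' lam'. edge_op f = T' e' \<and> e' \<in> arcs E \<and> weighted_shift E lam' T' \<and> has_period E n lam'"
    by (intro exI[of _ T] exI[of _ e] exI[of _ lam]) simp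
  then show ?thesis
    unfolding shift_algebra_def by (intro subsetD[OF cstar_generated_superset] CollectI)
qed

text \<open>
  Since there are no sinks, some edge \<open>(e, w)\<close> starts at \<open>w\<close>, and \<open>Q\<^sub>w\<close> is its source projection.
\<close>

lemma rem_op_in_A:
  assumes w: "w \<in> verts F"
  shows "rem_op w \<in> A"
proof -
  have "path_range E w \<in> verts E" using w by (intro E.path_range_verts) simp
  then obtain e where "e \<in> out_arcs E (path_range E w)" using no_sinks by blast
  then have f: "(e, w) \<in> arcs F" using w by simp
  have "rem_op w = op_adj (edge_op (e, w)) o\<^sub>L edge_op (e, w)"
    unfolding edge_op_adj_edge_op edge_dom_arcs[OF f] rem_op_def by simp
  then show ?thesis using edge_op_in_A[OF f] by (simp add: A_mult A_adj)
qed

lemma psi_in_A: "a \<in> C \<Longrightarrow> \<psi> a \<in> A"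
proof (induction rule: free_induct)
  case (mono c u)
  have letter: "(if b then op_adj (gen_op g) else gen_op g) \<in> A" if "g \<in> ck_gens F" for g b
  proof (cases g)
    case (Inl w)
    then show ?thesis using that rem_op_in_A[of w] by (simp add: gen_op_def A_adj del: F_simps)
  next
    case (Inr f)
    then show ?thesis using that edge_op_in_A[of f] by (simp add: gen_op_def A_adj del: F_simps)
  qed
  have "weval gen_op u \<in> A" using mono
  proof (induction u)
    case Nil
    then show ?case by (simp add: words_def)
  next
    case (Cons l u)
    obtain g b where l: "l = (g, b)" by (cases l)
    have g: "g \<in> ck_gens F" "u = [] \<or> u \<in> words (ck_gens F)" using Cons.prems by (simp_all add: words_Cons l)
    show ?case
    proof (cases "u = []")
      case True
      then show ?thesis using letter[OF g(1), of b] by (simp add: l)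
    next
      case False
      then have "weval gen_op u \<in> A" using Cons.IH g(2) by blast
      then show ?thesis using A_mult[OF letter[OF g(1), of b]] by (simp add: l)
    qed
  qed
  then show ?case using mono by (simp add: psi_simps) (simp add: \<psi>_def A_scale)
qed (auto simp: A_0 psi_simps A_add)

text \<open>
  For a path of length zero the projection is the defect of the Cuntz-Krieger relation at that vertex;
  conjugating with the edge operators prolongs the path.
\<close>

lemma restr_single_in_A: "u \<in> X \<Longrightarrow> restr {u} \<in> A"
proof -
  have "(x, l) \<in> X \<Longrightarrow> restr {(x, l)} \<in> A" for x l
  proof (induction l)
    case Nil
    have w: "(x, []) \<in> verts F" using Nil n by simp
    have "rm (y, []) = (y, [])" for y by (rule path_rem_self) (use n in simp)
    then have "{u \<in> X. rm u = (x, []) \<and> snd u = []} = {(x, [])}" using Nil by auto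
    then have "restr {(x, [])} = rem_op (x, []) - (\<Sum>f\<in>in_arcs F (x, []). edge_op f o\<^sub>L op_adj (edge_op f))"
      unfolding rem_op_minus_sum_edge_op[OF w] by simp
    also have "\<dots> \<in> A"
      using in_arcs_arcs(1) by (intro A_diff rem_op_in_A w A_sum A_mult A_adj edge_op_in_A) blast+
    finally show ?case .
  next
    case (Cons e l)
    let ?u = "(x, l)"
    have u: "?u \<in> X" "e \<in> arcs E" "tail E e = path_range E ?u" using Cons.prems by (simp_all add: E.paths_Cons)
    let ?f = "(e, rm ?u)"
    have f: "?f \<in> arcs F" using u rm_verts[OF u(1)] by (simp add: path_range_rem)
    have d: "?u \<in> edge_dom ?f" using u by (simp add: edge_dom_def)
    have cons: "(x, e # l) = path_cons e ?u" by (simp add: path_cons_def)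
    have "restr {path_cons e ?u} = edge_op ?f o\<^sub>L restr {?u} o\<^sub>L op_adj (edge_op ?f)"
    proof (rule op_eqI_ket)
      fix v
      show "restr {path_cons e ?u} (ket v)
          = (edge_op ?f o\<^sub>L restr {?u} o\<^sub>L op_adj (edge_op ?f)) (ket v)"
      proof (cases "\<exists>u'. v = path_cons e u'")
        case True
        then show ?thesis using d by (auto simp: adj_edge_op_ket_cons edge_op_ket path_cons_eq_iff)
      qed (auto simp: adj_edge_op_ket)
    qed simp_all
    moreover have "restr {?u} \<in> A" using Cons.IH u(1) by blast
    ultimately show ?case using edge_op_in_A[OF f] by (simp add: cons A_mult A_adj)
  qed
  then show "u \<in> X \<Longrightarrow> restr {u} \<in> A" by (cases u) simp
qed

lemma restr_finite_in_A:
  assumes "finite D" "D \<subseteq> X"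
  shows "restr D \<in> A"
proof -
  have "(\<Sum>u\<in>D. restr {u}) = restr (\<Union>u\<in>D. {u})"
    by (rule restr_sum_disjoint) (use assms in auto)
  then have "restr D = (\<Sum>u\<in>D. restr {u})" by simp
  also have "\<dots> \<in> A" using assms by (intro A_sum restr_single_in_A) auto
  finally show ?thesis .
qed

lemma tail_in_A:
  assumes "T \<in> A" "finite D"
  shows "T o\<^sub>L restr (- D) \<in> A"
proof -
  have "T o\<^sub>L restr X = T" using A_bounded[OF assms(1)] by (simp add: bounded_ops_iff)
  then have TX: "T (restr X x) = T x" for x by (metis blinfun_apply_blinfun_compose)
  have "T o\<^sub>L restr (- D) = T - (T o\<^sub>L restr (X \<inter> D))"
  proof (rule blinfun_eqI)
    fix x
    have "T (restr (X \<inter> D) x) = T (restr D x)" using TX[of "restr D x"] by simp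
    then show "(T o\<^sub>L restr (- D)) x = (T - (T o\<^sub>L restr (X \<inter> D))) x"
      by (simp add: restr_Compl blinfun.diff_left blinfun.diff_right)
  qed
  also have "\<dots> \<in> A" using assms by (intro A_diff A_mult restr_finite_in_A) auto
  finally show ?thesis .
qed

lemma ess_tail_diff: "finite D \<Longrightarrow> ess ((T o\<^sub>L restr (- D)) - T) = 0"
proof -
  assume D: "finite D"
  have "(T o\<^sub>L restr (- D)) - T = - (T o\<^sub>L restr D)"
    by (rule blinfun_eqI) (simp add: restr_Compl blinfun.diff_left blinfun.diff_right blinfun.minus_left)
  then show ?thesis using ess_comp_restr_finite[OF D, of T] by simp
qed

text \<open>
  Cutting off a finite coordinate projection stays in \<open>A\<close> and realises the essential norm up to an
  arbitrarily small error.
\<close>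

lemma norm_lift:
  assumes "T \<in> A" "ess T < c"
  shows "\<exists>S\<in>A. norm S < c \<and> ess (S - T) = 0"
proof -
  obtain D where D: "finite D" "norm (T o\<^sub>L restr (- D)) < c" using assms(2) by (rule ess_lessD)
  then show ?thesis using tail_in_A[OF assms(1) D(1)] ess_tail_diff[OF D(1), of T] by blast
qed

text \<open>
  Along a fast subsequence the successive differences are replaced by essentially equal elements of
  \<open>A\<close> with summable norms; the sum of these converges in norm.
\<close>

lemma lift_Cauchy:
  assumes T: "\<And>k. T k \<in> A"
    and cau: "\<And>e. 0 < e \<Longrightarrow> \<exists>N. \<forall>j\<ge>N. \<forall>k\<ge>N. ess (T j - T k) < e"
  shows "\<exists>S\<in>A. (\<lambda>k. ess (S - T k)) \<longlonglongrightarrow> 0"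
proof -
  have "\<exists>N. \<forall>i. \<forall>j\<ge>N i. \<forall>k\<ge>N i. ess (T j - T k) < (1/2) ^ i"
    by (intro choice allI cau) simp
  then obtain N where N: "\<And>i j k. j \<ge> N i \<Longrightarrow> k \<ge> N i \<Longrightarrow> ess (T j - T k) < (1/2) ^ i" by blast
  \<comment> \<open>The summand \<open>j\<close> makes the subsequence unbounded, the partial sums make it exceed \<open>N j\<close> and
    \<open>N (j - 1)\<close>.\<close>
  define r where "r j = j + (\<Sum>i\<le>j. N i)" for j
  have r: "r j \<ge> N j" "r (Suc j) \<ge> N j" for j by (simp_all add: r_def lessThan_Suc_atMost[symmetric])
  have "\<exists>S. \<forall>j. S j \<in> A \<and> norm (S j) < (1/2) ^ j \<and> ess (S j - (T (r (Suc j)) - T (r j))) = 0"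
    by (intro choice allI) (use norm_lift[OF A_diff[OF T T] N[OF r(2) r(1)]] in blast)
  then obtain S where S: "\<And>j. S j \<in> A" "\<And>j. norm (S j) < (1/2) ^ j"
      "\<And>j. ess (S j - (T (r (Suc j)) - T (r j))) = 0" by blast
  define T' where "T' j = T (r 0) + (\<Sum>i<j. S i)" for j
  have T'A: "T' j \<in> A" for j unfolding T'_def by (intro A_add A_sum T S)
  have T'0: "ess (T' j - T (r j)) = 0" for j
  proof (induction j)
    case (Suc j)
    have "T' (Suc j) - T (r (Suc j)) = (T' j - T (r j)) + (S j - (T (r (Suc j)) - T (r j)))"
      by (simp add: T'_def)
    also have "ess \<dots> \<le> 0" using ess_add[of "T' j - T (r j)" "S j - (T (r (Suc j)) - T (r j))"] Suc S(3)[of j] by simp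
    finally show ?case by (simp add: antisym)
  qed (simp add: T'_def)
  have "summable S"
    by (rule summable_comparison_test'[where g = "\<lambda>j. (1/2) ^ j"]) (use S(2) in \<open>auto intro: less_imp_le summable_geometric\<close>)
  then have "(\<lambda>j. T' j) \<longlonglongrightarrow> T (r 0) + suminf S"
    unfolding T'_def by (intro tendsto_add tendsto_const summable_LIMSEQ)
  then obtain L where L: "T' \<longlonglongrightarrow> L" by blast
  have "L \<in> A" using closed_sequentially[OF closed_A _ L] T'A by blast
  moreover have "(\<lambda>k. ess (L - T k)) \<longlonglongrightarrow> 0"
  proof (rule LIMSEQ_I)
    fix e :: real assume e: "0 < e"
    obtain M where M: "\<And>j k. j \<ge> M \<Longrightarrow> k \<ge> M \<Longrightarrow> ess (T j - T k) < e/2"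
      using cau[of "e/2"] e by auto
    have "eventually (\<lambda>j. norm (T' j - L) < e/2) sequentially"
      using tendstoD[OF L, of "e/2"] e by (simp add: dist_norm)
    moreover have "eventually (\<lambda>j. r j \<ge> M) sequentially"
      unfolding eventually_sequentially by (intro exI[of _ M]) (simp add: r_def)
    ultimately have "eventually (\<lambda>j. norm (T' j - L) < e/2 \<and> r j \<ge> M) sequentially" by (rule eventually_conj)
    then obtain j where j: "norm (T' j - L) < e/2" "r j \<ge> M" by (auto simp: eventually_sequentially)
    have "ess (L - T k) < e" if k: "k \<ge> M" for k
    proof -
      have "ess (L - T k) \<le> ess (L - T' j) + (ess (T' j - T (r j)) + ess (T (r j) - T k))"
        using ess_triangle[of L "T k" "T' j"] ess_triangle[of "T' j" "T k" "T (r j)"] by simp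
      also have "ess (L - T' j) \<le> norm (T' j - L)"
        using ess_le_norm[of "L - T' j"] by (simp add: norm_minus_commute)
      finally show ?thesis using j T'0[of j] M[OF j(2) k] by simp
    qed
    then show "\<exists>no. \<forall>k\<ge>no. norm (ess (L - T k) - 0) < e" by auto
  qed
  ultimately show ?thesis by blast
qed

text \<open>
  \<open>b = 1 - sqrt (1 - S* S)\<close> is found without functional calculus, as the fixed point of
  \<open>b \<mapsto> (S* S + b\<^sup>2) / 2\<close>.  This map contracts the ball of radius \<open>\<parallel>S\<parallel>\<^sup>2 < 1\<close>.
\<close>

lemma square_root_in_A:
  assumes S: "S \<in> A" "norm S < 1"
  shows "\<exists>b\<in>A. op_adj b = b \<and> op_adj S o\<^sub>L S = op_scale 2 b - (b o\<^sub>L b)"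
proof -
  define q where "q = norm S * norm S"
  have q: "0 \<le> q" "q < 1" using S(2) mult_strict_mono[of "norm S" 1 "norm S" 1] by (auto simp: q_def)
  define H where "H = op_adj S o\<^sub>L S"
  have H: "H \<in> A" "norm H \<le> q" "op_adj H = H"
    using S norm_blinfun_compose[of "op_adj S" S] by (simp_all add: H_def q_def A_mult A_adj adj_comp)
  let ?f = "\<lambda>b. op_scale (1/2) (H + (b o\<^sub>L b))"
  let ?B = "{b \<in> A. norm b \<le> q}"
  have "\<exists>!b. b \<in> ?B \<and> ?f b = b"
  proof (rule Banach_fix)
    have "?B = A \<inter> cball 0 q" by auto
    then show "complete ?B" using closed_A by (simp add: complete_eq_closed closed_Int)
    show "?B \<noteq> {}" using A_0 q by (auto intro!: exI[of _ 0])
    show "0 \<le> q" "q < 1" by (rule q)+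
    have bb: "norm (b o\<^sub>L b) \<le> q" if "norm b \<le> q" for b :: "('v, 'e) path op"
    proof -
      have "norm (b o\<^sub>L b) \<le> norm b * norm b" by (rule norm_blinfun_compose)
      also have "\<dots> \<le> q * 1" using that q by (intro mult_mono) auto
      finally show ?thesis by simp
    qed
    show "?f ` ?B \<subseteq> ?B"
    proof (rule image_subsetI)
      fix b assume b: "b \<in> ?B"
      have "norm (H + (b o\<^sub>L b)) \<le> norm H + norm (b o\<^sub>L b)" by (rule norm_triangle_ineq)
      also have "\<dots> \<le> 2 * q" using H(2) bb[of b] b by simp
      finally show "?f b \<in> ?B" using b H(1) by (simp add: A_scale A_add A_mult)
    qed
    show "dist (?f x) (?f y) \<le> q * dist x y" if x: "x \<in> ?B" and y: "y \<in> ?B" for x y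
    proof -
      have "?f x - ?f y = op_scale (1/2) ((x o\<^sub>L (x - y)) + ((x - y) o\<^sub>L y))"
        by (rule blinfun_eqI) (simp add: blinfun.add_left blinfun.diff_left blinfun.diff_right scaleC_distrib(1,2))
      then have "norm (?f x - ?f y) = 1/2 * norm ((x o\<^sub>L (x - y)) + ((x - y) o\<^sub>L y))" by simp
      also have "\<dots> \<le> 1/2 * (norm x * norm (x - y) + norm (x - y) * norm y)"
        by (intro mult_left_mono order_trans[OF norm_triangle_ineq] add_mono norm_blinfun_compose) auto
      also have "\<dots> \<le> 1/2 * (q * norm (x - y) + norm (x - y) * q)"
        using x y by (intro mult_left_mono add_mono mult_right_mono) auto
      finally show ?thesis by (simp add: dist_norm)
    qed
  qed
  then obtain b where b: "b \<in> ?B" "?f b = b" and unique: "\<And>b'. b' \<in> ?B \<Longrightarrow> ?f b' = b' \<Longrightarrow> b' = b" by blast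
  \<comment> \<open>The adjoint of the fixed point is again a fixed point, so uniqueness makes it self-adjoint.\<close>
  have "?f (op_adj b) = op_adj (?f b)"
    using b(1) H by (simp add: adj_scale adj_add adj_comp)
  then have "op_adj b = b" using b by (intro unique) (simp_all add: A_adj)
  moreover have "op_adj S o\<^sub>L S = op_scale 2 b - (b o\<^sub>L b)"
  proof -
    have "op_scale 2 b = op_scale 2 (?f b)" by (simp only: b(2))
    also have "\<dots> = H + (b o\<^sub>L b)" by (simp add: op_scale_simps)
    finally show ?thesis by (simp add: H_def)
  qed
  ultimately show ?thesis using b(1) by blast
qed

text \<open>
  A weighted shift of period \<open>n\<close> is a finite combination of the operators \<open>T\<^sub>(\<^sub>e\<^sub>,\<^sub>w\<^sub>)\<close>, the coefficient
  being the weight attached to \<open>e\<close> and the remainder \<open>w\<close>.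
\<close>

lemma A_least:
  assumes B: "cstar_subalgebra (op_algebra X) B" and T: "\<And>f. f \<in> arcs F \<Longrightarrow> edge_op f \<in> B"
  shows "A \<subseteq> B"
  unfolding shift_algebra_def
proof (rule cstar_generated_least[OF B], rule subsetI)
  fix S assume "S \<in> {T e | T e lam. e \<in> arcs E \<and> weighted_shift E lam T \<and> has_period E n lam}"
  then obtain T e lam where S: "S = T e" "e \<in> arcs E" "weighted_shift E lam T" "has_period E n lam" by blast
  define mspan where "mspan = {w \<in> verts F. tail E e = path_range E w}"
  have finW: "finite mspan" unfolding mspan_def using finite_F_verts by (rule finite_subset[rotated]) auto
  have S_ket: "S (ket u) = (if tail E e = path_range E u then lam (path_cons e u) *\<^sub>C ket (path_cons e u) else 0)"
    if "u \<in> X" for u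
    using S that by (auto simp: weighted_shift_def)
  have sum_in: "(\<Sum>w\<in>V. g w) \<in> B" if "\<And>w. w \<in> V \<Longrightarrow> g w \<in> B" for g and V :: "('v, 'e) path set"
    using that B by (induction V rule: infinite_finite_induct) (auto simp: cstar_subalgebra_op)
  have fW: "(e, w) \<in> arcs F" if "w \<in> mspan" for w using that S(2) by (simp add: mspan_def)
  have "S = (\<Sum>w\<in>mspan. op_scale (lam (path_cons e w)) (edge_op (e, w)))"
  proof (rule bounded_ops_eqI[of _ X])
    show "S \<in> bounded_ops X" using S by (auto simp: weighted_shift_def)
    have "(\<Sum>w\<in>V. op_scale (lam (path_cons e w)) (edge_op (e, w))) \<in> bounded_ops X" if "V \<subseteq> mspan" for V
      using that fW by (induction V rule: infinite_finite_induct) (auto intro!: edge_op_bounded_ops simp del: F_simps)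
    then show "(\<Sum>w\<in>mspan. op_scale (lam (path_cons e w)) (edge_op (e, w))) \<in> bounded_ops X" by blast
    fix u assume u: "u \<in> X"
    have "(\<Sum>w\<in>mspan. op_scale (lam (path_cons e w)) (edge_op (e, w))) (ket u)
        = (\<Sum>w\<in>mspan. if w = rm u then (if tail E e = path_range E u then lam (path_cons e w) *\<^sub>C ket (path_cons e u) else 0) else 0)"
      using u by (auto simp: blinfun.sum_left edge_op_ket edge_dom_def intro!: sum.cong)
    also have "\<dots> = (if tail E e = path_range E u then lam (path_cons e (rm u)) *\<^sub>C ket (path_cons e u) else 0)"
      using finW rm_verts[OF u] by (auto simp: mspan_def path_range_rem)
    also have "\<dots> = S (ket u)"
    proof (cases "tail E e = path_range E u")
      case True
      have "rm (rm u) = rm u" using rm_verts[OF u] by (intro path_rem_self) simp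
      then have "lam (path_cons e (rm u)) = lam (path_cons e u)"
        using S(4)[unfolded has_period_def, rule_format, OF S(2) E.path_rem_paths[OF u, of n] u]
          True path_range_rem[of E n u] by simp
      then show ?thesis using S_ket[OF u] True by simp
    qed (use S_ket[OF u] in simp)
    finally show "S (ket u) = (\<Sum>w\<in>mspan. op_scale (lam (path_cons e w)) (edge_op (e, w))) (ket u)" by simp
  qed
  also have "\<dots> \<in> B" using B T fW by (intro sum_in) (auto simp: cstar_subalgebra_op simp del: F_simps)
  finally show "S \<in> B" .
qed

subsection \<open>The ideals of compact operators\<close>

abbreviation "K \<equiv> compact_ops X"

lemma src_proj_eq: "src_proj E x = restr {w \<in> X. path_src w = x}"
  by (simp add: src_proj_def orth_proj_ket)

abbreviation "Rx x \<equiv> restr {w \<in> X. path_src w = x}"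

text \<open>
  The bounded operators that respect the decomposition of the basis by the source of a path.
\<close>

definition commutant :: "('v, 'e) path op set"
  where "commutant = {T \<in> bounded_ops X. \<forall>x. Rx x o\<^sub>L T = T o\<^sub>L Rx x}"

lemma commutant_subalgebra: "cstar_subalgebra (op_algebra X) commutant"
  unfolding cstar_subalgebra_op
proof (intro conjI ballI allI impI)
  show "commutant \<subseteq> bounded_ops X" by (auto simp: commutant_def)
  show "0 \<in> commutant" by (auto simp: commutant_def op_comp_zero)
  show "S + T \<in> commutant" if "S \<in> commutant" "T \<in> commutant" for S T using that by (auto simp: commutant_def op_comp_distrib)
  show "S o\<^sub>L T \<in> commutant" if "S \<in> commutant" "T \<in> commutant" for S T
  proof -
    have "Rx x o\<^sub>L (S o\<^sub>L T) = (S o\<^sub>L T) o\<^sub>L Rx x" for x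
    proof -
      have "Rx x o\<^sub>L (S o\<^sub>L T) = (Rx x o\<^sub>L S) o\<^sub>L T" by (simp only: op_comp_assoc)
      also have "\<dots> = S o\<^sub>L (Rx x o\<^sub>L T)" using that(1) by (simp add: commutant_def op_comp_assoc)
      also have "\<dots> = (S o\<^sub>L T) o\<^sub>L Rx x" using that(2) by (simp add: commutant_def op_comp_assoc)
      finally show ?thesis .
    qed
    then show ?thesis using that by (auto simp: commutant_def)
  qed
  show "op_scale c T \<in> commutant" if "T \<in> commutant" for c T
    using that by (auto simp: commutant_def op_scale_simps)
  show "op_adj T \<in> commutant" if T: "T \<in> commutant" for T
  proof -
    have "op_adj (Rx x o\<^sub>L T) = op_adj (T o\<^sub>L Rx x)" for x using T by (simp add: commutant_def)
    moreover have "clin T" using T by (auto simp: commutant_def)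
    ultimately have "op_adj T o\<^sub>L Rx x = Rx x o\<^sub>L op_adj T" for x
      using adj_comp[of "Rx x" T] adj_comp[of T "Rx x"] by (metis adj_restr clin_restr)
    then show ?thesis using T by (auto simp: commutant_def)
  qed
  fix T assume T: "T \<in> bounded_ops X" "\<forall>e>0. \<exists>S\<in>commutant. norm (T - S) < e"
  have "closed {T. Rx x o\<^sub>L T = T o\<^sub>L Rx x}" for x
    by (intro closed_Collect_eq bounded_bilinear.continuous_on[OF bounded_bilinear_blinfun_compose]
        continuous_on_const continuous_on_id)
  moreover have "\<forall>e>0. \<exists>S\<in>{T. Rx x o\<^sub>L T = T o\<^sub>L Rx x}. dist S T < e" for x
    using T(2) unfolding commutant_def dist_norm by (metis (mono_tags, lifting) mem_Collect_eq norm_minus_commute)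
  ultimately have "T \<in> {T. Rx x o\<^sub>L T = T o\<^sub>L Rx x}" for x
    using closed_approachable[of "{T. Rx x o\<^sub>L T = T o\<^sub>L Rx x}" T] by blast
  then show "T \<in> commutant" using T(1) by (auto simp: commutant_def)
qed

lemma A_subset_commutant: "A \<subseteq> commutant"
proof (rule A_least[OF commutant_subalgebra])
  fix f assume f: "f \<in> arcs F"
  have "path_src (path_cons e u) = path_src u" for e and u :: "('v, 'e) path"
    by (simp add: path_src_def path_cons_def)
  moreover have "path_cons (fst f) u \<in> X" if "u \<in> edge_dom f" for u
    using that f by (simp add: edge_dom_def E.path_cons_paths)
  ultimately have "Rx x o\<^sub>L edge_op f = edge_op f o\<^sub>L Rx x" for x
    by (intro op_eqI_ket) (auto simp: edge_op_ket edge_dom_def)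
  then show "edge_op f \<in> commutant" using edge_op_bounded_ops[OF f] by (simp add: commutant_def)
qed

lemma K_props:
  "T \<in> K \<longleftrightarrow> T \<in> bounded_ops X \<and> ess T = 0"
  "0 \<in> K" "S \<in> K \<Longrightarrow> T \<in> K \<Longrightarrow> S - T \<in> K" "S \<in> K \<Longrightarrow> T \<in> K \<Longrightarrow> S + T \<in> K"
  "T \<in> K \<Longrightarrow> S \<in> bounded_ops X \<Longrightarrow> T o\<^sub>L S \<in> K" "T \<in> K \<Longrightarrow> S \<in> bounded_ops X \<Longrightarrow> S o\<^sub>L T \<in> K"
  "T \<in> K \<Longrightarrow> op_scale c T \<in> K" "T \<in> K \<Longrightarrow> op_adj T \<in> K"
proof -
  show iff: "T \<in> K \<longleftrightarrow> T \<in> bounded_ops X \<and> ess T = 0" for T by (rule compact_ops_iff)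
  have 0: "ess T = 0" if "ess T \<le> 0" for T :: "('v, 'e) path op" using that by (simp add: antisym)
  show "0 \<in> K" by (auto simp: iff)
  show "S - T \<in> K" if "S \<in> K" "T \<in> K" using that ess_diff[of S T] by (auto simp: iff intro!: 0)
  show "S + T \<in> K" if "S \<in> K" "T \<in> K" using that ess_add[of S T] by (auto simp: iff intro!: 0)
  show "T o\<^sub>L S \<in> K" if "T \<in> K" "S \<in> bounded_ops X" using that ess_mult[of S T] by (auto simp: iff intro!: 0)
  show "S o\<^sub>L T \<in> K" if "T \<in> K" "S \<in> bounded_ops X" using that ess_mult[of T S] by (auto simp: iff intro!: 0)
  show "op_scale c T \<in> K" if "T \<in> K" using that by (auto simp: iff)
  show "op_adj T \<in> K" if "T \<in> K" using that by (auto simp: iff)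
qed

text \<open>
  \<open>T = \<Sum>\<^sub>x T R\<^sub>x = \<Sum>\<^sub>x R\<^sub>x T R\<^sub>x\<close> for \<open>T\<close> commuting with all \<open>R\<^sub>x\<close>; this description makes
  the closure properties of \<open>\<KK>\<^sub>E\<close> immediate.
\<close>

lemma src_compacts_eq: "src_compacts E = K \<inter> commutant"
proof (rule equalityI; rule subsetI)
  fix T assume "T \<in> src_compacts E"
  then obtain L where T: "T = (\<Sum>x\<in>verts E. Rx x o\<^sub>L L x o\<^sub>L Rx x)" and L: "\<And>x. x \<in> verts E \<Longrightarrow> L x \<in> K"
    unfolding src_compacts_def src_proj_eq by blast
  have Rb: "Rx x \<in> bounded_ops X" for x by (rule restr_bounded_ops) auto
  have term_K: "Rx x o\<^sub>L L x o\<^sub>L Rx x \<in> K" if "x \<in> verts E" for x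
    using L[OF that] Rb by (intro K_props(5,6))
  have RR: "Rx y o\<^sub>L Rx x = (if x = y then Rx x else 0)" for x y
    by (rule op_eqI_ket) auto
  have term_Com: "Rx x o\<^sub>L L x o\<^sub>L Rx x \<in> commutant" if x: "x \<in> verts E" for x
  proof -
    have "Rx y o\<^sub>L (Rx x o\<^sub>L L x o\<^sub>L Rx x) = (Rx x o\<^sub>L L x o\<^sub>L Rx x) o\<^sub>L Rx y" for y
    proof -
      have "Rx y o\<^sub>L (Rx x o\<^sub>L L x o\<^sub>L Rx x) = (Rx y o\<^sub>L Rx x) o\<^sub>L L x o\<^sub>L Rx x" by (simp only: op_comp_assoc)
      moreover have "(Rx x o\<^sub>L L x o\<^sub>L Rx x) o\<^sub>L Rx y = Rx x o\<^sub>L L x o\<^sub>L (Rx x o\<^sub>L Rx y)" by (simp only: op_comp_assoc)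
      ultimately show ?thesis by (simp only: RR) (simp add: op_comp_zero)
    qed
    then show ?thesis using term_K[OF x] by (simp add: commutant_def K_props(1))
  qed
  have "(\<Sum>x\<in>V. Rx x o\<^sub>L L x o\<^sub>L Rx x) \<in> K \<inter> commutant" if "V \<subseteq> verts E" for V
    using that commutant_subalgebra term_K term_Com
    by (induction V rule: infinite_finite_induct) (auto simp: K_props(2,4) cstar_subalgebra_op)
  then show "T \<in> K \<inter> commutant" unfolding T by blast
next
  fix T assume T: "T \<in> K \<inter> commutant"
  have "(\<Sum>x\<in>verts E. Rx x) = restr (\<Union>x\<in>verts E. {w \<in> X. path_src w = x})"
    by (rule restr_sum_disjoint) auto
  also have "(\<Union>x\<in>verts E. {w \<in> X. path_src w = x}) = X" using E.path_src_verts by auto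
  finally have sumR: "(\<Sum>x\<in>verts E. Rx x) = restr X" .
  have "Rx x o\<^sub>L T o\<^sub>L Rx x = T o\<^sub>L Rx x" for x
  proof -
    have "Rx x o\<^sub>L T o\<^sub>L Rx x = T o\<^sub>L (Rx x o\<^sub>L Rx x)" using T by (simp add: commutant_def op_comp_assoc)
    then show ?thesis by (simp add: restr_restr)
  qed
  then have "(\<Sum>x\<in>verts E. Rx x o\<^sub>L T o\<^sub>L Rx x) = T o\<^sub>L (\<Sum>x\<in>verts E. Rx x)"
    by (intro blinfun_eqI) (simp add: blinfun.sum_left blinfun.sum_right)
  also have "\<dots> = T" unfolding sumR using T by (simp add: K_props(1) bounded_ops_iff)
  finally have "T = (\<Sum>x\<in>verts E. Rx x o\<^sub>L T o\<^sub>L Rx x)" by simp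
  then show "T \<in> src_compacts E" unfolding src_compacts_def src_proj_eq using T
    by (intro CollectI exI[of _ "\<lambda>_. T"]) auto
qed

end

section \<open>Essential limits of Cauchy sequences\<close>

lemma tendsto_0_le:
  fixes f g :: "nat \<Rightarrow> real"
  assumes "g \<longlonglongrightarrow> 0" "\<And>k. f k \<le> g k" "\<And>k. 0 \<le> f k"
  shows "f \<longlonglongrightarrow> 0"
  by (rule Lim_null_comparison[OF _ assms(1)]) (use assms in auto)

context shift_setting
begin

abbreviation "CKfree \<equiv> ck_free F"

lemma ck_free_simps [simp]:
  "carrier CKfree = C" "mult CKfree = (\<star>)" "\<zero>\<^bsub>CKfree\<^esub> = 0" "add CKfree = (+)"
  "smult CKfree = fscale" "star CKfree = fstar"
  by (simp_all add: ck_free_def)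

lemma ck_free_minus: "b \<in> C \<Longrightarrow> a \<ominus>\<^bsub>CKfree\<^esub> b = a - b"
  by (rule a_minus_eq_diff) auto

lemma cauchy_seqs_iff: "a \<in> cauchy_seqs CKfree \<longleftrightarrow>
  (\<forall>k. a k \<in> C) \<and> (\<forall>e>0. \<exists>N. \<forall>j\<ge>N. \<forall>k\<ge>N. \<sigma> (a j - a k) < e)"
proof -
  have "nrm CKfree (a j \<ominus>\<^bsub>CKfree\<^esub> a k) = \<sigma> (a j - a k)" if "\<forall>k. a k \<in> C" for j k
    using that by (simp add: ck_free_minus nrm_ck_free)
  then show ?thesis unfolding cauchy_seqs_def by auto
qed

lemma null_seqs_iff: "a \<in> null_seqs CKfree \<longleftrightarrow> (\<forall>k. a k \<in> C) \<and> (\<lambda>k. \<sigma> (a k)) \<longlonglongrightarrow> 0"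
proof -
  have "(\<lambda>k. nrm CKfree (a k)) = (\<lambda>k. \<sigma> (a k))" if "\<forall>k. a k \<in> C"
    using that by (simp add: nrm_ck_free)
  then show ?thesis unfolding null_seqs_def by auto
qed

text \<open>
  The relation between a sequence of polynomials and the operators that represent its image in the
  Calkin algebra.  All statements about the completion are reduced to it.
\<close>

definition esslim :: "(nat \<Rightarrow> (('v, 'e) path + 'e \<times> ('v, 'e) path) star_poly) \<Rightarrow> ('v, 'e) path op \<Rightarrow> bool"
  where "esslim a T \<longleftrightarrow> (\<forall>k. a k \<in> C) \<and> T \<in> bounded_ops X \<and> (\<lambda>k. ess (T - \<psi> (a k))) \<longlonglongrightarrow> 0"

lemma esslimD:
  "esslim a T \<Longrightarrow> a k \<in> C" "esslim a T \<Longrightarrow> T \<in> bounded_ops X" "esslim a T \<Longrightarrow> clin T"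
  "esslim a T \<Longrightarrow> (\<lambda>k. ess (T - \<psi> (a k))) \<longlonglongrightarrow> 0"
  by (auto simp: esslim_def)

lemma esslim_const: "a \<in> C \<Longrightarrow> esslim (\<lambda>_. a) (\<psi> a)"
  using A_bounded[OF psi_in_A] by (simp add: esslim_def)

lemma esslim_0: "esslim a 0 \<longleftrightarrow> a \<in> null_seqs CKfree"
  by (auto simp: esslim_def null_seqs_iff \<sigma>_def)

lemma esslim_add: "esslim a S \<Longrightarrow> esslim b T \<Longrightarrow> esslim (\<lambda>k. a k + b k) (S + T)"
proof -
  assume a: "esslim a S" and b: "esslim b T"
  have "(\<lambda>k. ess (S + T - \<psi> (a k + b k))) \<longlonglongrightarrow> 0"
  proof (rule tendsto_0_le)
    show "(\<lambda>k. ess (S - \<psi> (a k)) + ess (T - \<psi> (b k))) \<longlonglongrightarrow> 0"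
      using tendsto_add[OF esslimD(4)[OF a] esslimD(4)[OF b]] by simp
    show "ess (S + T - \<psi> (a k + b k)) \<le> ess (S - \<psi> (a k)) + ess (T - \<psi> (b k))" for k
      using ess_add[of "S - \<psi> (a k)" "T - \<psi> (b k)"] esslimD(1)[OF a] esslimD(1)[OF b]
      by (simp add: psi_simps algebra_simps)
  qed simp
  then show ?thesis using esslimD(1,2)[OF a] esslimD(1,2)[OF b] by (auto simp: esslim_def)
qed

lemma esslim_scale: "esslim a T \<Longrightarrow> esslim (\<lambda>k. fscale c (a k)) (op_scale c T)"
proof -
  assume a: "esslim a T"
  have "ess (op_scale c T - \<psi> (fscale c (a k))) = cmod c * ess (T - \<psi> (a k))" for k
    using esslimD(1)[OF a] by (simp add: psi_simps op_scale_simps(2)[symmetric])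
  then have "(\<lambda>k. ess (op_scale c T - \<psi> (fscale c (a k)))) \<longlonglongrightarrow> 0"
    using tendsto_mult_right_zero[OF esslimD(4)[OF a], of "cmod c"] by simp
  then show ?thesis using esslimD(1,2)[OF a] by (auto simp: esslim_def)
qed

lemma esslim_diff: "esslim a S \<Longrightarrow> esslim b T \<Longrightarrow> esslim (\<lambda>k. a k - b k) (S - T)"
  using esslim_add[of a S "\<lambda>k. fscale (-1) (b k)" "op_scale (-1) T"] esslim_scale[of b T "-1"]
  by (simp add: fscale_minus1 op_scale_simps)

lemma esslim_star: "esslim a T \<Longrightarrow> esslim (\<lambda>k. fstar (a k)) (op_adj T)"
proof -
  assume a: "esslim a T"
  have "ess (op_adj T - \<psi> (fstar (a k))) = ess (T - \<psi> (a k))" for k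
  proof -
    have "op_adj T - \<psi> (fstar (a k)) = op_adj (T - \<psi> (a k))"
      using esslimD(1,3)[OF a] by (simp add: psi_simps adj_diff)
    then show ?thesis using esslimD(3)[OF a] by simp
  qed
  then show ?thesis using esslimD[OF a] by (auto simp: esslim_def)
qed

lemma esslim_mult: "esslim a S \<Longrightarrow> esslim b T \<Longrightarrow> esslim (\<lambda>k. a k \<star> b k) (S o\<^sub>L T)"
proof -
  assume a: "esslim a S" and b: "esslim b T"
  let ?x = "\<lambda>k. ess (S - \<psi> (a k))" and ?y = "\<lambda>k. ess (T - \<psi> (b k))"
  have "(\<lambda>k. ess ((S o\<^sub>L T) - \<psi> (a k \<star> b k))) \<longlonglongrightarrow> 0"
  proof (rule tendsto_0_le)
    have "(\<lambda>k. ?x k * ess T + (ess S + ?x k) * ?y k) \<longlonglongrightarrow> 0 * ess T + (ess S + 0) * 0"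
      by (intro tendsto_add tendsto_mult tendsto_const esslimD(4)[OF a] esslimD(4)[OF b])
    then show "(\<lambda>k. ?x k * ess T + (ess S + ?x k) * ?y k) \<longlonglongrightarrow> 0" by simp
    fix k
    have "(S o\<^sub>L T) - \<psi> (a k \<star> b k) = ((S - \<psi> (a k)) o\<^sub>L T) + (\<psi> (a k) o\<^sub>L (T - \<psi> (b k)))"
      using esslimD(1)[OF a] esslimD(1)[OF b] by (simp add: psi_simps op_comp_distrib)
    then have "ess ((S o\<^sub>L T) - \<psi> (a k \<star> b k)) \<le> ?x k * ess T + ess (\<psi> (a k)) * ?y k"
      using ess_add[of "(S - \<psi> (a k)) o\<^sub>L T" "\<psi> (a k) o\<^sub>L (T - \<psi> (b k))"]
        ess_mult[of T "S - \<psi> (a k)"] ess_mult[of "T - \<psi> (b k)" "\<psi> (a k)"] esslimD(3)[OF b] by simp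
    also have "\<dots> \<le> ?x k * ess T + (ess S + ?x k) * ?y k"
      using ess_diff_abs[of S "\<psi> (a k)"] by (intro add_left_mono mult_right_mono) auto
    finally show "ess ((S o\<^sub>L T) - \<psi> (a k \<star> b k)) \<le> ?x k * ess T + (ess S + ?x k) * ?y k" .
  qed simp
  then show ?thesis using esslimD(1,2)[OF a] esslimD(1,2)[OF b] by (auto simp: esslim_def)
qed

lemma esslim_unique:
  assumes a: "esslim a S" and a': "esslim a T"
  shows "ess (S - T) = 0"
proof -
  have "(\<lambda>k. ess (S - \<psi> (a k)) + ess (T - \<psi> (a k))) \<longlonglongrightarrow> 0 + 0"
    by (intro tendsto_add esslimD(4)[OF a] esslimD(4)[OF a'])
  moreover have "ess (S - T) \<le> ess (S - \<psi> (a k)) + ess (T - \<psi> (a k))" for k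
    using ess_triangle[of S T "\<psi> (a k)"] by (simp add: ess_diff_commute[of T])
  ultimately have "ess (S - T) \<le> 0 + 0" by (intro LIMSEQ_le_const) auto
  then show ?thesis by (simp add: antisym)
qed

lemma esslim_cong_op: "esslim a S \<Longrightarrow> T \<in> bounded_ops X \<Longrightarrow> ess (S - T) = 0 \<Longrightarrow> esslim a T"
proof -
  assume a: "esslim a S" and T: "T \<in> bounded_ops X" "ess (S - T) = 0"
  have "(\<lambda>k. ess (T - \<psi> (a k))) \<longlonglongrightarrow> 0"
  proof (rule tendsto_0_le[OF esslimD(4)[OF a]])
    show "ess (T - \<psi> (a k)) \<le> ess (S - \<psi> (a k))" for k
      using ess_triangle[of T "\<psi> (a k)" S] T(2) by (simp add: ess_diff_commute[of T])
  qed simp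
  then show ?thesis using a T by (auto simp: esslim_def)
qed

lemma esslim_cauchy: "esslim a T \<Longrightarrow> a \<in> cauchy_seqs CKfree"
  unfolding cauchy_seqs_iff
proof (intro conjI allI impI)
  assume a: "esslim a T"
  show "a k \<in> C" for k using a by (rule esslimD)
  fix e :: real assume "0 < e"
  then obtain N where N: "\<And>k. k \<ge> N \<Longrightarrow> ess (T - \<psi> (a k)) < e/2"
    using LIMSEQ_D[OF esslimD(4)[OF a], of "e/2"] by auto
  have "\<sigma> (a j - a k) < e" if "j \<ge> N" "k \<ge> N" for j k
    using ess_triangle[of "\<psi> (a j)" "\<psi> (a k)" T] N[OF that(1)] N[OF that(2)] esslimD(1)[OF a]
    by (simp add: \<sigma>_def psi_simps ess_diff_commute[of _ T])
  then show "\<exists>N. \<forall>j\<ge>N. \<forall>k\<ge>N. \<sigma> (a j - a k) < e" by blast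
qed

lemma esslim_exists:
  assumes a: "a \<in> cauchy_seqs CKfree"
  shows "\<exists>T\<in>A. esslim a T"
proof -
  have aC: "a k \<in> C" for k using a by (simp add: cauchy_seqs_iff)
  have "\<exists>T\<in>A. (\<lambda>k. ess (T - \<psi> (a k))) \<longlonglongrightarrow> 0"
  proof (rule lift_Cauchy)
    show "\<psi> (a k) \<in> A" for k using aC by (rule psi_in_A)
    have "\<sigma> (a j - a k) = ess (\<psi> (a j) - \<psi> (a k))" for j k using aC by (simp add: \<sigma>_def psi_simps)
    then show "\<exists>N. \<forall>j\<ge>N. \<forall>k\<ge>N. ess (\<psi> (a j) - \<psi> (a k)) < e" if "0 < e" for e
      using a that by (simp add: cauchy_seqs_iff)
  qed
  then show ?thesis using aC A_bounded by (auto simp: esslim_def)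
qed

text \<open>
  The essential limits form a C*-subalgebra that contains the operators \<open>T\<^sub>(\<^sub>e\<^sub>,\<^sub>w\<^sub>)\<close>.
\<close>

lemma esslim_of_A:
  assumes "T \<in> A"
  shows "\<exists>a. esslim a T"
proof -
  let ?D = "{T. \<exists>a. esslim a T}"
  have "A \<subseteq> ?D"
  proof (rule A_least)
    show "\<And>f. f \<in> arcs F \<Longrightarrow> edge_op f \<in> ?D"
    proof -
      fix f assume "f \<in> arcs F"
      then have "esslim (\<lambda>_. s f) (edge_op f)" using esslim_const[of "s f"] by (simp add: psi_gen)
      then show "edge_op f \<in> ?D" by blast
    qed
    show "cstar_subalgebra (op_algebra X) ?D"
      unfolding cstar_subalgebra_op
    proof (intro conjI ballI allI impI)
      show "?D \<subseteq> bounded_ops X" by (auto simp: esslim_def)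
      show "0 \<in> ?D" using esslim_const[of 0] by auto
      show "S + T \<in> ?D" if "S \<in> ?D" "T \<in> ?D" for S T using that esslim_add by blast
      show "S o\<^sub>L T \<in> ?D" if "S \<in> ?D" "T \<in> ?D" for S T using that esslim_mult by blast
      show "op_scale c T \<in> ?D" if "T \<in> ?D" for c T using that esslim_scale by blast
      show "op_adj T \<in> ?D" if "T \<in> ?D" for T using that esslim_star by blast
      fix T assume T: "T \<in> bounded_ops X" "\<forall>e>0. \<exists>S\<in>?D. norm (T - S) < e"
      have "\<exists>b. b \<in> C \<and> ess (T - \<psi> b) < 1 / real (Suc k)" for k
      proof -
        have "0 < 1 / (2 * real (Suc k))" by simp
        then obtain S a where S: "esslim a S" "norm (T - S) < 1 / (2 * real (Suc k))" using T(2) by blast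
        obtain m where m: "ess (S - \<psi> (a m)) < 1 / (2 * real (Suc k))"
          using LIMSEQ_D[OF esslimD(4)[OF S(1)], of "1 / (2 * real (Suc k))"] by auto
        have "ess (T - \<psi> (a m)) \<le> norm (T - S) + ess (S - \<psi> (a m))"
          using ess_triangle[of T "\<psi> (a m)" S] ess_le_norm[of "T - S"] by simp
        also have "\<dots> < 1 / (2 * real (Suc k)) + 1 / (2 * real (Suc k))" using S(2) m by (rule add_strict_mono)
        also have "\<dots> = 1 / real (Suc k)" by (simp add: field_simps)
        finally show ?thesis using esslimD(1)[OF S(1)] by blast
      qed
      then obtain b where b: "\<And>k. b k \<in> C" "\<And>k. ess (T - \<psi> (b k)) < 1 / real (Suc k)" by metis
      have "(\<lambda>k. ess (T - \<psi> (b k))) \<longlonglongrightarrow> 0"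
        by (rule tendsto_0_le[OF LIMSEQ_inverse_real_of_nat]) (use b in \<open>auto simp: inverse_eq_divide less_imp_le\<close>)
      then show "T \<in> ?D" using b(1) T(1) by (auto simp: esslim_def)
    qed
  qed
  then show ?thesis using assms by blast
qed

section \<open>The Cuntz-Krieger algebra and the Calkin algebra as quotients\<close>

lemma seq_algebra_simps [simp]:
  "carrier (seq_algebra CKfree) = cauchy_seqs CKfree" "mult (seq_algebra CKfree) = (\<lambda>a b k. a k \<star> b k)"
  "\<zero>\<^bsub>seq_algebra CKfree\<^esub> = 0" "add (seq_algebra CKfree) = (+)"
  "smult (seq_algebra CKfree) = (\<lambda>c a k. fscale c (a k))" "star (seq_algebra CKfree) = (\<lambda>a k. fstar (a k))"
  by (simp_all add: seq_algebra_def fun_eq_iff plus_fun_apply zero_fun_apply)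

lemma zero_seq: "(0 :: nat \<Rightarrow> 'g star_poly) = (\<lambda>_. 0)"
  by (rule zero_fun_def)

lemma cauchy_esslim: "a \<in> cauchy_seqs CKfree \<longleftrightarrow> (\<exists>T. esslim a T)"
  using esslim_exists esslim_cauchy by blast

sublocale CK: quotient_data "seq_algebra CKfree" "null_seqs CKfree"
proof
  show "a - b \<in> carrier (seq_algebra CKfree)" if "a \<in> carrier (seq_algebra CKfree)" "b \<in> carrier (seq_algebra CKfree)" for a b
    using that esslim_diff[of a _ b] by (auto simp: cauchy_esslim fun_diff_def)
  show "0 \<in> carrier (seq_algebra CKfree)"
    using esslim_cauchy[OF esslim_const[of 0]] by (simp add: zero_seq)
  show "0 \<in> null_seqs CKfree" using esslim_const[of 0] by (simp add: esslim_0[symmetric] zero_seq)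
  show "a - b \<in> null_seqs CKfree" if "a \<in> null_seqs CKfree" "b \<in> null_seqs CKfree" for a b
    using that esslim_diff[of a 0 b 0] by (simp add: esslim_0[symmetric] fun_diff_def)
qed simp_all

abbreviation cls :: "(nat \<Rightarrow> (('v, 'e) path + 'e \<times> ('v, 'e) path) star_poly) \<Rightarrow> _"
  where "cls a \<equiv> null_seqs CKfree +>\<^bsub>seq_algebra CKfree\<^esub> a"

abbreviation "OE \<equiv> ck_algebra F"

lemma ck_algebra_eq: "OE = quot (seq_algebra CKfree) (null_seqs CKfree)"
  by (simp add: ck_algebra_def completion_def)

lemma carrier_ck_algebra: "carrier OE = cls ` cauchy_seqs CKfree"
  unfolding ck_algebra_eq CK.quot_carrier by simp

lemma esslim_null_perturb:
  assumes "x - a \<in> null_seqs CKfree" "esslim a T"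
  shows "esslim x T"
proof -
  have "esslim (x - a) 0" using assms(1) by (simp only: esslim_0)
  then have "esslim (\<lambda>k. (x - a) k + a k) (0 + T)" using assms(2) by (rule esslim_add)
  then show ?thesis by simp
qed

lemma esslim_eq_null:
  assumes "esslim a S" "esslim b T"
  shows "a - b \<in> null_seqs CKfree \<longleftrightarrow> ess (S - T) = 0"
proof
  assume "a - b \<in> null_seqs CKfree"
  then have "esslim a T" using assms(2) by (rule esslim_null_perturb)
  then show "ess (S - T) = 0" using assms(1) esslim_unique by blast
next
  assume 0: "ess (S - T) = 0"
  have 1: "esslim (a - b) (S - T)" using esslim_diff[OF assms] by (simp add: fun_diff_def)
  have "esslim (a - b) 0" by (rule esslim_cong_op[OF 1 bounded_ops_closed(1)]) (simp add: 0)
  then show "a - b \<in> null_seqs CKfree" by (simp add: esslim_0)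
qed

lemma cls_eq_iff: "esslim a S \<Longrightarrow> esslim b T \<Longrightarrow> cls a = cls b \<longleftrightarrow> ess (S - T) = 0"
  unfolding CK.coset_eq_iff by (rule esslim_eq_null)

lemma cls_add: "cls a \<oplus>\<^bsub>OE\<^esub> cls b = cls (\<lambda>k. a k + b k)"
  unfolding ck_algebra_eq CK.quot_add by (simp add: plus_fun_def)

lemma cls_mult:
  assumes "esslim a S" "esslim b T"
  shows "cls a \<otimes>\<^bsub>OE\<^esub> cls b = cls (\<lambda>k. a k \<star> b k)"
  unfolding ck_algebra_eq
proof (subst CK.quot_mult)
  fix x y assume "x - a \<in> null_seqs CKfree" "y - b \<in> null_seqs CKfree"
  then have "esslim x S" "esslim y T" using assms esslim_null_perturb by blast+
  then have "esslim (\<lambda>k. x k \<star> y k) (S o\<^sub>L T)" "esslim (\<lambda>k. a k \<star> b k) (S o\<^sub>L T)" using assms esslim_mult by blast+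
  then have "(\<lambda>k. x k \<star> y k) - (\<lambda>k. a k \<star> b k) \<in> null_seqs CKfree" by (subst esslim_eq_null) auto
  then show "(x \<otimes>\<^bsub>seq_algebra CKfree\<^esub> y) - (a \<otimes>\<^bsub>seq_algebra CKfree\<^esub> b) \<in> null_seqs CKfree" by simp
qed simp

lemma cls_smult:
  assumes "esslim a T"
  shows "c \<odot>\<^bsub>OE\<^esub> cls a = cls (\<lambda>k. fscale c (a k))"
  unfolding ck_algebra_eq
proof (subst CK.quot_smult)
  fix x assume "x - a \<in> null_seqs CKfree"
  then have "esslim x T" using assms by (rule esslim_null_perturb)
  then have "esslim (\<lambda>k. fscale c (x k)) (op_scale c T)" "esslim (\<lambda>k. fscale c (a k)) (op_scale c T)"
    using assms esslim_scale by blast+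
  then have "(\<lambda>k. fscale c (x k)) - (\<lambda>k. fscale c (a k)) \<in> null_seqs CKfree" by (subst esslim_eq_null) auto
  then show "(c \<odot>\<^bsub>seq_algebra CKfree\<^esub> x) - (c \<odot>\<^bsub>seq_algebra CKfree\<^esub> a) \<in> null_seqs CKfree" by simp
qed simp

lemma cls_star:
  assumes "esslim a T"
  shows "star OE (cls a) = cls (\<lambda>k. fstar (a k))"
  unfolding ck_algebra_eq
proof (subst CK.quot_star)
  fix x assume "x - a \<in> null_seqs CKfree"
  then have "esslim x T" using assms by (rule esslim_null_perturb)
  then have "esslim (\<lambda>k. fstar (x k)) (op_adj T)" "esslim (\<lambda>k. fstar (a k)) (op_adj T)"
    using assms esslim_star by blast+
  then have "(\<lambda>k. fstar (x k)) - (\<lambda>k. fstar (a k)) \<in> null_seqs CKfree" by (subst esslim_eq_null) auto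
  then show "star (seq_algebra CKfree) x - star (seq_algebra CKfree) a \<in> null_seqs CKfree" by simp
qed simp

sublocale Calk: quotient_data "op_algebra X" K
  by unfold_locales (auto simp: K_props(2,3))

abbreviation "cal \<equiv> calkin_map E"

lemma cal_eq: "cal T = K +>\<^bsub>op_algebra X\<^esub> T"
  by (simp add: calkin_map_def)

lemma carrier_calkin: "carrier (calkin_algebra E) = cal ` bounded_ops X"
  unfolding calkin_algebra_def Calk.quot_carrier cal_eq by simp

lemma cal_eq_iff: "S \<in> bounded_ops X \<Longrightarrow> T \<in> bounded_ops X \<Longrightarrow> cal S = cal T \<longleftrightarrow> ess (S - T) = 0"
  unfolding cal_eq Calk.coset_eq_iff by (auto simp: K_props(1))

lemma cal_add: "cal S \<oplus>\<^bsub>calkin_algebra E\<^esub> cal T = cal (S + T)"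
  unfolding calkin_algebra_def cal_eq by (rule Calk.quot_add)

lemma K_perturb: "x - S \<in> K \<Longrightarrow> S \<in> bounded_ops X \<Longrightarrow> x \<in> bounded_ops X"
  using bounded_ops_closed(2)[of "x - S" X S] by (simp add: K_props(1))

lemma cal_mult:
  assumes "S \<in> bounded_ops X" "T \<in> bounded_ops X"
  shows "cal S \<otimes>\<^bsub>calkin_algebra E\<^esub> cal T = cal (S o\<^sub>L T)"
  unfolding calkin_algebra_def cal_eq
proof (subst Calk.quot_mult)
  fix x y assume xy: "x - S \<in> K" "y - T \<in> K"
  have "(x o\<^sub>L y) - (S o\<^sub>L T) = (x o\<^sub>L (y - T)) + ((x - S) o\<^sub>L T)" by (simp add: op_comp_distrib)
  also have "\<dots> \<in> K" using xy assms K_perturb by (intro K_props(4,5,6)) auto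
  finally show "(x \<otimes>\<^bsub>op_algebra X\<^esub> y) - (S \<otimes>\<^bsub>op_algebra X\<^esub> T) \<in> K" by simp
qed simp

lemma cal_smult:
  "c \<odot>\<^bsub>calkin_algebra E\<^esub> cal T = cal (op_scale c T)"
  unfolding calkin_algebra_def cal_eq
  by (subst Calk.quot_smult) (auto simp: op_scale_simps(2)[symmetric] intro: K_props(7))

lemma cal_star:
  assumes T: "T \<in> bounded_ops X"
  shows "star (calkin_algebra E) (cal T) = cal (op_adj T)"
  unfolding calkin_algebra_def cal_eq
proof (subst Calk.quot_star)
  fix x assume x: "x - T \<in> K"
  then have "x \<in> bounded_ops X" using T by (rule K_perturb)
  then have "op_adj x - op_adj T = op_adj (x - T)" using T by (simp add: adj_diff)
  then show "star (op_algebra X) x - star (op_algebra X) T \<in> K" using K_props(8)[OF x] by simp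
qed simp

section \<open>Homomorphisms into the Calkin algebra\<close>

text \<open>
  Well defined on classes: two essential limits of the same sequence differ by a compact operator.
\<close>

definition \<pi>\<^sub>0 :: "(nat \<Rightarrow> (('v, 'e) path + 'e \<times> ('v, 'e) path) star_poly) set \<Rightarrow> ('v, 'e) path op set"
  where "\<pi>\<^sub>0 Z = cal (SOME T. \<exists>a. Z = cls a \<and> esslim a T)"

lemma pi0_cls:
  assumes "esslim a T"
  shows "\<pi>\<^sub>0 (cls a) = cal T"
proof -
  define T' where "T' = (SOME T. \<exists>b. cls a = cls b \<and> esslim b T)"
  have "\<exists>b. cls a = cls b \<and> esslim b T'" unfolding T'_def by (rule someI[of _ T]) (use assms in blast)
  then obtain b where b: "cls a = cls b" "esslim b T'" by blast
  then have "ess (T - T') = 0" using cls_eq_iff[OF assms b(2)] by simp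
  then have "cal T = cal T'" using cal_eq_iff esslimD(2)[OF assms] esslimD(2)[OF b(2)] by blast
  then show ?thesis by (simp add: \<pi>\<^sub>0_def T'_def)
qed

lemma ball_OE: "(\<And>a T. esslim a T \<Longrightarrow> P (cls a)) \<Longrightarrow> \<forall>Z\<in>carrier OE. P Z"
  by (auto simp: carrier_ck_algebra cauchy_esslim)

lemma cls_const: "ck_vert F w = cls (\<lambda>_. p w)" "ck_arc F f = cls (\<lambda>_. s f)"
  by (simp_all add: ck_vert_def ck_arc_def to_completion_def)

lemma pi0_star_hom: "star_hom \<pi>\<^sub>0 OE (calkin_algebra E)"
  unfolding star_hom_def
proof (intro conjI)
  show "\<pi>\<^sub>0 \<in> carrier OE \<rightarrow> carrier (calkin_algebra E)"
    by (auto simp: carrier_ck_algebra cauchy_esslim pi0_cls carrier_calkin) (rule imageI, erule esslimD(2))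
  show "\<forall>a\<in>carrier OE. \<forall>b\<in>carrier OE. \<pi>\<^sub>0 (a \<oplus>\<^bsub>OE\<^esub> b) = \<pi>\<^sub>0 a \<oplus>\<^bsub>calkin_algebra E\<^esub> \<pi>\<^sub>0 b"
    by (intro ball_OE) (simp add: cls_add cal_add pi0_cls[OF esslim_add] pi0_cls)
  show "\<forall>a\<in>carrier OE. \<forall>b\<in>carrier OE. \<pi>\<^sub>0 (a \<otimes>\<^bsub>OE\<^esub> b) = \<pi>\<^sub>0 a \<otimes>\<^bsub>calkin_algebra E\<^esub> \<pi>\<^sub>0 b"
    by (intro ball_OE) (simp add: cls_mult cal_mult pi0_cls[OF esslim_mult] pi0_cls esslimD(2))
  show "\<forall>c. \<forall>a\<in>carrier OE. \<pi>\<^sub>0 (c \<odot>\<^bsub>OE\<^esub> a) = c \<odot>\<^bsub>calkin_algebra E\<^esub> \<pi>\<^sub>0 a"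
    by (intro allI ball_OE) (simp add: cls_smult cal_smult pi0_cls[OF esslim_scale] pi0_cls)
  show "\<forall>a\<in>carrier OE. \<pi>\<^sub>0 (star OE a) = star (calkin_algebra E) (\<pi>\<^sub>0 a)"
    by (intro ball_OE) (simp add: cls_star cal_star pi0_cls[OF esslim_star] pi0_cls esslimD(2))
qed

lemma induced_hom_pi0: "induced_hom E n \<pi>\<^sub>0"
  unfolding induced_hom_def
proof (intro conjI ballI pi0_star_hom)
  fix w assume "w \<in> verts F"
  then have "esslim (\<lambda>_. p w) (rem_op w)" using esslim_const[of "p w"] by (simp add: psi_gen)
  then show "\<pi>\<^sub>0 (ck_vert F w) = cal (rem_proj E n w)" by (simp add: cls_const rem_proj_eq pi0_cls)
next
  fix f assume f: "f \<in> arcs F"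
  then have "esslim (\<lambda>_. s f) (edge_op f)" using esslim_const[of "s f"] by (simp add: psi_gen)
  then show "\<pi>\<^sub>0 (ck_arc F f) = cal (edge_shift E n f)" by (simp add: cls_const edge_shift_eq[OF f] pi0_cls)
qed

context
  fixes \<pi>
  assumes \<pi>: "induced_hom E n \<pi>"
begin

lemma hom: "star_hom \<pi> OE (calkin_algebra E)"
  using \<pi> by (simp add: induced_hom_def)

lemma cls_in_OE: "esslim a T \<Longrightarrow> cls a \<in> carrier OE"
  by (simp add: carrier_ck_algebra esslim_cauchy)

lemma hom_cls_exists: "esslim a T \<Longrightarrow> \<exists>S\<in>bounded_ops X. \<pi> (cls a) = cal S"
proof -
  assume "esslim a T"
  then have "\<pi> (cls a) \<in> carrier (calkin_algebra E)"
    using hom cls_in_OE unfolding star_hom_def by (auto dest: funcset_mem)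
  then show ?thesis by (auto simp: carrier_calkin)
qed

lemma hom_add:
  assumes "esslim a S" "esslim b T" "\<pi> (cls a) = cal S'" "\<pi> (cls b) = cal T'"
  shows "\<pi> (cls (\<lambda>k. a k + b k)) = cal (S' + T')"
proof -
  have "\<pi> (cls (\<lambda>k. a k + b k)) = \<pi> (cls a \<oplus>\<^bsub>OE\<^esub> cls b)" by (simp only: cls_add)
  also have "\<dots> = \<pi> (cls a) \<oplus>\<^bsub>calkin_algebra E\<^esub> \<pi> (cls b)"
    using hom cls_in_OE assms(1,2) unfolding star_hom_def by blast
  finally show ?thesis by (simp only: assms(3,4) cal_add)
qed

lemma hom_mult:
  assumes "esslim a S" "esslim b T" "\<pi> (cls a) = cal S'" "\<pi> (cls b) = cal T'"
    "S' \<in> bounded_ops X" "T' \<in> bounded_ops X"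
  shows "\<pi> (cls (\<lambda>k. a k \<star> b k)) = cal (S' o\<^sub>L T')"
proof -
  have "\<pi> (cls (\<lambda>k. a k \<star> b k)) = \<pi> (cls a \<otimes>\<^bsub>OE\<^esub> cls b)" by (simp only: cls_mult[OF assms(1,2)])
  also have "\<dots> = \<pi> (cls a) \<otimes>\<^bsub>calkin_algebra E\<^esub> \<pi> (cls b)"
    using hom cls_in_OE assms(1,2) unfolding star_hom_def by blast
  finally show ?thesis by (simp only: assms(3,4) cal_mult[OF assms(5,6)])
qed

lemma hom_scale:
  assumes "esslim a S" "\<pi> (cls a) = cal S'"
  shows "\<pi> (cls (\<lambda>k. fscale c (a k))) = cal (op_scale c S')"
proof -
  have "\<pi> (cls (\<lambda>k. fscale c (a k))) = \<pi> (c \<odot>\<^bsub>OE\<^esub> cls a)" by (simp only: cls_smult[OF assms(1)])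
  also have "\<dots> = c \<odot>\<^bsub>calkin_algebra E\<^esub> \<pi> (cls a)"
    using hom cls_in_OE assms(1) unfolding star_hom_def by blast
  finally show ?thesis by (simp only: assms(2) cal_smult)
qed

lemma hom_star:
  assumes "esslim a S" "\<pi> (cls a) = cal S'" "S' \<in> bounded_ops X"
  shows "\<pi> (cls (\<lambda>k. fstar (a k))) = cal (op_adj S')"
proof -
  have "\<pi> (cls (\<lambda>k. fstar (a k))) = \<pi> (star OE (cls a))" by (simp only: cls_star[OF assms(1)])
  also have "\<dots> = star (calkin_algebra E) (\<pi> (cls a))"
    using hom cls_in_OE assms(1) unfolding star_hom_def by blast
  finally show ?thesis by (simp only: assms(2) cal_star[OF assms(3)])
qed

lemma hom_diff:
  assumes "esslim a S" "esslim b T" "\<pi> (cls a) = cal S'" "\<pi> (cls b) = cal T'"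
  shows "\<pi> (cls (\<lambda>k. a k - b k)) = cal (S' - T')"
  using hom_add[OF assms(1) esslim_scale[OF assms(2)] assms(3) hom_scale[OF assms(2,4)], of "-1"]
  by (simp add: fscale_minus1 op_scale_simps)

lemma hom_const: "a \<in> C \<Longrightarrow> \<pi> (cls (\<lambda>_. a)) = cal (\<psi> a)"
proof (induction rule: free_induct)
  case (add a b)
  then show ?case using hom_add[OF esslim_const[of a] esslim_const[of b]] by (simp add: psi_simps)
next
  case zero
  have "0 \<in> C" by simp
  then obtain S where S: "S \<in> bounded_ops X" "\<pi> (cls (\<lambda>_. 0)) = cal S" using hom_cls_exists esslim_const by metis
  have "\<pi> (cls (\<lambda>_. 0)) = cal (op_scale 0 S)"
    using hom_scale[OF esslim_const[of 0] S(2), of 0] by simp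
  then show ?case by (simp add: op_scale_simps)
next
  case (mono c u)
  have letter: "\<pi> (cls (\<lambda>_. mono_word [l])) = cal (\<psi> (mono_word [l]))" if l: "fst l \<in> ck_gens F" for l
  proof -
    have gen: "\<pi> (cls (\<lambda>_. gen g)) = cal (\<psi> (gen g))" if "g \<in> ck_gens F" for g
    proof (cases g)
      case (Inl w)
      then show ?thesis using \<pi> that unfolding induced_hom_def
        by (auto simp: cls_const psi_gen rem_proj_eq simp del: F_simps)
    next
      case (Inr f)
      then show ?thesis using \<pi> that unfolding induced_hom_def
        by (auto simp: cls_const psi_gen edge_shift_eq simp del: F_simps)
    qed
    obtain g b where gb: "l = (g, b)" by (cases l)
    show ?thesis
    proof (cases b)
      case True
      have gC: "gen g \<in> C" using l by (simp add: gb)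
      have "\<pi> (cls (\<lambda>_. fstar (gen g))) = cal (op_adj (\<psi> (gen g)))"
        using hom_star[OF esslim_const[OF gC] gen] l A_bounded[OF psi_in_A[OF gC]] by (simp add: gb)
      then show ?thesis using gC True by (simp add: gb psi_simps flip: fstar_gen)
    qed (use gen[of g] l in \<open>simp add: gb gen_eq\<close>)
  qed
  have "\<pi> (cls (\<lambda>_. mono_word u)) = cal (\<psi> (mono_word u))" using mono
  proof (induction u)
    case Nil
    then show ?case by (simp add: words_def)
  next
    case (Cons l u)
    have l: "fst l \<in> ck_gens F" using Cons.prems by (simp add: words_Cons)
    show ?case
    proof (cases "u = []")
      case True
      then show ?thesis using letter[OF l] by simp
    next
      case False
      then have u: "u \<in> words (ck_gens F)" using Cons.prems by (simp add: words_Cons)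
      have C: "mono_word [l] \<in> C" "mono_word u \<in> C" using l u by (simp_all add: words_def)
      have "\<pi> (cls (\<lambda>_. mono_word [l] \<star> mono_word u)) = cal (\<psi> (mono_word [l]) o\<^sub>L \<psi> (mono_word u))"
        by (rule hom_mult[OF esslim_const[OF C(1)] esslim_const[OF C(2)] letter[OF l] Cons.IH[OF u]])
          (use C psi_in_A A_bounded in auto)
      also have "\<psi> (mono_word [l]) o\<^sub>L \<psi> (mono_word u) = \<psi> (mono_word [l] \<star> mono_word u)"
        using C by (simp only: psi_simps)
      finally show ?thesis by (simp add: mono_word_mult)
    qed
  qed
  then show ?case using mono hom_scale[OF esslim_const[of "mono_word u"]] by (simp add: psi_simps)
qed

text \<open>
  A homomorphism between the quotients preserves the identity \<open>S* S = 2 b - b\<^sup>2\<close> with self-adjoint \<open>b\<close>,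
  and in the Calkin algebra such an identity already bounds the essential norm by 1.
\<close>

lemma hom_contractive_unit:
  assumes a: "esslim a S" "S \<in> A" "ess S < 1" and T: "T \<in> bounded_ops X" "\<pi> (cls a) = cal T"
  shows "ess T \<le> 1"
proof -
  obtain S' where S': "S' \<in> A" "norm S' < 1" "ess (S' - S) = 0" using norm_lift[OF a(2,3)] by blast
  have a': "esslim a S'"
    by (rule esslim_cong_op[OF a(1)]) (use S' A_bounded ess_diff_commute[of S S'] in auto)
  obtain b where b: "b \<in> A" "op_adj b = b" "op_adj S' o\<^sub>L S' = op_scale 2 b - (b o\<^sub>L b)"
    using square_root_in_A[OF S'(1,2)] by blast
  obtain \<beta> where \<beta>: "esslim \<beta> b" using esslim_of_A[OF b(1)] by blast
  obtain B where B: "B \<in> bounded_ops X" "\<pi> (cls \<beta>) = cal B" using hom_cls_exists[OF \<beta>] by blast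
  have "cls (\<lambda>k. fstar (a k) \<star> a k) = cls (\<lambda>k. fscale 2 (\<beta> k) - \<beta> k \<star> \<beta> k)"
    using cls_eq_iff[OF esslim_mult[OF esslim_star[OF a'] a'] esslim_diff[OF esslim_scale[OF \<beta>, of 2] esslim_mult[OF \<beta> \<beta>]]] b(3)
    by simp
  moreover have "\<pi> (cls (\<lambda>k. fstar (a k) \<star> a k)) = cal (op_adj T o\<^sub>L T)"
    by (rule hom_mult[OF esslim_star[OF a'] a' hom_star[OF a' T(2,1)] T(2)]) (use T in auto)
  moreover have "\<pi> (cls (\<lambda>k. fscale 2 (\<beta> k) - \<beta> k \<star> \<beta> k)) = cal (op_scale 2 B - (B o\<^sub>L B))"
    by (rule hom_diff[OF esslim_scale[OF \<beta>] esslim_mult[OF \<beta> \<beta>] hom_scale[OF \<beta> B(2)] hom_mult[OF \<beta> \<beta> B(2,2,1,1)]])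
  ultimately have "cal (op_adj T o\<^sub>L T) = cal (op_scale 2 B - (B o\<^sub>L B))" by simp
  then have 1: "ess ((op_adj T o\<^sub>L T) - (op_scale 2 B - (B o\<^sub>L B))) = 0"
    using T(1) B(1) by (subst (asm) cal_eq_iff) auto
  have "cls (\<lambda>k. fstar (\<beta> k)) = cls \<beta>"
    using cls_eq_iff[OF esslim_star[OF \<beta>] \<beta>] b(2) by simp
  then have "cal (op_adj B) = cal B" using hom_star[OF \<beta> B(2,1)] B(2) by simp
  then have 2: "ess (op_adj B - B) = 0" using B(1) by (subst (asm) cal_eq_iff) auto
  have cB: "clin B" "clin T" using B(1) T(1) by auto
  have "ess ((op_adj T o\<^sub>L T) - (op_scale 2 B - (op_adj B o\<^sub>L B))) \<le> 0"
  proof -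
    let ?L = "(op_adj T o\<^sub>L T) - (op_scale 2 B - (B o\<^sub>L B))" and ?M = "(op_adj B - B) o\<^sub>L B"
    have "(op_adj T o\<^sub>L T) - (op_scale 2 B - (op_adj B o\<^sub>L B)) = ?L + ?M" by (simp add: op_comp_distrib)
    then have "ess ((op_adj T o\<^sub>L T) - (op_scale 2 B - (op_adj B o\<^sub>L B))) \<le> ess ?L + ess ?M"
      by (simp only: ess_add)
    moreover have "ess ?M \<le> ess (op_adj B - B) * ess B" by (rule ess_mult[OF cB(1)])
    ultimately show ?thesis unfolding 1 2 by linarith
  qed
  then show ?thesis by (intro ess_le_1_if_square_root[OF cB(2,1)] antisym) auto
qed

lemma hom_contractive:
  assumes a: "esslim a S" "S \<in> A" "ess S < c" and T: "T \<in> bounded_ops X" "\<pi> (cls a) = cal T"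
  shows "ess T \<le> c"
proof -
  have c: "0 < c" using a(3) ess_nonneg[of S] by linarith
  let ?d = "complex_of_real (1 / c)"
  have "ess (op_scale ?d T) \<le> 1"
  proof (rule hom_contractive_unit[OF esslim_scale[OF a(1)] A_scale[OF a(2)]])
    show "ess (op_scale ?d S) < 1" using a(3) c by (simp add: norm_divide)
    show "\<pi> (cls (\<lambda>k. fscale ?d (a k))) = cal (op_scale ?d T)" by (rule hom_scale[OF a(1) T(2)])
  qed (use T in auto)
  then show ?thesis using c by (simp add: norm_divide)
qed

text \<open>
  Contractivity on the difference of \<open>a\<close> and the constant sequence \<open>a k\<close> compares the image with
  \<open>\<psi> (a k)\<close>, which tends essentially to \<open>S\<close>.
\<close>

lemma hom_eq:
  assumes a: "esslim a S" and S: "S \<in> A"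
  shows "\<pi> (cls a) = cal S"
proof -
  obtain T where T: "T \<in> bounded_ops X" "\<pi> (cls a) = cal T" using hom_cls_exists[OF a] by blast
  have "ess (T - S) \<le> 0 + e" if e: "0 < e" for e
  proof -
    obtain k where k: "ess (S - \<psi> (a k)) < e/2"
      using LIMSEQ_D[OF esslimD(4)[OF a], of "e/2"] e by auto
    have ak: "a k \<in> C" using a by (rule esslimD)
    have "ess (T - \<psi> (a k)) \<le> e/2"
    proof (rule hom_contractive[OF esslim_diff[OF a esslim_const[OF ak]] _ k])
      show "S - \<psi> (a k) \<in> A" using S psi_in_A[OF ak] by (rule A_diff)
      show "T - \<psi> (a k) \<in> bounded_ops X" using T(1) A_bounded[OF psi_in_A[OF ak]] by auto
      show "\<pi> (cls (\<lambda>j. a j - a k)) = cal (T - \<psi> (a k))"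
        by (rule hom_diff[OF a esslim_const[OF ak] T(2) hom_const[OF ak]])
    qed
    then show ?thesis using ess_triangle[of T S "\<psi> (a k)"] k ess_diff_commute[of "\<psi> (a k)" S] by simp
  qed
  then have "ess (T - S) \<le> 0" by (rule field_le_epsilon)
  then have "ess (T - S) = 0" by (simp add: antisym)
  then have "cal T = cal S" using cal_eq_iff[OF T(1) A_bounded[OF S]] by simp
  then show ?thesis using T(2) by simp
qed

lemma carrier_esslim_A: "carrier OE = {cls a | a S. S \<in> A \<and> esslim a S}"
  unfolding carrier_ck_algebra using esslim_exists esslim_cauchy by blast

text \<open>
  By \<open>hom_eq\<close> the homomorphism is the passage to the essential limit, which is injective because
  null sequences are those with essential limit 0, and has range \<open>q(A)\<close> because every element of \<open>A\<close> is an
  essential limit.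
\<close>

lemma induced_hom_iso: "star_iso \<pi> OE (BD_image E n)"
  unfolding star_iso_def
proof
  have img: "\<pi> ` carrier OE = cal ` A"
  proof (rule equalityI; rule subsetI)
    fix Z assume "Z \<in> \<pi> ` carrier OE"
    then show "Z \<in> cal ` A" using hom_eq by (auto simp: carrier_esslim_A)
  next
    fix Z assume "Z \<in> cal ` A"
    then obtain S where S: "S \<in> A" "Z = cal S" by blast
    obtain a where a: "esslim a S" using esslim_of_A[OF S(1)] by blast
    then show "Z \<in> \<pi> ` carrier OE" using hom_eq[OF a S(1)] cls_in_OE[OF a] S(2) by (metis imageI)
  qed
  show "star_hom \<pi> OE (BD_image E n)"
  proof -
    have "\<pi> \<in> carrier OE \<rightarrow> cal ` A" using img by blast
    then show ?thesis using hom unfolding star_hom_def BD_image_def by simp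
  qed
  have "inj_on \<pi> (carrier OE)"
  proof (rule inj_onI)
    fix Y Z assume "Y \<in> carrier OE" "Z \<in> carrier OE" and eq: "\<pi> Y = \<pi> Z"
    then obtain a b S T where Y: "Y = cls a" "S \<in> A" "esslim a S" and Z: "Z = cls b" "T \<in> A" "esslim b T"
      by (auto simp: carrier_esslim_A)
    have "cal S = cal T" using eq hom_eq[OF Y(3,2)] hom_eq[OF Z(3,2)] by (simp add: Y Z)
    then have "ess (S - T) = 0" using cal_eq_iff[OF A_bounded[OF Y(2)] A_bounded[OF Z(2)]] by simp
    then show "Y = Z" using cls_eq_iff[OF Y(3) Z(3)] by (simp add: Y(1) Z(1))
  qed
  then show "bij_betw \<pi> (carrier OE) (carrier (BD_image E n))"
    using img by (simp add: bij_betw_def BD_image_def)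
qed

end

section \<open>The two descriptions of the quotient algebra\<close>

abbreviation "A_alg \<equiv> op_algebra X\<lparr>carrier := A\<rparr>"

sublocale BD: quotient_data A_alg "K \<inter> commutant"
proof
  show "S - T \<in> K \<inter> commutant" if "S \<in> K \<inter> commutant" "T \<in> K \<inter> commutant" for S T
  proof -
    have "S - T \<in> commutant" using that by (auto simp: commutant_def op_comp_distrib)
    then show ?thesis using that K_props(3) by blast
  qed
  show "0 \<in> K \<inter> commutant" using commutant_subalgebra K_props(2) by (auto simp: cstar_subalgebra_op)
qed (auto simp: A_0 A_diff)

abbreviation "bd T \<equiv> (K \<inter> commutant) +>\<^bsub>A_alg\<^esub> T"

lemma BD_algebra_eq: "BD_algebra E n = quot A_alg (K \<inter> commutant)"
  by (simp add: BD_algebra_def src_compacts_eq)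

lemma A_commutant: "T \<in> A \<Longrightarrow> T \<in> commutant"
  using A_subset_commutant by blast

lemma commutant_ops:
  "S \<in> commutant \<Longrightarrow> T \<in> commutant \<Longrightarrow> S o\<^sub>L T \<in> commutant" "S \<in> commutant \<Longrightarrow> T \<in> commutant \<Longrightarrow> S + T \<in> commutant"
  "T \<in> commutant \<Longrightarrow> op_scale c T \<in> commutant" "T \<in> commutant \<Longrightarrow> op_adj T \<in> commutant" "T \<in> commutant \<Longrightarrow> T \<in> bounded_ops X"
  using commutant_subalgebra unfolding cstar_subalgebra_op by blast+

lemma BD_perturb: "x - T \<in> K \<inter> commutant \<Longrightarrow> T \<in> A \<Longrightarrow> x \<in> commutant"
proof -
  assume "x - T \<in> K \<inter> commutant" "T \<in> A"
  then have "(x - T) + T \<in> commutant" by (intro commutant_ops(2)[OF _ A_commutant]) auto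
  then show "x \<in> commutant" by simp
qed

text \<open>
  Representatives may leave \<open>A\<close> inside their coset, but they stay in \<open>commutant\<close>, which is what closure of
  the ideal needs.
\<close>

lemma bd_ops:
  assumes S: "S \<in> A" and T: "T \<in> A"
  shows "bd S \<oplus>\<^bsub>BD_algebra E n\<^esub> bd T = bd (S + T)" "bd S \<otimes>\<^bsub>BD_algebra E n\<^esub> bd T = bd (S o\<^sub>L T)"
    "c \<odot>\<^bsub>BD_algebra E n\<^esub> bd T = bd (op_scale c T)" "star (BD_algebra E n) (bd T) = bd (op_adj T)"
proof -
  show "bd S \<oplus>\<^bsub>BD_algebra E n\<^esub> bd T = bd (S + T)" unfolding BD_algebra_eq by (rule BD.quot_add)
  show "bd S \<otimes>\<^bsub>BD_algebra E n\<^esub> bd T = bd (S o\<^sub>L T)"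
    unfolding BD_algebra_eq
  proof (subst BD.quot_mult)
    fix x y assume xy: "x - S \<in> K \<inter> commutant" "y - T \<in> K \<inter> commutant"
    have x: "x \<in> commutant" using xy(1) S by (rule BD_perturb)
    have "(x o\<^sub>L y) - (S o\<^sub>L T) = (x o\<^sub>L (y - T)) + ((x - S) o\<^sub>L T)" by (simp add: op_comp_distrib)
    also have "\<dots> \<in> K \<inter> commutant"
    proof
      show "(x o\<^sub>L (y - T)) + ((x - S) o\<^sub>L T) \<in> K"
        by (rule K_props(4)[OF K_props(6)[OF _ commutant_ops(5)[OF x]] K_props(5)[OF _ A_bounded[OF T]]]) (use xy in auto)
      show "(x o\<^sub>L (y - T)) + ((x - S) o\<^sub>L T) \<in> commutant"
        by (rule commutant_ops(2)[OF commutant_ops(1)[OF x] commutant_ops(1)[OF _ A_commutant[OF T]]]) (use xy in auto)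
    qed
    finally show "(x \<otimes>\<^bsub>A_alg\<^esub> y) - (S \<otimes>\<^bsub>A_alg\<^esub> T) \<in> K \<inter> commutant" by simp
  qed simp
  show "c \<odot>\<^bsub>BD_algebra E n\<^esub> bd T = bd (op_scale c T)"
    unfolding BD_algebra_eq
  proof (subst BD.quot_smult)
    fix x assume "x - T \<in> K \<inter> commutant"
    then have "op_scale c (x - T) \<in> K \<inter> commutant" by (auto intro: K_props(7) commutant_ops)
    then show "(c \<odot>\<^bsub>A_alg\<^esub> x) - (c \<odot>\<^bsub>A_alg\<^esub> T) \<in> K \<inter> commutant" by (simp add: op_scale_simps)
  qed simp
  show "star (BD_algebra E n) (bd T) = bd (op_adj T)"
    unfolding BD_algebra_eq
  proof (subst BD.quot_star)
    fix x assume x: "x - T \<in> K \<inter> commutant"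
    then have "x \<in> commutant" using T by (rule BD_perturb)
    then have "clin x" using commutant_ops(5) bounded_ops_clin by blast
    then have "op_adj x - op_adj T = op_adj (x - T)" using T by (simp add: adj_diff)
    then show "star A_alg x - star A_alg T \<in> K \<inter> commutant" using x by (simp add: K_props(8) commutant_ops)
  qed simp
qed

lemma BD_to_calkin_bd:
  shows "BD_to_calkin E (bd T) = cal T"
proof -
  have "BD_to_calkin E (bd T) = (\<Union>S\<in>bd T. cal T)"
    unfolding BD_to_calkin_def
  proof (intro SUP_cong refl)
    fix S assume "S \<in> bd T"
    then have "S - T \<in> K" by (simp add: BD.mem_coset_iff)
    then show "cal S = cal T" by (simp add: cal_eq Calk.coset_eq_iff)
  qed
  then show ?thesis using BD.mem_coset_self[of T] by auto
qed

text \<open>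
  Injectivity: an element of \<open>A\<close> that is compact commutes with the projections \<open>R\<^sub>x\<close> and therefore
  lies in \<open>\<KK>\<^sub>E\<close>.
\<close>

lemma BD_iso: "star_iso (BD_to_calkin E) (BD_algebra E n) (BD_image E n)"
proof -
  have car: "carrier (BD_algebra E n) = bd ` A" unfolding BD_algebra_eq BD.quot_carrier by simp
  have im: "carrier (BD_image E n) = cal ` A" "add (BD_image E n) = add (calkin_algebra E)"
    "mult (BD_image E n) = mult (calkin_algebra E)" "smult (BD_image E n) = smult (calkin_algebra E)"
    "star (BD_image E n) = star (calkin_algebra E)" by (simp_all add: BD_image_def)
  have "star_hom (BD_to_calkin E) (BD_algebra E n) (BD_image E n)"
    unfolding star_hom_def car im
    using A_bounded
    by (auto simp: BD_to_calkin_bd bd_ops cal_add cal_mult cal_smult cal_star)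
  moreover have "inj_on (BD_to_calkin E) (bd ` A)"
  proof (rule inj_onI)
    fix Y Z assume "Y \<in> bd ` A" "Z \<in> bd ` A" and eq: "BD_to_calkin E Y = BD_to_calkin E Z"
    then obtain S T where ST: "S \<in> A" "T \<in> A" "Y = bd S" "Z = bd T" by blast
    have "cal S = cal T" using eq by (simp add: ST BD_to_calkin_bd)
    then have "S - T \<in> K" by (simp add: cal_eq Calk.coset_eq_iff)
    moreover have "S - T \<in> commutant" using A_diff[OF ST(1,2)] by (rule A_commutant)
    ultimately show "Y = Z" by (simp add: ST BD.coset_eq_iff)
  qed
  moreover have "BD_to_calkin E ` bd ` A = cal ` A" by (simp add: image_image BD_to_calkin_bd)
  ultimately show ?thesis by (simp add: star_iso_def bij_betw_def car im)
qed

end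

theorem theorem5p3:
  fixes E :: "('v, 'e) pre_digraph" and n :: nat
  assumes fin: "fin_digraph E"
    and no_sinks: "\<forall>x\<in>verts E. out_arcs E x \<noteq> {}"
    and no_sources: "\<forall>x\<in>verts E. in_arcs E x \<noteq> {}"
    and n: "n \<ge> 1"
  shows "star_iso (BD_to_calkin E) (BD_algebra E n) (BD_image E n) \<and>
    (\<exists>\<pi>. induced_hom E n \<pi>) \<and>
    (\<forall>\<pi>. induced_hom E n \<pi> \<longrightarrow>
      star_iso \<pi> (ck_algebra (path_graph E n)) (BD_image E n))"
proof -
  interpret shift_setting E n
    by (rule shift_setting.intro) (use assms in auto)
  show ?thesis using BD_iso induced_hom_pi0 induced_hom_iso by blast
qed

end
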